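(* Let $d\ge1$, $s\in\mathbb{R}$, $1\le p<\infty$, and let $U$ be distributed according to the $B^s_{pp}$ prior on $\mathbb{T}^d$. Let $t<\widetilde t<s-d/p$, $\widetilde r>r>d/2$, and $w\in[r,\widetilde r]$, with $w>r$ if $p=1$. Let $A:B^t_{pp}(\mathbb{T}^d)\to B^{\widetilde r}_{11}(\mathbb{T}^d)$ be a bounded linear operator. Let $g:B^t_{pp}\to B^t_{pp}$ be a map such that for some $q\in[0,\infty)$ and $c<\infty$ $$\|g(u)\|_{B^t_{pp}}\le c(1+\|u\|_{B^t_{pp}})^q,\qquad \|g(u_1)-g(u_2)\|_{B^t_{pp}}\le c\|u_1-u_2\|_{B^t_{pp}}\left(1+\max(\|u_1\|_{B^t_{pp}},\|u_2\|_{B^t_{pp}})\right)^q$$ for all $u,u_1,u_2\in B^t_{pp}$. Let $T_n(\sum_{\ell=1}^\infty c_\ell\psi_\ell)=\sum_{\ell=1}^nc_\ell\psi_\ell$, $U_n=T_nU$, and assume $$\|I-T_n\|_{L(B^{\widetilde t}_{pp},B^t_{pp})}<\eta_2(n)\quad (n\ge1),\qquad \lim_{n\to\infty}\eta_2(n)=0.$$ Let $P_k:B^{\widetilde r}_{11}(\mathbb{T}^d)\to B^{\widetilde r}_{11}(\mathbb{T}^d)$ be bounded linear projections with $k$-dimensional range satisfying $$\|I-P_k\|_{L(B^{\widetilde r}_{11},B^r_{11})}<\eta_1(k)\quad (k\ge1),\qquad \lim_{k\to\infty}\eta_1(k)=0,$$ and assume $\|T_n\|_{L(B^{\widetilde t}_{pp})}\le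 C$ and $\|P_k\|_{L(B^{\widetilde r}_{11})}\le C$ for all $k,n\ge1$. Let $m,m_k\in B^{-r}_{\infty\infty}(\mathbb{T}^d)$ satisfy $\|m\|_{B^{-r}_{\infty\infty}}\le K$, $\|m_k\|_{B^{-r}_{\infty\infty}}\le K$ for all $k\ge1$, and $\eta_3(k):=\|m_k-m\|_{B^{-r}_{\infty\infty}}\to0$ as $k\to\infty$. Put $1/p+1/p'=1$ (with $2r/p'=0$ if $p=1$) and $$\gamma=1+\left(\frac{2q+8}{p}\right)\left(\frac{w}{w-r+2r/p'}\right).$$ Then there is a constant $C'=C'(A,g,t,r,w,p)$ (the remaining fixed data $s,d,\widetilde t,\widetilde r,C$ being fixed; $C'$ does not depend on $k,n,K,m,m_k$) such that $$\|\mathcal{R}_{\Theta_{kn}}(g(U_n)\,|\,m_k)-\mathcal{R}_M(g(U)\,|\,m)\|_{B^t_{pp}}\le C'(1+K)^\gamma\left[\eta_1(k)+\eta_2(n)+\eta_3(k)\right].$$ Moreover, the limit $\lim_{n\to\infty}\mathcal{R}_{\Theta_{kn}}(g(U_n)\,|\,m_k)$ exists for each fixed $k$, and $\lim_{k\to\infty}\mathcal{R}_{\Theta_{kn}}(g(U_n)\,|\,m_k)$ exists for each fixed $n$.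
   Context: Besov spaces. $\mathbb{T}^d$ is the $d$-dimensional torus. $(\psi_\ell)_{\ell\ge1}$ is a fixed orthonormal basis of $L^2(\mathbb{T}^d)$ consisting of periodized, compactly supported tensor-product wavelets of regularity large enough for all smoothness indices used; $\psi_1$ is the scaling function and the wavelets are numbered scale by scale, scale $j\ge0$ corresponding to $2^{jd}+1\le\ell\le2^{(j+1)d}$ (with $\ell=2,\dots,2^d$ for $j=0$). For $\sigma\in\mathbb{R}$ the Besov norm is by definition $$\Big\|\sum_{\ell=1}^\infty c_\ell\psi_\ell\Big\|_{B^\sigma_{pp}(\mathbb{T}^d)}=\Big(\sum_{\ell=1}^\infty\ell^{\,p\sigma/d+p/2-1}|c_\ell|^p\Big)^{1/p}\ (1\le p<\infty),\qquad \Big\|\sum_{\ell=1}^\infty c_\ell\psi_\ell\Big\|_{B^\sigma_{\infty\infty}(\mathbb{T}^d)}=\sup_{\ell\ge1}\ell^{\,\sigma/d+1/2}|c_\ell| .$$ $\langle f,h\rangle=\sum_\ell f_\ell h_\ell$ denotes the duality pairing of $f=\sum f_\ell\psi_\ell$ and $h=\sum h_\ell\psi_\ell$. $L(X,Y)$ denotes bounded linear operators, $L(X)=L(X,X)$. Prior. "$U$ is distributed according to the $B^s_{pp}$ prior" means $U=\sum_{\ell\ge1}\ell^{-(s/d+1/2-1/p)}X_\ell\psi_\ell$ with $X_\ell$ i.i.d. real random variables with density $c_p\exp(-|x|^p)$, $c_p=(\int_{\mathbb{R}}e^{-|x|^p}dx)^{-1}$. Reconstructors. With Bochner integrals/expectations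 in $B^t_{pp}$, $$\mathcal{R}_M(g(U)\,|\,m)=\frac{\mathbb{E}\left[g(U)\exp\left(-\frac12\|AU\|_{L^2}^2+\langle AU,m\rangle\right)\right]}{\mathbb{E}\exp\left(-\frac12\|AU\|_{L^2}^2+\langle AU,m\rangle\right)},$$ $$\mathcal{R}_{\Theta_{kn}}(g(U_n)\,|\,m_k)=\frac{\mathbb{E}\left[g(T_nU)\exp\left(-\frac12\|P_kAT_nU\|_{L^2}^2+\langle P_kAT_nU,m_k\rangle\right)\right]}{\mathbb{E}\exp\left(-\frac12\|P_kAT_nU\|_{L^2}^2+\langle P_kAT_nU,m_k\rangle\right)}.$$ These correspond to the models $M=AU+\mathcal{E}$ and $\Theta_{kn}=P_kAU_n+\mathcal{E}$, with $\mathcal{E}$ standard Gaussian white noise independent of $U$. *)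

theory Defs
  imports
    "HOL-Probability.Probability"
    "HOL-Library.Function_Algebras"
begin

instantiation "fun" :: (type, real_vector) real_vector
begin

definition scaleR_fun :: "real \<Rightarrow> ('a \<Rightarrow> 'b) \<Rightarrow> 'a \<Rightarrow> 'b" where
  "scaleR_fun a f = (\<lambda>x. a *\<^sub>R f x)"

instance
  by standard (auto simp: scaleR_fun_def fun_eq_iff algebra_simps)

end

definition square_integrable :: "'a measure \<Rightarrow> ('a \<Rightarrow> real) \<Rightarrow> bool" where
  "square_integrable M f \<longleftrightarrow> f \<in> borel_measurable M \<and> integrable M (\<lambda>x. (f x)\<^sup>2)"

definition orthonormal_basis :: "'a measure \<Rightarrow> 'i set \<Rightarrow> ('i \<Rightarrow> 'a \<Rightarrow> real) \<Rightarrow> bool" where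
  "orthonormal_basis M I e \<longleftrightarrow>
     (\<forall>i\<in>I. square_integrable M (e i)) \<and>
     (\<forall>i\<in>I. \<forall>j\<in>I. (LINT x|M. e i x * e j x) = (if i = j then 1 else 0)) \<and>
     (\<forall>f. square_integrable M f \<longrightarrow> (\<forall>i\<in>I. (LINT x|M. f x * e i x) = 0) \<longrightarrow> (AE x in M. f x = 0))"

text \<open>Functions on the \<open>d\<close>-dimensional torus are periodic functions on \<open>\<real>\<^sup>d\<close>, integrated over a
  unit cube; \<open>d = CARD('d)\<close>.\<close>

definition torus :: "(real ^ 'd) measure" where
  "torus = restrict_space lborel (cbox 0 1)"

definition periodize :: "(real ^ 'd \<Rightarrow> real) \<Rightarrow> real ^ 'd \<Rightarrow> real" where
  "periodize f = (\<lambda>x. \<Sum>\<^sub>\<infinity>z\<in>(UNIV :: (int ^ 'd) set). f (\<chi> i. x $ i + of_int (z $ i)))"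

definition C_k :: "nat \<Rightarrow> (real \<Rightarrow> real) \<Rightarrow> bool" where
  "C_k N f \<longleftrightarrow> (\<forall>i<N. \<forall>x. (deriv ^^ i) f field_differentiable at x) \<and>
     continuous_on UNIV ((deriv ^^ N) f)"

text \<open>\<open>\<phi>\<close> is the scaling function and \<open>\<omega>\<close> the mother wavelet of a compactly supported orthonormal
  multiresolution analysis of \<open>L\<^sup>2(\<real>)\<close>; \<open>h\<close> and \<open>b\<close> are the two filters.\<close>

definition wavelet_pair :: "nat \<Rightarrow> (real \<Rightarrow> real) \<Rightarrow> (real \<Rightarrow> real) \<Rightarrow> bool" where
  "wavelet_pair N \<phi> \<omega> \<longleftrightarrow>
     C_k N \<phi> \<and> C_k N \<omega> \<and> bounded {x. \<phi> x \<noteq> 0} \<and> bounded {x. \<omega> x \<noteq> 0} \<and>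
     (\<exists>h b :: int \<Rightarrow> real. finite {k. h k \<noteq> 0} \<and> finite {k. b k \<noteq> 0} \<and>
        (\<forall>x. \<phi> x = (\<Sum>k | h k \<noteq> 0. h k * \<phi> (2 * x - of_int k))) \<and>
        (\<forall>x. \<omega> x = (\<Sum>k | b k \<noteq> 0. b k * \<phi> (2 * x - of_int k)))) \<and>
     orthonormal_basis lborel (UNIV :: (int + nat \<times> int) set)
       (case_sum (\<lambda>k x. \<phi> (x - of_int k))
          (\<lambda>(j, k) x. 2 powr (real j / 2) * \<omega> (2 ^ j * x - of_int k)))"

text \<open>The wavelets \<open>\<psi> l\<close> are numbered from \<open>l = 1\<close>; the value \<open>\<psi> 0\<close> is never used.  Scale \<open>j\<close>
  consists of the \<open>(2 ^ d - 1) * 2 ^ (j * d)\<close> tensor products with shift \<open>k\<close> in which at least one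
  factor is a mother wavelet (the factors with \<open>e $ i\<close>), numbered in any order \<open>\<iota>\<close>.\<close>

definition wavelet_basis :: "nat \<Rightarrow> (nat \<Rightarrow> real ^ 'd \<Rightarrow> real) \<Rightarrow> bool" where
  "wavelet_basis N \<psi> \<longleftrightarrow>
     orthonormal_basis torus {1..} \<psi> \<and>
     (\<exists>\<phi> \<omega>. wavelet_pair N \<phi> \<omega> \<and>
        \<psi> 1 = periodize (\<lambda>x. \<Prod>i\<in>UNIV. \<phi> (x $ i)) \<and>
        (\<forall>j. \<exists>\<iota> :: nat \<Rightarrow> (bool ^ 'd) \<times> (int ^ 'd).
           bij_betw \<iota> {2 ^ (j * CARD('d)) + 1 .. 2 ^ ((j + 1) * CARD('d))}
             {(e, k). (\<exists>i. e $ i) \<and> (\<forall>i. 0 \<le> k $ i \<and> k $ i < 2 ^ j)} \<and>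
           (\<forall>l\<in>{2 ^ (j * CARD('d)) + 1 .. 2 ^ ((j + 1) * CARD('d))}.
              \<psi> l = periodize (\<lambda>x. \<Prod>i\<in>UNIV. 2 powr (real j / 2) *
                (if fst (\<iota> l) $ i then \<omega> else \<phi>) (2 ^ j * x $ i - of_int (snd (\<iota> l) $ i))))))"

text \<open>A formal series \<open>\<Sum>\<^sub>l c\<^sub>l \<psi>\<^sub>l\<close>, \<open>l \<ge> 1\<close>, is represented by its coefficients, shifted by one:
  \<open>u i\<close> is the coefficient of \<open>\<psi> (Suc i)\<close>.  Spaces of such series are given by their elements and a
  norm, which is meaningful on the elements only.\<close>

record series_space =
  elts :: "(nat \<Rightarrow> real) set"
  nrm :: "(nat \<Rightarrow> real) \<Rightarrow> real"

definition besov :: "nat \<Rightarrow> real \<Rightarrow> real \<Rightarrow> series_space" where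
  "besov d \<sigma> p =
     \<lparr>elts = {u. summable (\<lambda>i. real (Suc i) powr (p * \<sigma> / d + p / 2 - 1) * \<bar>u i\<bar> powr p)},
      nrm = (\<lambda>u. (\<Sum>i. real (Suc i) powr (p * \<sigma> / d + p / 2 - 1) * \<bar>u i\<bar> powr p) powr (1 / p))\<rparr>"

definition besov_inf :: "nat \<Rightarrow> real \<Rightarrow> series_space" where
  "besov_inf d \<sigma> =
     \<lparr>elts = {u. bdd_above (range (\<lambda>i. real (Suc i) powr (\<sigma> / d + 1 / 2) * \<bar>u i\<bar>))},
      nrm = (\<lambda>u. SUP i. real (Suc i) powr (\<sigma> / d + 1 / 2) * \<bar>u i\<bar>)\<rparr>"

definition pairing :: "(nat \<Rightarrow> real) \<Rightarrow> (nat \<Rightarrow> real) \<Rightarrow> real" where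
  "pairing u v = (\<Sum>i. u i * v i)"

definition L2_sum :: "(nat \<Rightarrow> real ^ 'd \<Rightarrow> real) \<Rightarrow> (nat \<Rightarrow> real) \<Rightarrow> (real ^ 'd \<Rightarrow> real) \<Rightarrow> bool" where
  "L2_sum \<psi> u f \<longleftrightarrow> square_integrable torus f \<and>
     (\<lambda>n. LINT x|torus. (f x - (\<Sum>i<n. u i * \<psi> (Suc i) x))\<^sup>2) \<longlonglongrightarrow> 0"

definition L2_norm :: "(nat \<Rightarrow> real ^ 'd \<Rightarrow> real) \<Rightarrow> (nat \<Rightarrow> real) \<Rightarrow> real" where
  "L2_norm \<psi> u = (THE a. \<exists>f. L2_sum \<psi> u f \<and> a = sqrt (LINT x|torus. (f x)\<^sup>2))"

definition bounded_op :: "series_space \<Rightarrow> series_space \<Rightarrow> ((nat \<Rightarrow> real) \<Rightarrow> nat \<Rightarrow> real) \<Rightarrow> bool" where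
  "bounded_op X Y T \<longleftrightarrow>
     (\<forall>u\<in>elts X. T u \<in> elts Y) \<and>
     (\<forall>u\<in>elts X. \<forall>v\<in>elts X. T (u + v) = T u + T v) \<and>
     (\<forall>a. \<forall>u\<in>elts X. T (a *\<^sub>R u) = a *\<^sub>R T u) \<and>
     (\<exists>b. \<forall>u\<in>elts X. nrm Y (T u) \<le> b * nrm X u)"

definition op_norm :: "series_space \<Rightarrow> series_space \<Rightarrow> ((nat \<Rightarrow> real) \<Rightarrow> nat \<Rightarrow> real) \<Rightarrow> real" where
  "op_norm X Y T = (SUP u \<in> {u \<in> elts X. nrm X u \<le> 1}. nrm Y (T u))"

definition converges_in :: "series_space \<Rightarrow> (nat \<Rightarrow> nat \<Rightarrow> real) \<Rightarrow> (nat \<Rightarrow> real) \<Rightarrow> bool" where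
  "converges_in X f u \<longleftrightarrow> u \<in> elts X \<and> (\<forall>\<^sub>F n in sequentially. f n \<in> elts X) \<and>
     (\<lambda>n. nrm X (f n - u)) \<longlonglongrightarrow> 0"

definition truncation :: "nat \<Rightarrow> (nat \<Rightarrow> real) \<Rightarrow> nat \<Rightarrow> real" where
  "truncation n u = (\<lambda>i. if Suc i \<le> n then u i else 0)"

definition besov_prior ::
  "nat \<Rightarrow> real \<Rightarrow> real \<Rightarrow> 'a measure \<Rightarrow> ('a \<Rightarrow> nat \<Rightarrow> real) \<Rightarrow> bool" where
  "besov_prior d s p \<Omega> U \<longleftrightarrow>
     (\<exists>X :: nat \<Rightarrow> 'a \<Rightarrow> real.
        prob_space.indep_vars \<Omega> (\<lambda>_. borel) X UNIV \<and>
        (\<forall>i. distributed \<Omega> lborel (X i)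
           (\<lambda>x. ennreal (exp (- (\<bar>x\<bar> powr p)) / (LINT y|lborel. exp (- (\<bar>y\<bar> powr p)))))) \<and>
        (\<forall>\<omega>\<in>space \<Omega>. \<forall>i. U \<omega> i = real (Suc i) powr (- (s / d + 1 / 2 - 1 / p)) * X i \<omega>))"

text \<open>The notion of \<^const>\<open>has_bochner_integral\<close>, for the norm of \<open>X\<close> instead of a type class norm.
  The measurability condition makes \<open>f\<close> almost everywhere the limit of simple functions.\<close>

definition has_bochner_integral_in ::
  "series_space \<Rightarrow> 'a measure \<Rightarrow> ('a \<Rightarrow> nat \<Rightarrow> real) \<Rightarrow> (nat \<Rightarrow> real) \<Rightarrow> bool" where
  "has_bochner_integral_in X M f v \<longleftrightarrow> v \<in> elts X \<and> (AE x in M. f x \<in> elts X) \<and>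
     (\<exists>\<sigma>. (\<forall>i. Bochner_Integration.simple_bochner_integrable M (\<sigma> i) \<and> \<sigma> i ` space M \<subseteq> elts X \<and>
              (\<lambda>x. nrm X (f x - \<sigma> i x)) \<in> borel_measurable M) \<and>
          (\<lambda>i. \<integral>\<^sup>+x. ennreal (nrm X (f x - \<sigma> i x)) \<partial>M) \<longlonglongrightarrow> 0 \<and>
          (\<lambda>i. nrm X (Bochner_Integration.simple_bochner_integral M (\<sigma> i) - v)) \<longlonglongrightarrow> 0)"

definition bochner_integral_in ::
  "series_space \<Rightarrow> 'a measure \<Rightarrow> ('a \<Rightarrow> nat \<Rightarrow> real) \<Rightarrow> nat \<Rightarrow> real" where
  "bochner_integral_in X M f = (THE v. has_bochner_integral_in X M f v)"

definition likelihood :: "(nat \<Rightarrow> real ^ 'd \<Rightarrow> real) \<Rightarrow> (nat \<Rightarrow> real) \<Rightarrow> (nat \<Rightarrow> real) \<Rightarrow> real" where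
  "likelihood \<psi> m z = exp (- (1 / 2) * (L2_norm \<psi> z)\<^sup>2 + pairing z m)"

text \<open>Reconstruction, in \<open>X\<close>, of the random element \<open>G\<close> from the data \<open>m\<close>, where \<open>Z\<close> is the noiseless
  observation.  In the instances below \<open>G\<close> and \<open>Z\<close> have the required regularity only almost surely,
  because the prior is carried by a Besov space only almost surely; hence the completion.\<close>

definition reconstructor ::
  "(nat \<Rightarrow> real ^ 'd \<Rightarrow> real) \<Rightarrow> series_space \<Rightarrow> 'a measure \<Rightarrow>
   ('a \<Rightarrow> nat \<Rightarrow> real) \<Rightarrow> ('a \<Rightarrow> nat \<Rightarrow> real) \<Rightarrow> (nat \<Rightarrow> real) \<Rightarrow> nat \<Rightarrow> real" where
  "reconstructor \<psi> X \<Omega> G Z m =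
     (1 / (LINT \<omega>|completion \<Omega>. likelihood \<psi> m (Z \<omega>))) *\<^sub>R
     bochner_integral_in X (completion \<Omega>) (\<lambda>\<omega>. likelihood \<psi> m (Z \<omega>) *\<^sub>R G \<omega>)"

definition reconstructor_exists ::
  "(nat \<Rightarrow> real ^ 'd \<Rightarrow> real) \<Rightarrow> series_space \<Rightarrow> 'a measure \<Rightarrow>
   ('a \<Rightarrow> nat \<Rightarrow> real) \<Rightarrow> ('a \<Rightarrow> nat \<Rightarrow> real) \<Rightarrow> (nat \<Rightarrow> real) \<Rightarrow> bool" where
  "reconstructor_exists \<psi> X \<Omega> G Z m \<longleftrightarrow>
     integrable (completion \<Omega>) (\<lambda>\<omega>. likelihood \<psi> m (Z \<omega>)) \<and>
     (LINT \<omega>|completion \<Omega>. likelihood \<psi> m (Z \<omega>)) > 0 \<and>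
     (\<exists>v. has_bochner_integral_in X (completion \<Omega>) (\<lambda>\<omega>. likelihood \<psi> m (Z \<omega>) *\<^sub>R G \<omega>) v)"

text \<open>The models with noiseless observation \<open>A U\<close> and \<open>P\<^sub>k A T\<^sub>n U\<close>, where \<open>Q\<close> stands for \<open>P\<^sub>k\<close>.\<close>

definition R_M ::
  "(nat \<Rightarrow> real ^ 'd \<Rightarrow> real) \<Rightarrow> series_space \<Rightarrow> 'a measure \<Rightarrow> ('a \<Rightarrow> nat \<Rightarrow> real) \<Rightarrow>
   ((nat \<Rightarrow> real) \<Rightarrow> nat \<Rightarrow> real) \<Rightarrow> ((nat \<Rightarrow> real) \<Rightarrow> nat \<Rightarrow> real) \<Rightarrow> (nat \<Rightarrow> real) \<Rightarrow> nat \<Rightarrow> real" where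
  "R_M \<psi> X \<Omega> U A g m = reconstructor \<psi> X \<Omega> (\<lambda>\<omega>. g (U \<omega>)) (\<lambda>\<omega>. A (U \<omega>)) m"

definition R_M_exists ::
  "(nat \<Rightarrow> real ^ 'd \<Rightarrow> real) \<Rightarrow> series_space \<Rightarrow> 'a measure \<Rightarrow> ('a \<Rightarrow> nat \<Rightarrow> real) \<Rightarrow>
   ((nat \<Rightarrow> real) \<Rightarrow> nat \<Rightarrow> real) \<Rightarrow> ((nat \<Rightarrow> real) \<Rightarrow> nat \<Rightarrow> real) \<Rightarrow> (nat \<Rightarrow> real) \<Rightarrow> bool" where
  "R_M_exists \<psi> X \<Omega> U A g m \<longleftrightarrow>
     reconstructor_exists \<psi> X \<Omega> (\<lambda>\<omega>. g (U \<omega>)) (\<lambda>\<omega>. A (U \<omega>)) m"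

definition R_Theta ::
  "(nat \<Rightarrow> real ^ 'd \<Rightarrow> real) \<Rightarrow> series_space \<Rightarrow> 'a measure \<Rightarrow> ('a \<Rightarrow> nat \<Rightarrow> real) \<Rightarrow>
   ((nat \<Rightarrow> real) \<Rightarrow> nat \<Rightarrow> real) \<Rightarrow> ((nat \<Rightarrow> real) \<Rightarrow> nat \<Rightarrow> real) \<Rightarrow>
   ((nat \<Rightarrow> real) \<Rightarrow> nat \<Rightarrow> real) \<Rightarrow> nat \<Rightarrow> (nat \<Rightarrow> real) \<Rightarrow> nat \<Rightarrow> real" where
  "R_Theta \<psi> X \<Omega> U A g Q n m =
     reconstructor \<psi> X \<Omega> (\<lambda>\<omega>. g (truncation n (U \<omega>))) (\<lambda>\<omega>. Q (A (truncation n (U \<omega>)))) m"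

definition R_Theta_exists ::
  "(nat \<Rightarrow> real ^ 'd \<Rightarrow> real) \<Rightarrow> series_space \<Rightarrow> 'a measure \<Rightarrow> ('a \<Rightarrow> nat \<Rightarrow> real) \<Rightarrow>
   ((nat \<Rightarrow> real) \<Rightarrow> nat \<Rightarrow> real) \<Rightarrow> ((nat \<Rightarrow> real) \<Rightarrow> nat \<Rightarrow> real) \<Rightarrow>
   ((nat \<Rightarrow> real) \<Rightarrow> nat \<Rightarrow> real) \<Rightarrow> nat \<Rightarrow> (nat \<Rightarrow> real) \<Rightarrow> bool" where
  "R_Theta_exists \<psi> X \<Omega> U A g Q n m \<longleftrightarrow>
     reconstructor_exists \<psi> X \<Omega> (\<lambda>\<omega>. g (truncation n (U \<omega>))) (\<lambda>\<omega>. Q (A (truncation n (U \<omega>)))) m"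

text \<open>Here \<open>1 - 1 / p\<close> is \<open>1 / p'\<close> for the conjugate exponent \<open>p'\<close>, and \<open>0\<close> for \<open>p = 1\<close>.\<close>

definition gamma_exponent :: "real \<Rightarrow> real \<Rightarrow> real \<Rightarrow> real \<Rightarrow> real" where
  "gamma_exponent p q r w = 1 + ((2 * q + 8) / p) * (w / (w - r + 2 * r * (1 - 1 / p)))"

end

theory Submission
  imports Defs
begin

text \<open>The reconstructions are ratios of Gaussian-type integrals \<open>E [exp \<Phi> g] / E [exp \<Phi>]\<close>, where \<open>\<Phi>\<close> is the
  log-likelihood of the data.  Splitting frequencies at a level adapted to \<open>1 + K\<close> gives
  \<open>\<Phi> \<le> C (1 + K)\<^sup>\<beta> + R\<^sup>p / 8\<close>, where \<open>\<beta> = 2 w / (w - r + 2 r / p')\<close> and \<open>R\<close> is the norm of the prior in \<open>besov d t' p\<close>,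
  which satisfies \<open>E [exp (R\<^sup>p / 2)] < \<infinity>\<close>.  The normalising constants are of exponential size in
  \<open>K\<close>, but posterior moments are not: outside \<open>R\<^sup>p \<le> 8 C (1 + K)\<^sup>\<beta>\<close> the prior beats the likelihood, and \<open>E [exp \<Phi>]\<close> is
  bounded below by Jensen's inequality because the linear part of \<open>\<Phi>\<close> has mean zero.  Hence the \<open>a\<close>-th
  posterior moment of \<open>R\<close> is at most a multiple of \<open>(1 + K)\<^bsup>\<beta> a / p\<^esup>\<close>.  Two log-likelihoods with
  \<open>\<bar>\<Phi>\<^sub>1 - \<Phi>\<^sub>2\<bar> \<le> \<epsilon> H (1 + R)\<^sup>2\<close> then have close posterior means: either \<open>\<epsilon>\<close> is so small that the two normalising
  constants are comparable, or the bound is trivial.\<close>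

section \<open>Weighted sequence spaces and their Bochner integral\<close>

text \<open>The fraction \<open>1 / 8\<close> in the upper bound is a budget: the likelihood, its
  part depending on \<open>K\<close>, and polynomial factors in \<open>R\<close> must jointly stay
  within the exponent \<open>1 / 2\<close>. The exponent \<open>\<beta>\<close> comes from balancing
  the cost \<open>K\<^sup>2 * y powr (2 * r)\<close> of the frequencies below the cutoff
  \<open>y\<close> against the cost of those above it, after Young's inequality has turned the
  latter into a pure power of \<open>1 + K\<close>. One factor \<open>1 + K\<close>, from the
  dependence of the log-likelihood on \<open>z\<close>, and posterior moments of total order
  \<open>q + 2\<close> account for \<open>\<gamma>\<close>.

  Two obstacles shape the formal proof. Spaces are sets of sequences with a norm rather than types,
  so Bochner integrals are computed coordinate by coordinate, and Minkowski's inequality leads back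
  to the norm. The operators and \<open>g\<close> are controlled only on Besov spaces, so
  measurability is derived from continuity along simple approximations of \<open>U\<close>. The
  constant is uniform in \<open>P\<close> because stability is proved for arbitrary operators below
  a fixed bound; the two limits follow from that same estimate with other reference models.\<close>

definition seq_space :: "(nat \<Rightarrow> real) \<Rightarrow> real \<Rightarrow> series_space" where
  "seq_space a p =
     \<lparr>elts = {u. summable (\<lambda>i. a i * \<bar>u i\<bar> powr p)},
      nrm = (\<lambda>u. (\<Sum>i. a i * \<bar>u i\<bar> powr p) powr (1 / p))\<rparr>"

definition besov_weight :: "nat \<Rightarrow> real \<Rightarrow> real \<Rightarrow> nat \<Rightarrow> real" where
  "besov_weight d \<sigma> p i = real (Suc i) powr (p * \<sigma> / d + p / 2 - 1)"

lemma besov_eq: "besov d \<sigma> p = seq_space (besov_weight d \<sigma> p) p"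
  by (simp add: besov_def seq_space_def besov_weight_def)

lemma besov_weight_pos [simp]: "0 < besov_weight d \<sigma> p i"
  by (simp add: besov_weight_def)

lemma besov_weight_mono:
  assumes "\<sigma> \<le> \<sigma>'" "0 \<le> p"
  shows "besov_weight d \<sigma> p i \<le> besov_weight d \<sigma>' p i"
  unfolding besov_weight_def using assms
  by (intro powr_mono) (auto intro!: divide_right_mono mult_left_mono)

text \<open>Writing the first factor as a power \<open>p - 1\<close> keeps the conjugate exponent
  out of the statement, so that \<open>p = 1\<close> is covered as well.\<close>

lemma Young_powr:
  fixes x y p :: real
  assumes "1 \<le> p" "0 \<le> x" "0 \<le> y"
  shows "x powr (p - 1) * y \<le> (1 - 1 / p) * x powr p + (1 / p) * y powr p"
proof (cases "p = 1")
  case True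
  then show ?thesis using assms by simp
next
  case False
  with assms have p: "p > 1" by simp
  show ?thesis
  proof (cases "x = 0 \<or> y = 0")
    case True
    then show ?thesis using p assms by auto
  next
    case False
    have "x powr (p - 1) * y = (y powr p) powr (1 / p) * (x powr p) powr (1 - 1 / p)"
      using p assms False by (auto simp: powr_powr right_diff_distrib)
    also have "\<dots> \<le> (1 / p) * y powr p + (1 - 1 / p) * x powr p"
      using p assms False by (intro Youngs_inequality_0) auto
    finally show ?thesis by simp
  qed
qed

text \<open>Normalise by the bounds \<open>X\<close> and \<open>Y\<close> and apply Young's
  inequality termwise. If \<open>Y = 0\<close> this division is impossible, but then
  \<open>y\<close> vanishes wherever the weight does not.\<close>

lemma Hoelder_sum_powr:
  fixes a x y :: "'i \<Rightarrow> real"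
  assumes p: "1 \<le> p" and a: "\<And>i. i \<in> I \<Longrightarrow> 0 \<le> a i" and fin: "finite I"
    and X: "0 < X" "(\<Sum>i\<in>I. a i * \<bar>x i\<bar> powr p) \<le> X powr p"
    and Y: "0 \<le> Y" "(\<Sum>i\<in>I. a i * \<bar>y i\<bar> powr p) \<le> Y powr p"
  shows "(\<Sum>i\<in>I. a i * \<bar>x i\<bar> powr (p - 1) * \<bar>y i\<bar>) \<le> X powr (p - 1) * Y"
proof (cases "Y = 0")
  case True
  have "(\<Sum>i\<in>I. a i * \<bar>y i\<bar> powr p) = 0"
    using Y True a sum_nonneg[of I "\<lambda>i. a i * \<bar>y i\<bar> powr p"] by auto
  then have "\<forall>i\<in>I. a i = 0 \<or> y i = 0"
    using a fin by (auto simp: sum_nonneg_eq_0_iff)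
  then have "(\<Sum>i\<in>I. a i * \<bar>x i\<bar> powr (p - 1) * \<bar>y i\<bar>) = 0"
    by (intro sum.neutral) auto
  then show ?thesis using True by simp
next
  case False
  with Y have Y0: "Y > 0" by simp
  have "(\<Sum>i\<in>I. a i * \<bar>x i\<bar> powr (p - 1) * \<bar>y i\<bar>) / (X powr (p - 1) * Y)
      = (\<Sum>i\<in>I. a i * ((\<bar>x i\<bar> / X) powr (p - 1) * (\<bar>y i\<bar> / Y)))"
    using X Y0 by (simp add: sum_divide_distrib powr_divide mult.assoc)
  also have "\<dots> \<le> (\<Sum>i\<in>I. a i * ((1 - 1 / p) * (\<bar>x i\<bar> / X) powr p + (1 / p) * (\<bar>y i\<bar> / Y) powr p))"
    using X Y0 a by (intro sum_mono mult_left_mono Young_powr p) auto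
  also have "\<dots> = (1 - 1 / p) * ((\<Sum>i\<in>I. a i * \<bar>x i\<bar> powr p) / X powr p)
      + (1 / p) * ((\<Sum>i\<in>I. a i * \<bar>y i\<bar> powr p) / Y powr p)"
    using X Y0 by (simp add: powr_divide sum.distrib sum_distrib_left sum_divide_distrib algebra_simps)
  also have "\<dots> \<le> (1 - 1 / p) * 1 + (1 / p) * 1"
    using X Y Y0 p by (intro add_mono mult_left_mono) auto
  finally show ?thesis using X Y0 by (simp add: field_simps)
qed

context
  fixes a :: "nat \<Rightarrow> real" and p :: real
  assumes a: "\<And>i. 0 < a i" and p: "1 \<le> p"
begin

private abbreviation (input) "E \<equiv> elts (seq_space a p)"
private abbreviation (input) "norm' \<equiv> nrm (seq_space a p)"

lemma seq_space_elts: "u \<in> E \<longleftrightarrow> summable (\<lambda>i. a i * \<bar>u i\<bar> powr p)"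
  by (simp add: seq_space_def)

lemma seq_space_nrm: "norm' u = (\<Sum>i. a i * \<bar>u i\<bar> powr p) powr (1 / p)"
  by (simp add: seq_space_def)

lemma seq_space_nrm_nonneg [simp]: "0 \<le> norm' u"
  by (simp add: seq_space_nrm)

lemma seq_space_nrm_powr:
  assumes "u \<in> E"
  shows "norm' u powr p = (\<Sum>i. a i * \<bar>u i\<bar> powr p)"
  using assms p less_imp_le[OF a]
  by (simp add: seq_space_nrm powr_powr seq_space_elts suminf_nonneg)

lemma seq_space_sum_le_nrm:
  assumes "u \<in> E"
  shows "(\<Sum>i<n. a i * \<bar>u i\<bar> powr p) \<le> norm' u powr p"
  unfolding seq_space_nrm_powr[OF assms] using assms less_imp_le[OF a]
  by (intro sum_le_suminf) (auto simp: seq_space_elts)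

lemma seq_space_nrm_leI:
  assumes "\<And>n. (\<Sum>i<n. a i * \<bar>u i\<bar> powr p) \<le> c powr p" "0 \<le> c"
  shows "u \<in> E" "norm' u \<le> c"
proof -
  have s: "summable (\<lambda>i. a i * \<bar>u i\<bar> powr p)"
    using assms less_imp_le[OF a]
    by (intro bounded_imp_summable[where B = "c powr p"])
       (simp_all only: lessThan_Suc_atMost[symmetric], auto)
  then show "u \<in> E" by (simp add: seq_space_elts)
  have "(\<Sum>i. a i * \<bar>u i\<bar> powr p) \<le> c powr p"
    by (rule suminf_le_const[OF s assms(1)])
  then have "norm' u \<le> (c powr p) powr (1 / p)"
    unfolding seq_space_nrm using p less_imp_le[OF a] s by (intro powr_mono2) (auto intro!: suminf_nonneg)
  then show "norm' u \<le> c" using p assms(2) by (simp add: powr_powr)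
qed

text \<open>Coordinates are continuous functionals because every weight is positive. Passages from
  the norm to integrals or limits of single coordinates rest on this bound.\<close>

lemma seq_space_coordinate:
  assumes "u \<in> E"
  shows "\<bar>u i\<bar> \<le> a i powr (- 1 / p) * norm' u"
proof -
  have "a i * \<bar>u i\<bar> powr p \<le> (\<Sum>j<Suc i. a j * \<bar>u j\<bar> powr p)"
    using less_imp_le[OF a] by (intro member_le_sum) auto
  also have "\<dots> \<le> norm' u powr p" by (rule seq_space_sum_le_nrm[OF assms])
  finally have "(a i * \<bar>u i\<bar> powr p) powr (1 / p) \<le> (norm' u powr p) powr (1 / p)"
    using p less_imp_le[OF a] by (intro powr_mono2) auto
  then have "a i powr (1 / p) * \<bar>u i\<bar> \<le> norm' u"
    using p less_imp_le[OF a] by (simp add: powr_mult powr_powr)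
  then have "a i powr (- 1 / p) * (a i powr (1 / p) * \<bar>u i\<bar>) \<le> a i powr (- 1 / p) * norm' u"
    by (intro mult_left_mono) auto
  then show ?thesis using a[of i] by (simp add: powr_minus powr_add[symmetric] mult.assoc[symmetric])
qed

lemma seq_space_0 [simp]: "0 \<in> E" "norm' 0 = 0"
  using p by (auto simp: seq_space_elts seq_space_nrm)

lemma seq_space_scaleR:
  assumes "u \<in> E"
  shows "c *\<^sub>R u \<in> E" "norm' (c *\<^sub>R u) = \<bar>c\<bar> * norm' u"
proof -
  have *: "(\<lambda>i. a i * \<bar>(c *\<^sub>R u) i\<bar> powr p) = (\<lambda>i. \<bar>c\<bar> powr p * (a i * \<bar>u i\<bar> powr p))"
    by (auto simp: scaleR_fun_def abs_mult powr_mult)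
  show "c *\<^sub>R u \<in> E" using assms unfolding seq_space_elts * by (rule summable_mult)
  show "norm' (c *\<^sub>R u) = \<bar>c\<bar> * norm' u"
    using assms p less_imp_le[OF a] unfolding seq_space_elts seq_space_nrm *
    by (simp add: suminf_mult powr_mult powr_powr suminf_nonneg)
qed

lemma seq_space_nrm_eq_0:
  assumes "u \<in> E" "norm' u = 0"
  shows "u = 0"
  using seq_space_coordinate[OF assms(1)] assms(2) by (auto simp: fun_eq_iff)

text \<open>Testing against the extremal sequence of the Hoelder inequality: both the triangle inequality and its
  integral version are instances.\<close>

lemma seq_space_nrm_le_dual:
  assumes S: "0 \<le> S"
    and dual: "\<And>n X. 0 < X \<Longrightarrow> (\<Sum>i<n. a i * \<bar>u i\<bar> powr p) = X powr p \<Longrightarrow>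
      (\<Sum>i<n. a i * \<bar>u i\<bar> powr (p - 1) * \<bar>u i\<bar>) \<le> X powr (p - 1) * S"
  shows "u \<in> E" "norm' u \<le> S"
proof -
  have *: "(\<Sum>i<n. a i * \<bar>u i\<bar> powr p) \<le> S powr p" for n
  proof (rule ccontr)
    define T where "T = (\<Sum>i<n. a i * \<bar>u i\<bar> powr p)"
    assume "\<not> T \<le> S powr p"
    then have T: "T > S powr p" by simp
    then have T0: "T > 0" using powr_ge_zero le_less_trans by blast
    \<comment> \<open>If the partial sum \<open>T\<close> exceeds \<open>S powr p\<close>, its
      \<open>p\<close>-th root \<open>X\<close> exceeds \<open>S\<close>, and the hypothesis taken
      with this \<open>X\<close> gives the contradiction
      \<open>T \<le> X powr (p - 1) * S < T\<close>.\<close>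
    define X where "X = T powr (1 / p)"
    have X: "X > 0" "X powr p = T" using T0 p by (auto simp: X_def powr_powr)
    have XT: "X > S"
    proof (rule ccontr)
      assume "\<not> ?thesis"
      then have "X powr p \<le> S powr p" using X p by (intro powr_mono2) auto
      with X T show False by simp
    qed
    have "T = (\<Sum>i<n. a i * \<bar>u i\<bar> powr (p - 1) * \<bar>u i\<bar>)"
      unfolding T_def
    proof (rule sum.cong)
      show "a i * \<bar>u i\<bar> powr p = a i * \<bar>u i\<bar> powr (p - 1) * \<bar>u i\<bar>" for i
        by (cases "u i = 0") (auto simp: powr_diff)
    qed simp
    also have "\<dots> \<le> X powr (p - 1) * S" using X by (intro dual) (auto simp: T_def)
    also have "\<dots> < X powr (p - 1) * X" using XT X by (intro mult_strict_left_mono) auto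
    also have "\<dots> = T" using X by (simp add: powr_diff)
    finally show False by simp
  qed
  show "u \<in> E" "norm' u \<le> S"
    by (rule seq_space_nrm_leI[OF *]; use S in simp)+
qed

lemma seq_space_add:
  assumes u: "u \<in> E" and v: "v \<in> E"
  shows "u + v \<in> E" "norm' (u + v) \<le> norm' u + norm' v"
proof -
  have *: "(\<Sum>i<n. a i * \<bar>(u + v) i\<bar> powr (p - 1) * \<bar>(u + v) i\<bar>) \<le> X powr (p - 1) * (norm' u + norm' v)"
    if X: "0 < X" "(\<Sum>i<n. a i * \<bar>(u + v) i\<bar> powr p) = X powr p" for n X
  proof -
    have "(\<Sum>i<n. a i * \<bar>(u + v) i\<bar> powr (p - 1) * \<bar>(u + v) i\<bar>)
      \<le> (\<Sum>i<n. a i * \<bar>(u + v) i\<bar> powr (p - 1) * (\<bar>u i\<bar> + \<bar>v i\<bar>))"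
      using less_imp_le[OF a] by (intro sum_mono mult_left_mono) auto
    also have "\<dots> = (\<Sum>i<n. a i * \<bar>(u + v) i\<bar> powr (p - 1) * \<bar>u i\<bar>) + (\<Sum>i<n. a i * \<bar>(u + v) i\<bar> powr (p - 1) * \<bar>v i\<bar>)"
      by (simp add: algebra_simps sum.distrib)
    also have "\<dots> \<le> X powr (p - 1) * norm' u + X powr (p - 1) * norm' v"
      using X u v less_imp_le[OF a]
      by (intro add_mono Hoelder_sum_powr p seq_space_sum_le_nrm) auto
    finally show ?thesis by (simp add: algebra_simps)
  qed
  show "u + v \<in> E" "norm' (u + v) \<le> norm' u + norm' v"
    by (rule seq_space_nrm_le_dual[OF _ *]; simp)+
qed

lemma seq_space_diff:
  assumes u: "u \<in> E" and v: "v \<in> E"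
  shows "u - v \<in> E" "norm' (u - v) \<le> norm' u + norm' v"
proof -
  have "(-1) *\<^sub>R v \<in> E" "norm' ((-1) *\<^sub>R v) = norm' v" using seq_space_scaleR[OF v, of "-1"] by auto
  then show "u - v \<in> E" "norm' (u - v) \<le> norm' u + norm' v"
    using seq_space_add[OF u, of "(-1) *\<^sub>R v"] by auto
qed

lemma seq_space_dominated:
  assumes "v \<in> E" "\<And>i. \<bar>u i\<bar> \<le> \<bar>v i\<bar>"
  shows "u \<in> E" "norm' u \<le> norm' v"
proof -
  have "(\<Sum>i<n. a i * \<bar>u i\<bar> powr p) \<le> norm' v powr p" for n
  proof -
    have "(\<Sum>i<n. a i * \<bar>u i\<bar> powr p) \<le> (\<Sum>i<n. a i * \<bar>v i\<bar> powr p)"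
      using less_imp_le[OF a] p assms by (intro sum_mono mult_left_mono powr_mono2) auto
    also have "\<dots> \<le> norm' v powr p" by (rule seq_space_sum_le_nrm[OF assms(1)])
    finally show ?thesis .
  qed
  then show "u \<in> E" "norm' u \<le> norm' v" by (auto intro!: seq_space_nrm_leI(1)[where c = "norm' v"] seq_space_nrm_leI(2))
qed

text \<open>Tannery's theorem, that is dominated convergence for series, applied to the
  \<open>p\<close>-th powers. Truncations and simple approximations both converge in norm for this
  reason.\<close>

lemma seq_space_tendsto_0:
  assumes v: "v \<in> E" and dom: "\<And>n i. \<bar>u n i\<bar> \<le> \<bar>v i\<bar>" and lim: "\<And>i. (\<lambda>n. u n i) \<longlonglongrightarrow> 0"
  shows "(\<lambda>n. norm' (u n)) \<longlonglongrightarrow> 0"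
proof -
  have lim': "(\<lambda>n. a i * \<bar>u n i\<bar> powr p) \<longlonglongrightarrow> 0" for i
  proof -
    have "(\<lambda>n. a i * \<bar>u n i\<bar> powr p) \<longlonglongrightarrow> a i * (0 powr p)"
      using p by (intro tendsto_intros tendsto_powr2 tendsto_rabs_zero lim) auto
    then show ?thesis by simp
  qed
  have "(\<lambda>n. \<Sum>i. a i * \<bar>u n i\<bar> powr p) \<longlonglongrightarrow> (\<Sum>i. 0)"
    using v p less_imp_le[OF a] dom lim'
    by (intro tannerys_theorem[where M = "\<lambda>i. a i * \<bar>v i\<bar> powr p", THEN conjunct2, THEN conjunct2])
       (auto simp: seq_space_elts abs_mult intro!: always_eventually mult_left_mono powr_mono2)
  then have "(\<lambda>n. (\<Sum>i. a i * \<bar>u n i\<bar> powr p) powr (1 / p)) \<longlonglongrightarrow> 0 powr (1 / p)"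
    using p less_imp_le[OF a] v dom
    by (intro tendsto_powr2)
       (auto simp: seq_space_elts intro!: always_eventually suminf_nonneg mult_left_mono powr_mono2
         summable_comparison_test_ev[where g = "\<lambda>i. a i * \<bar>v i\<bar> powr p"])
  then show ?thesis using p by (simp add: seq_space_nrm)
qed

lemma truncation_in_seq_space [simp]: "truncation n u \<in> E"
  unfolding seq_space_elts by (rule summable_finite[of "{..<n}"]) (auto simp: truncation_def)

lemma nrm_truncation_le: "u \<in> E \<Longrightarrow> norm' (truncation n u) \<le> norm' u"
  by (rule seq_space_dominated(2)) (auto simp: truncation_def)

lemma nrm_truncation_tendsto:
  assumes "u \<in> E"
  shows "(\<lambda>n. norm' (truncation n u - u)) \<longlonglongrightarrow> 0"
proof (rule seq_space_tendsto_0[OF assms])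
  show "\<bar>(truncation n u - u) i\<bar> \<le> \<bar>u i\<bar>" for n i by (auto simp: truncation_def)
  show "(\<lambda>n. (truncation n u - u) i) \<longlonglongrightarrow> 0" for i
    by (rule tendsto_eventually, rule eventually_sequentiallyI[of "Suc i"]) (simp add: truncation_def)
qed

lemma seq_space_mono:
  assumes b: "\<And>i. b i \<le> a i" "\<And>i. 0 \<le> b i" and u: "u \<in> E"
  shows "u \<in> elts (seq_space b p)" "nrm (seq_space b p) u \<le> norm' u"
proof -
  have s: "summable (\<lambda>i. b i * \<bar>u i\<bar> powr p)"
    using u b unfolding seq_space_elts
    by (rule_tac summable_comparison_test_ev) (auto intro!: always_eventually mult_right_mono)
  then show "u \<in> elts (seq_space b p)" by (simp add: seq_space_def)
  show "nrm (seq_space b p) u \<le> norm' u"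
    using s u b p unfolding seq_space_elts
    by (auto simp: seq_space_def intro!: powr_mono2 suminf_le suminf_nonneg mult_right_mono)
qed

section \<open>Integration of sequence-valued functions and the Bochner integral\<close>

lemma seq_space_nrm_measurable:
  assumes "\<And>j. (\<lambda>x. h x j) \<in> borel_measurable M"
  shows "(\<lambda>x. norm' (h x)) \<in> borel_measurable M"
  unfolding seq_space_nrm using assms by measurable

text \<open>Minkowski's integral inequality. The extremal sequence belonging to the integral does
  not depend on \<open>x\<close>, so Hoelder's inequality can be applied at each \<open>x\<close>
  and the finite sum exchanged with the integral.\<close>

lemma seq_space_integral:
  assumes meas: "\<And>j. (\<lambda>x. h x j) \<in> borel_measurable M" and AE: "AE x in M. h x \<in> E"
    and int: "integrable M (\<lambda>x. norm' (h x))"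
  shows "integrable M (\<lambda>x. h x j)" "(\<lambda>j. LINT x|M. h x j) \<in> E"
    "norm' (\<lambda>j. LINT x|M. h x j) \<le> (LINT x|M. norm' (h x))"
proof -
  have intj: "integrable M (\<lambda>x. h x j)" for j
  proof (rule Bochner_Integration.integrable_bound)
    show "integrable M (\<lambda>x. a j powr (- 1 / p) * norm' (h x))" using int by simp
    show "AE x in M. norm (h x j) \<le> norm (a j powr (- 1 / p) * norm' (h x))"
      using AE by eventually_elim (auto simp: abs_mult dest: seq_space_coordinate)
  qed (use meas in auto)
  show "integrable M (\<lambda>x. h x j)" by (rule intj)
  have *: "(\<Sum>i<n. a i * \<bar>LINT x|M. h x i\<bar> powr (p - 1) * \<bar>LINT x|M. h x i\<bar>)
      \<le> X powr (p - 1) * (LINT x|M. norm' (h x))"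
    if X: "0 < X" "(\<Sum>i<n. a i * \<bar>LINT x|M. h x i\<bar> powr p) = X powr p" for n X
  proof -
    have "(\<Sum>i<n. a i * \<bar>LINT x|M. h x i\<bar> powr (p - 1) * \<bar>LINT x|M. h x i\<bar>)
      \<le> (\<Sum>i<n. a i * \<bar>LINT x|M. h x i\<bar> powr (p - 1) * (LINT x|M. \<bar>h x i\<bar>))"
      using less_imp_le[OF a] by (intro sum_mono mult_left_mono integral_abs_bound) auto
    also have "\<dots> = (LINT x|M. (\<Sum>i<n. a i * \<bar>LINT x|M. h x i\<bar> powr (p - 1) * \<bar>h x i\<bar>))"
      using intj by simp
    also have "\<dots> \<le> (LINT x|M. X powr (p - 1) * norm' (h x))"
    proof (rule integral_mono_AE)
      show "AE x in M. (\<Sum>i<n. a i * \<bar>LINT x|M. h x i\<bar> powr (p - 1) * \<bar>h x i\<bar>) \<le> X powr (p - 1) * norm' (h x)"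
        using AE
      proof eventually_elim
        case (elim x)
        then show ?case
          using X less_imp_le[OF a] by (intro Hoelder_sum_powr p seq_space_sum_le_nrm) auto
      qed
    qed (use intj int in auto)
    also have "\<dots> = X powr (p - 1) * (LINT x|M. norm' (h x))" by simp
    finally show ?thesis .
  qed
  show "(\<lambda>j. LINT x|M. h x j) \<in> E" "norm' (\<lambda>j. LINT x|M. h x j) \<le> (LINT x|M. norm' (h x))"
    by (rule seq_space_nrm_le_dual[OF _ *]; simp)+
qed

text \<open>Sequences enter only as a real vector space; evaluation at \<open>j\<close> is linear on
  it, which is enough to compare with real integrals.\<close>

lemma simple_bochner_integral_coordinate:
  fixes f :: "'b \<Rightarrow> nat \<Rightarrow> real"
  assumes "Bochner_Integration.simple_bochner_integrable M f"
  shows "Bochner_Integration.simple_bochner_integral M f j = (LINT x|M. f x j)"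
    "integrable M (\<lambda>x. f x j)"
proof -
  have "linear (\<lambda>u :: nat \<Rightarrow> real. u j)" by (rule linearI) (auto simp: scaleR_fun_def)
  then have *: "Bochner_Integration.simple_bochner_integral M (\<lambda>x. f x j) = Bochner_Integration.simple_bochner_integral M f j"
    using assms by (rule simple_bochner_integral_linear)
  have "Bochner_Integration.simple_bochner_integrable M (\<lambda>x. f x j)"
    using simple_bochner_integrable_compose2[OF _ assms assms, of "\<lambda>u v. u j"] by simp
  then have **: "has_bochner_integral M (\<lambda>x. f x j) (Bochner_Integration.simple_bochner_integral M (\<lambda>x. f x j))"
    by (rule has_bochner_integral_simple_bochner_integrable)
  then show "Bochner_Integration.simple_bochner_integral M f j = (LINT x|M. f x j)"
    using * has_bochner_integral_integral_eq by metis
  show "integrable M (\<lambda>x. f x j)" using ** by (auto simp: integrable.simps)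
qed

text \<open>Uniqueness of the Bochner integral, without which the definite description
  \<open>bochner_integral_in\<close> would say nothing. In coordinate \<open>j\<close> the integrals
  of \<open>\<sigma> i\<close> converge to \<open>v j\<close> by norm convergence, and to the
  integral of \<open>h\<close> by convergence in the mean.\<close>

lemma has_bochner_integral_in_coordinate:
  assumes meas: "\<And>j. (\<lambda>x. h x j) \<in> borel_measurable M" and int: "\<And>j. integrable M (\<lambda>x. h x j)"
    and h: "has_bochner_integral_in (seq_space a p) M h v"
  shows "v = (\<lambda>j. LINT x|M. h x j)"
proof
  fix j
  from h obtain \<sigma> where v: "v \<in> E" and AE: "AE x in M. h x \<in> E"
    and s: "\<And>i. Bochner_Integration.simple_bochner_integrable M (\<sigma> i)" "\<And>i. \<sigma> i ` space M \<subseteq> E"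
    and lim: "(\<lambda>i. \<integral>\<^sup>+x. ennreal (norm' (h x - \<sigma> i x)) \<partial>M) \<longlonglongrightarrow> 0"
    and limv: "(\<lambda>i. norm' (Bochner_Integration.simple_bochner_integral M (\<sigma> i) - v)) \<longlonglongrightarrow> 0"
    unfolding has_bochner_integral_in_def by blast
  define c where "c = a j powr (- 1 / p)"
  have c: "c \<ge> 0" by (simp add: c_def)
  have sE: "Bochner_Integration.simple_bochner_integral M (\<sigma> i) \<in> E" for i
  proof -
    have *: "(\<Sum>y\<in>A. f y *\<^sub>R y) \<in> E" if "finite A" "A \<subseteq> E" for A f
      using that by (induction A rule: finite_induct) (auto simp del: plus_fun_apply intro!: seq_space_add seq_space_scaleR)
    show ?thesis
      unfolding simple_bochner_integral_def using s(2)[of i] s(1)[of i]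
      by (intro *) (auto elim!: simple_bochner_integrable.cases simp: simple_function_def)
  qed
  note sj = simple_bochner_integral_coordinate[OF s(1)]
  have "(\<lambda>i. LINT x|M. \<sigma> i x j) \<longlonglongrightarrow> (LINT x|M. h x j)"
  proof (rule tendsto_L1_int[OF sj(2) int])
    have "(\<lambda>i. c * (\<integral>\<^sup>+x. ennreal (norm' (h x - \<sigma> i x)) \<partial>M)) \<longlonglongrightarrow> ennreal c * 0"
      by (intro ennreal_tendsto_cmult lim) auto
    moreover have "(\<integral>\<^sup>+x. norm (\<sigma> i x j - h x j) \<partial>M) \<le> c * (\<integral>\<^sup>+x. ennreal (norm' (h x - \<sigma> i x)) \<partial>M)" for i
    proof -
      have "(\<lambda>x. \<sigma> i x j') \<in> borel_measurable M" for j' using sj(2)[of i j'] by auto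
      then have m: "(\<lambda>x. norm' (h x - \<sigma> i x)) \<in> borel_measurable M"
        using meas by (intro seq_space_nrm_measurable) auto
      have "(\<integral>\<^sup>+x. norm (\<sigma> i x j - h x j) \<partial>M) \<le> (\<integral>\<^sup>+x. ennreal c * ennreal (norm' (h x - \<sigma> i x)) \<partial>M)"
      proof (rule nn_integral_mono_AE)
        show "AE x in M. ennreal (norm (\<sigma> i x j - h x j)) \<le> ennreal c * ennreal (norm' (h x - \<sigma> i x))"
          using AE AE_space
        proof eventually_elim
          case (elim x)
          then have "h x - \<sigma> i x \<in> E" using s by (intro seq_space_diff) auto
          from seq_space_coordinate[OF this, of j] show ?case
            by (auto simp: ennreal_mult[symmetric] c_def abs_minus_commute intro!: ennreal_leI)
        qed
      qed
      also have "\<dots> = c * (\<integral>\<^sup>+x. ennreal (norm' (h x - \<sigma> i x)) \<partial>M)"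
        using m by (intro nn_integral_cmult) auto
      finally show ?thesis .
    qed
    ultimately show "(\<lambda>i. \<integral>\<^sup>+x. norm (\<sigma> i x j - h x j) \<partial>M) \<longlonglongrightarrow> 0"
      using tendsto_sandwich[where f = "\<lambda>_. 0" and g = "\<lambda>i. \<integral>\<^sup>+x. norm (\<sigma> i x j - h x j) \<partial>M" and c = 0
          and h = "\<lambda>i. ennreal c * (\<integral>\<^sup>+x. ennreal (norm' (h x - \<sigma> i x)) \<partial>M)" and net = sequentially]
      by simp
  qed
  moreover have "(\<lambda>i. LINT x|M. \<sigma> i x j) \<longlonglongrightarrow> v j"
  proof (rule LIM_zero_cancel, rule Lim_null_comparison)
    have "(\<lambda>i. c * norm' (Bochner_Integration.simple_bochner_integral M (\<sigma> i) - v)) \<longlonglongrightarrow> c * 0"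
      by (intro tendsto_intros limv)
    then show "(\<lambda>i. c * norm' (Bochner_Integration.simple_bochner_integral M (\<sigma> i) - v)) \<longlonglongrightarrow> 0" by simp
    show "\<forall>\<^sub>F i in sequentially. norm ((LINT x|M. \<sigma> i x j) - v j) \<le> c * norm' (Bochner_Integration.simple_bochner_integral M (\<sigma> i) - v)"
      using seq_space_coordinate[OF seq_space_diff(1)[OF sE v], of _ j]
      by (intro always_eventually allI) (auto simp: sj(1) c_def)
  qed
  ultimately show "v j = (LINT x|M. h x j)" using LIMSEQ_unique by blast
qed

text \<open>Stage \<open>i\<close> approximates the first \<open>i\<close> coordinates by simple
  functions and drops the others, hence takes finitely many values, all in the space even where
  \<open>h\<close> is not. Each coordinate is bounded by \<open>2 * \<bar>h x j\<bar>\<close>, so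
  the error is dominated by \<open>3 *\<^sub>R h x\<close> and tends to 0 in norm.\<close>

lemma seq_space_simple_approximation:
  assumes meas: "\<And>j. (\<lambda>x. h x j) \<in> borel_measurable M"
  obtains \<sigma> where "\<And>i. simple_function M (\<sigma> i)" "\<And>i x. \<sigma> i x \<in> E"
    "\<And>i x. x \<in> space M \<Longrightarrow> h x \<in> E \<Longrightarrow> norm' (h x - \<sigma> i x) \<le> 3 * norm' (h x)"
    "\<And>x. x \<in> space M \<Longrightarrow> h x \<in> E \<Longrightarrow> (\<lambda>i. norm' (h x - \<sigma> i x)) \<longlonglongrightarrow> 0"
proof -
  have "\<exists>F. (\<forall>i. simple_function M (F i)) \<and> (\<forall>x\<in>space M. (\<lambda>i. F i x) \<longlonglongrightarrow> h x j) \<and>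
    (\<forall>i. \<forall>x\<in>space M. dist (F i x) 0 \<le> 2 * dist (h x j) 0)" for j
    by (rule borel_measurable_implies_sequence_metric) (use meas in simp)
  then have "\<forall>j. \<exists>F. (\<forall>i. simple_function M (F i)) \<and> (\<forall>x\<in>space M. (\<lambda>i. F i x) \<longlonglongrightarrow> h x j) \<and>
    (\<forall>i. \<forall>x\<in>space M. dist (F i x) 0 \<le> 2 * dist (h x j) 0)" by blast
  then obtain F where *: "\<forall>j. (\<forall>i. simple_function M (F j i)) \<and> (\<forall>x\<in>space M. (\<lambda>i. F j i x) \<longlonglongrightarrow> h x j) \<and>
    (\<forall>i. \<forall>x\<in>space M. dist (F j i x) 0 \<le> 2 * dist (h x j) 0)"
    by (rule choice[THEN exE])
  then have F: "\<And>j i. simple_function M (F j i)" "\<And>j x. x \<in> space M \<Longrightarrow> (\<lambda>i. F j i x) \<longlonglongrightarrow> h x j"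
    "\<And>j i x. x \<in> space M \<Longrightarrow> \<bar>F j i x\<bar> \<le> 2 * \<bar>h x j\<bar>"
    by (auto simp: dist_real_def)
  define \<sigma> where "\<sigma> i x = truncation i (\<lambda>j. F j i x)" for i x
  have \<sigma>_le: "\<bar>\<sigma> i x j\<bar> \<le> 2 * \<bar>h x j\<bar>" if "x \<in> space M" for i x j
    using F(3)[OF that] by (auto simp: \<sigma>_def truncation_def)
  have \<sigma>_lim: "(\<lambda>i. \<sigma> i x j) \<longlonglongrightarrow> h x j" if "x \<in> space M" for x j
  proof (rule Lim_transform_eventually[OF F(2)[OF that]])
    show "\<forall>\<^sub>F i in sequentially. F j i x = \<sigma> i x j"
      by (rule eventually_sequentiallyI[of "Suc j"]) (simp add: truncation_def \<sigma>_def)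
  qed
  have simple: "simple_function M (\<sigma> i)" for i
  proof -
    \<comment> \<open>The number \<open>k\<close> of coordinates kept is separated from the stage
      \<open>i\<close>, so that the induction adds one simple coordinate at a time.\<close>
    have "simple_function M (\<lambda>x. truncation k (\<lambda>j. F j i x))" for k
    proof (induction k)
      case 0
      then show ?case by (simp add: truncation_def)
    next
      case (Suc k)
      have eq: "truncation (Suc k) u = (truncation k u)(k := u k)" for u
        by (auto simp: truncation_def fun_eq_iff)
      then show ?case
        using simple_function_compose2[OF Suc F(1)[of k i], of "\<lambda>u y. u(k := y)"] by (simp only: eq)
    qed
    then show ?thesis by (simp only: \<sigma>_def[abs_def])
  qed
  have h\<sigma>: "h x - \<sigma> i x \<in> E" "norm' (h x - \<sigma> i x) \<le> 3 * norm' (h x)" if "h x \<in> E" "x \<in> space M" for i x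
  proof -
    have 3: "3 *\<^sub>R h x \<in> E" "norm' (3 *\<^sub>R h x) = 3 * norm' (h x)" using seq_space_scaleR[OF that(1), of 3] by auto
    have "\<bar>(h x - \<sigma> i x) j\<bar> \<le> \<bar>(3 *\<^sub>R h x) j\<bar>" for j
      using \<sigma>_le[OF that(2), of i j] by (auto simp: scaleR_fun_def)
    from seq_space_dominated[where u = "h x - \<sigma> i x", OF 3(1) this]
    show "h x - \<sigma> i x \<in> E" "norm' (h x - \<sigma> i x) \<le> 3 * norm' (h x)" unfolding 3(2) by blast+
  qed
  have lim: "(\<lambda>i. norm' (h x - \<sigma> i x)) \<longlonglongrightarrow> 0" if "h x \<in> E" "x \<in> space M" for x
  proof (rule seq_space_tendsto_0)
    show "3 *\<^sub>R h x \<in> E" using seq_space_scaleR[OF that(1), of 3] by auto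
    show "\<bar>(h x - \<sigma> i x) j\<bar> \<le> \<bar>(3 *\<^sub>R h x) j\<bar>" for i j
      using \<sigma>_le[OF that(2), of i j] by (auto simp: scaleR_fun_def)
    show "(\<lambda>i. (h x - \<sigma> i x) j) \<longlonglongrightarrow> 0" for j
      using tendsto_diff[OF tendsto_const \<sigma>_lim[OF that(2), of j], of "h x j"] by simp
  qed
  have \<sigma>E: "\<sigma> i x \<in> E" for i x by (simp add: \<sigma>_def)
  show thesis by (rule that[of \<sigma>]) (fact simple, fact \<sigma>E, use h\<sigma> lim in auto)
qed

text \<open>Along the simple approximations the errors are dominated by
  \<open>3 * norm' (h x)\<close>, so they tend to 0 in the mean; Minkowski's inequality carries this
  over to the integrals. Finiteness of the measure makes every simple function admissible.\<close>

lemma has_bochner_integral_in_seq_space: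
  assumes fin: "finite_measure M"
    and meas: "\<And>j. (\<lambda>x. h x j) \<in> borel_measurable M" and AE: "AE x in M. h x \<in> E"
    and int: "integrable M (\<lambda>x. norm' (h x))"
  shows "has_bochner_integral_in (seq_space a p) M h (\<lambda>j. LINT x|M. h x j)"
proof -
  obtain \<sigma> where simple: "\<And>i. simple_function M (\<sigma> i)" and \<sigma>E: "\<And>i x. \<sigma> i x \<in> E"
    and h\<sigma>: "\<And>i x. x \<in> space M \<Longrightarrow> h x \<in> E \<Longrightarrow> norm' (h x - \<sigma> i x) \<le> 3 * norm' (h x)"
    and lim: "\<And>x. x \<in> space M \<Longrightarrow> h x \<in> E \<Longrightarrow> (\<lambda>i. norm' (h x - \<sigma> i x)) \<longlonglongrightarrow> 0"
    using seq_space_simple_approximation[of h M, OF meas] by blast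
  have sb: "Bochner_Integration.simple_bochner_integrable M (\<sigma> i)" for i
    using simple finite_measure.emeasure_finite[OF fin] by (intro simple_bochner_integrable.intros) auto
  note sj = simple_bochner_integral_coordinate[OF sb]
  have m\<sigma>: "(\<lambda>x. \<sigma> i x j) \<in> borel_measurable M" for i j using sj(2)[of i j] by auto
  have m: "(\<lambda>x. norm' (h x - \<sigma> i x)) \<in> borel_measurable M" for i
    using meas m\<sigma> by (intro seq_space_nrm_measurable) auto
  have L1: "integrable M (\<lambda>x. norm' (h x - \<sigma> i x))" for i
  proof (rule Bochner_Integration.integrable_bound)
    show "integrable M (\<lambda>x. 3 * norm' (h x))" using int by simp
    show "AE x in M. norm (norm' (h x - \<sigma> i x)) \<le> norm (3 * norm' (h x))"
      using AE AE_space by eventually_elim (use h\<sigma> in auto)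
  qed (rule m)
  have L1_lim: "(\<lambda>i. LINT x|M. norm' (h x - \<sigma> i x)) \<longlonglongrightarrow> (LINT x|M. 0)"
  proof (rule integral_dominated_convergence)
    show "integrable M (\<lambda>x. 3 * norm' (h x))" using int by simp
    show "AE x in M. norm (norm' (h x - \<sigma> i x)) \<le> 3 * norm' (h x)" for i
      using AE AE_space by eventually_elim (use h\<sigma> in auto)
    show "AE x in M. (\<lambda>i. norm' (h x - \<sigma> i x)) \<longlonglongrightarrow> 0"
      using AE AE_space by eventually_elim (use lim in auto)
  qed (use m in auto)
  have diff: "norm' (Bochner_Integration.simple_bochner_integral M (\<sigma> i) - (\<lambda>j. LINT x|M. h x j))
      \<le> (LINT x|M. norm' (h x - \<sigma> i x))" for i
  proof -
    have neg: "norm' u = norm' (- u)" for u by (simp add: seq_space_nrm)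
    have "- (Bochner_Integration.simple_bochner_integral M (\<sigma> i) - (\<lambda>j. LINT x|M. h x j)) = (\<lambda>j. LINT x|M. (h x - \<sigma> i x) j)"
      using seq_space_integral(1)[OF meas AE int] sj by (auto simp: fun_eq_iff)
    moreover have "norm' (\<lambda>j. LINT x|M. (h x - \<sigma> i x) j) \<le> (LINT x|M. norm' (h x - \<sigma> i x))"
    proof (rule seq_space_integral(3)[where h = "\<lambda>x. h x - \<sigma> i x", OF _ _ L1])
      show "AE x in M. h x - \<sigma> i x \<in> E" using AE AE_space
        by eventually_elim (use \<sigma>E in \<open>auto intro!: seq_space_diff simp del: fun_diff_def\<close>)
    qed (use meas m\<sigma> in simp)
    ultimately show ?thesis by (subst neg) simp
  qed
  show ?thesis
    unfolding has_bochner_integral_in_def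
  proof (intro conjI exI[of _ \<sigma>] allI)
    show "(\<lambda>j. LINT x|M. h x j) \<in> E" by (rule seq_space_integral[OF meas AE int])
    show "(\<lambda>i. \<integral>\<^sup>+x. ennreal (norm' (h x - \<sigma> i x)) \<partial>M) \<longlonglongrightarrow> 0"
      using L1_lim by (subst nn_integral_eq_integral[OF L1]) (auto simp: tendsto_ennreal_iff[where x = 0, simplified])
    show "(\<lambda>i. norm' (Bochner_Integration.simple_bochner_integral M (\<sigma> i) - (\<lambda>j. LINT x|M. h x j))) \<longlonglongrightarrow> 0"
      by (rule Lim_null_comparison[where g = "\<lambda>i. LINT x|M. norm' (h x - \<sigma> i x)"])
         (use L1_lim diff in auto)
    show "\<sigma> i ` space M \<subseteq> E" for i using \<sigma>E by auto
  qed (use AE sb m in auto)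
qed

lemma bochner_integral_in_seq_space:
  assumes fin: "finite_measure M"
    and meas: "\<And>j. (\<lambda>x. h x j) \<in> borel_measurable M" and AE: "AE x in M. h x \<in> E"
    and int: "integrable M (\<lambda>x. norm' (h x))"
  shows "bochner_integral_in (seq_space a p) M h = (\<lambda>j. LINT x|M. h x j)"
  unfolding bochner_integral_in_def
proof (rule the_equality)
  show "has_bochner_integral_in (seq_space a p) M h (\<lambda>j. LINT x|M. h x j)"
    by (rule has_bochner_integral_in_seq_space[OF assms])
  show "v = (\<lambda>j. LINT x|M. h x j)" if "has_bochner_integral_in (seq_space a p) M h v" for v
    using has_bochner_integral_in_coordinate[where h = h, OF meas _ that] seq_space_integral(1)[where h = h, OF meas AE int]
    by blast
qed

end

section \<open>The norm of square integrable functions in terms of coefficients\<close>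

text \<open>Monotone convergence: the sum has finite integral, hence is finite almost
  everywhere.\<close>

lemma AE_summable_of_integral:
  fixes f :: "nat \<Rightarrow> 'a \<Rightarrow> real"
  assumes int: "\<And>i. integrable M (f i)" and nonneg: "\<And>i x. 0 \<le> f i x"
    and sum: "summable (\<lambda>i. LINT x|M. f i x)"
  shows "AE x in M. summable (\<lambda>i. f i x)"
proof -
  have [measurable]: "f i \<in> borel_measurable M" for i using int by auto
  have "(\<integral>\<^sup>+x. (\<Sum>i. ennreal (f i x)) \<partial>M) = (\<Sum>i. \<integral>\<^sup>+x. ennreal (f i x) \<partial>M)"
    by (rule nn_integral_suminf) simp
  also have "\<dots> = (\<Sum>i. ennreal (LINT x|M. f i x))"
    using int nonneg by (simp add: nn_integral_eq_integral)
  also have "\<dots> = ennreal (\<Sum>i. LINT x|M. f i x)"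
    using sum nonneg by (intro suminf_ennreal2) auto
  finally have "(\<integral>\<^sup>+x. (\<Sum>i. ennreal (f i x)) \<partial>M) \<noteq> \<infinity>" by simp
  then have "AE x in M. (\<Sum>i. ennreal (f i x)) \<noteq> \<infinity>"
    by (intro nn_integral_noteq_infinite) auto
  then show ?thesis
    by eventually_elim (auto intro!: summable_suminf_not_top nonneg)
qed

lemma two_abs_mult_le:
  fixes a b e :: real
  assumes "0 < e"
  shows "2 * \<bar>a * b\<bar> \<le> e * a\<^sup>2 + b\<^sup>2 / e"
proof -
  have "0 \<le> (e * \<bar>a\<bar> - \<bar>b\<bar>)\<^sup>2" by simp
  then have "2 * \<bar>a * b\<bar> * e \<le> e\<^sup>2 * a\<^sup>2 + b\<^sup>2"
    by (simp add: power2_diff power_mult_distrib abs_mult algebra_simps)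
  then show ?thesis using assms by (simp add: field_simps power2_eq_square)
qed

lemma square_integrable_mult:
  assumes "square_integrable M f" "square_integrable M g"
  shows "integrable M (\<lambda>x. f x * g x)"
proof (rule Bochner_Integration.integrable_bound)
  show "integrable M (\<lambda>x. (f x)\<^sup>2 + (g x)\<^sup>2)" using assms by (auto simp: square_integrable_def)
  show "AE x in M. norm (f x * g x) \<le> norm ((f x)\<^sup>2 + (g x)\<^sup>2)"
    using two_abs_mult_le[of 1] by (auto intro!: AE_I2 simp: add_nonneg_nonneg) (smt (verit, best) zero_le_power2)
qed (use assms in \<open>auto simp: square_integrable_def\<close>)

context
  fixes M :: "'a measure" and e :: "nat \<Rightarrow> 'a \<Rightarrow> real" and z :: "nat \<Rightarrow> real"
  assumes sq: "\<And>i. square_integrable M (e i)"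
    and orth: "\<And>i j. (LINT x|M. e i x * e j x) = (if i = j then 1 else 0)"
    and z: "summable (\<lambda>i. \<bar>z i\<bar>)"
begin

lemma orthonormal_partial_sum:
  "integrable M (\<lambda>x. (\<Sum>i<n. z i * e i x)\<^sup>2)" "(LINT x|M. (\<Sum>i<n. z i * e i x)\<^sup>2) = (\<Sum>i<n. (z i)\<^sup>2)"
proof -
  have *: "(\<Sum>i<n. z i * e i x)\<^sup>2 = (\<Sum>i<n. \<Sum>j<n. z i * z j * (e i x * e j x))" for x
    by (simp add: power2_eq_square sum_product mult_ac)
  show "integrable M (\<lambda>x. (\<Sum>i<n. z i * e i x)\<^sup>2)"
    unfolding * by (intro Bochner_Integration.integrable_sum integrable_mult_right square_integrable_mult sq)
  have "(LINT x|M. (\<Sum>i<n. z i * e i x)\<^sup>2) = (\<Sum>i<n. \<Sum>j<n. z i * z j * (LINT x|M. e i x * e j x))"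
    unfolding * by (simp add: Bochner_Integration.integral_sum square_integrable_mult sq)
  also have "\<dots> = (\<Sum>i<n. (z i)\<^sup>2)"
    by (simp add: orth if_distrib sum.delta power2_eq_square cong: if_cong)
  finally show "(LINT x|M. (\<Sum>i<n. z i * e i x)\<^sup>2) = (\<Sum>i<n. (z i)\<^sup>2)" .
qed

lemma summable_square: "summable (\<lambda>i. (z i)\<^sup>2)"
proof (rule summable_comparison_test_ev[OF _ z])
  have "\<forall>\<^sub>F i in sequentially. \<bar>z i\<bar> < 1"
    using summable_LIMSEQ_zero[OF z] by (auto dest!: order_tendstoD(2)[of _ 0 _ 1])
  then show "\<forall>\<^sub>F i in sequentially. norm ((z i)\<^sup>2) \<le> \<bar>z i\<bar>"
  proof eventually_elim
    case (elim i)
    then have "\<bar>z i\<bar> * \<bar>z i\<bar> \<le> \<bar>z i\<bar>" by (intro mult_left_le) auto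
    then show ?case by (simp add: power2_eq_square abs_mult)
  qed
qed

text \<open>Parseval's identity by elementary means: the difference of the squares of
  \<open>f\<close> and \<open>S n\<close> is split, with a parameter \<open>\<epsilon> n\<close>,
  into a small multiple of \<open>(S n x)\<^sup>2\<close> and a large multiple of the squared
  error.\<close>

lemma orthonormal_series_norm:
  assumes f: "square_integrable M f"
    and lim: "(\<lambda>n. LINT x|M. (f x - (\<Sum>i<n. z i * e i x))\<^sup>2) \<longlonglongrightarrow> 0"
  shows "(LINT x|M. (f x)\<^sup>2) = (\<Sum>i. (z i)\<^sup>2)"
proof -
  define S where "S n x = (\<Sum>i<n. z i * e i x)" for n x
  define d where "d n = (LINT x|M. (f x - S n x)\<^sup>2)" for n
  \<comment> \<open>The square root of the error balances both parts: \<open>\<epsilon> n\<close>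
    tends to 0, and so does \<open>d n / \<epsilon> n\<close>, being at most
    \<open>sqrt (d n)\<close>. The summand \<open>1 / real (Suc n)\<close> keeps
    \<open>\<epsilon> n\<close> positive when the error vanishes.\<close>
  define \<epsilon> where "\<epsilon> n = sqrt (d n) + 1 / real (Suc n)" for n
  define Q where "Q = (\<Sum>i. (z i)\<^sup>2)"
  have d0: "d n \<ge> 0" for n by (simp add: d_def)
  have \<epsilon>0: "\<epsilon> n > 0" for n using d0[of n] by (simp add: \<epsilon>_def add_nonneg_pos)
  have sqS: "square_integrable M (S n)" for n
    using orthonormal_partial_sum(1)[of n] sq
    by (auto simp: square_integrable_def S_def[abs_def] intro!: borel_measurable_sum borel_measurable_times)
  have int1: "integrable M (\<lambda>x. (S n x)\<^sup>2)" and int2: "integrable M (\<lambda>x. (f x)\<^sup>2)" for n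
    using sqS f by (auto simp: square_integrable_def)
  have int3: "integrable M (\<lambda>x. (f x - S n x)\<^sup>2)" for n
    using square_integrable_mult[OF f sqS[of n]] int1[of n] int2 by (simp add: power2_diff mult.assoc)
  have "\<bar>(LINT x|M. (f x)\<^sup>2) - (LINT x|M. (S n x)\<^sup>2)\<bar> \<le> \<epsilon> n * Q + d n + sqrt (d n)" for n
  proof -
    have "\<bar>(LINT x|M. (f x)\<^sup>2) - (LINT x|M. (S n x)\<^sup>2)\<bar> = \<bar>LINT x|M. (f x)\<^sup>2 - (S n x)\<^sup>2\<bar>"
      using int1 int2 by simp
    also have "\<dots> \<le> (LINT x|M. \<bar>(f x)\<^sup>2 - (S n x)\<^sup>2\<bar>)" by (rule integral_abs_bound)
    also have "\<dots> \<le> (LINT x|M. \<epsilon> n * (S n x)\<^sup>2 + ((f x - S n x)\<^sup>2 / \<epsilon> n + (f x - S n x)\<^sup>2))"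
    proof (rule integral_mono)
      fix x
      have "(f x)\<^sup>2 - (S n x)\<^sup>2 = 2 * (S n x * (f x - S n x)) + (f x - S n x)\<^sup>2"
        by (simp add: power2_eq_square algebra_simps)
      then have "\<bar>(f x)\<^sup>2 - (S n x)\<^sup>2\<bar> \<le> 2 * \<bar>S n x * (f x - S n x)\<bar> + (f x - S n x)\<^sup>2"
        by (smt (verit) zero_le_power2)
      also have "\<dots> \<le> \<epsilon> n * (S n x)\<^sup>2 + ((f x - S n x)\<^sup>2 / \<epsilon> n + (f x - S n x)\<^sup>2)"
        using two_abs_mult_le[OF \<epsilon>0[of n], of "S n x" "f x - S n x"] by simp
      finally show "\<bar>(f x)\<^sup>2 - (S n x)\<^sup>2\<bar> \<le> \<epsilon> n * (S n x)\<^sup>2 + ((f x - S n x)\<^sup>2 / \<epsilon> n + (f x - S n x)\<^sup>2)" .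
    qed (use int1 int2 int3 in auto)
    also have "\<dots> = \<epsilon> n * (\<Sum>i<n. (z i)\<^sup>2) + d n / \<epsilon> n + d n"
      using int1 int3 orthonormal_partial_sum(2)[of n] by (simp add: d_def S_def)
    also have "\<dots> \<le> \<epsilon> n * Q + sqrt (d n) + d n"
    proof -
      have "(\<Sum>i<n. (z i)\<^sup>2) \<le> Q" unfolding Q_def by (intro sum_le_suminf summable_square) auto
      moreover have "d n / \<epsilon> n \<le> sqrt (d n)"
      proof -
        have "d n = sqrt (d n) * sqrt (d n)" using d0 by simp
        also have "\<dots> \<le> sqrt (d n) * \<epsilon> n" using d0 by (intro mult_left_mono) (auto simp: \<epsilon>_def)
        finally show ?thesis using \<epsilon>0[of n] by (simp add: field_simps)
      qed
      ultimately show ?thesis using \<epsilon>0[of n] by (intro add_mono mult_left_mono) auto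
    qed
    finally show ?thesis by simp
  qed
  then have bound: "norm ((LINT x|M. (S n x)\<^sup>2) - (LINT x|M. (f x)\<^sup>2)) \<le> \<epsilon> n * Q + d n + sqrt (d n)" for n
    by (simp add: abs_minus_commute)
  have dlim: "d \<longlonglongrightarrow> 0" using lim by (simp add: d_def[abs_def] S_def)
  have "(\<lambda>n. 1 / real (Suc n)) \<longlonglongrightarrow> 0"
    using LIMSEQ_inverse_real_of_nat by (simp add: inverse_eq_divide)
  then have "(\<lambda>n. \<epsilon> n * Q + d n + sqrt (d n)) \<longlonglongrightarrow> (sqrt 0 + 0) * Q + 0 + sqrt 0"
    unfolding \<epsilon>_def by (intro tendsto_intros dlim)
  then have "(\<lambda>n. (LINT x|M. (S n x)\<^sup>2) - (LINT x|M. (f x)\<^sup>2)) \<longlonglongrightarrow> 0"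
    by (rule_tac Lim_null_comparison[OF always_eventually[rule_format, OF bound]]) simp
  then have "(\<lambda>n. LINT x|M. (S n x)\<^sup>2) \<longlonglongrightarrow> (LINT x|M. (f x)\<^sup>2)"
    by (rule LIM_zero_cancel)
  moreover have "(\<lambda>n. LINT x|M. (S n x)\<^sup>2) \<longlonglongrightarrow> Q"
    unfolding S_def orthonormal_partial_sum(2) Q_def using summable_square by (rule summable_LIMSEQ)
  ultimately show ?thesis unfolding Q_def using LIMSEQ_unique by blast
qed

text \<open>Absolute summability of \<open>z\<close> allows an explicit sum: the integrals of
  \<open>\<bar>z i\<bar> * (e i x)\<^sup>2\<close> are summable, so that series converges almost
  everywhere, to \<open>H x\<close>. Cauchy-Schwarz with weights \<open>\<bar>z i\<bar>\<close>
  bounds the square of every block of the original series by \<open>A * H x\<close>, and dominated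
  convergence applies.\<close>

lemma orthonormal_series_exists:
  obtains f where "square_integrable M f"
    "(\<lambda>n. LINT x|M. (f x - (\<Sum>i<n. z i * e i x))\<^sup>2) \<longlonglongrightarrow> 0"
proof -
  have [measurable]: "e i \<in> borel_measurable M" for i using sq by (simp add: square_integrable_def)
  define f where "f x = (\<Sum>i. z i * e i x)" for x
  define A where "A = (\<Sum>i. \<bar>z i\<bar>)"
  define H where "H x = (\<Sum>i. \<bar>z i\<bar> * (e i x)\<^sup>2)" for x
  have A: "(\<Sum>i\<in>I. \<bar>z i\<bar>) \<le> A" if "finite I" for I
    unfolding A_def using that by (intro sum_le_suminf z) auto
  have inte: "integrable M (\<lambda>x. (e i x)\<^sup>2)" and e1: "(LINT x|M. (e i x)\<^sup>2) = 1" for i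
    using sq orth[of i i] by (auto simp: square_integrable_def power2_eq_square)
  have AE: "AE x in M. summable (\<lambda>i. \<bar>z i\<bar> * (e i x)\<^sup>2)"
    by (rule AE_summable_of_integral) (use inte e1 z in auto)
  have H: "integrable M H"
    unfolding H_def
  proof (rule integrable_suminf)
    show "AE x in M. summable (\<lambda>i. norm (\<bar>z i\<bar> * (e i x)\<^sup>2))" using AE by simp
    show "summable (\<lambda>i. LINT x|M. norm (\<bar>z i\<bar> * (e i x)\<^sup>2))" using e1 z by (simp add: abs_mult)
  qed (use inte in auto)
  have *: "summable (\<lambda>i. z i * e i x)" "(\<Sum>i\<in>I. z i * e i x)\<^sup>2 \<le> A * H x"
    if s: "summable (\<lambda>i. \<bar>z i\<bar> * (e i x)\<^sup>2)" and I: "finite I" for x and I :: "nat set"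
  proof -
    show "summable (\<lambda>i. z i * e i x)"
    proof (rule summable_comparison_test_ev)
      show "summable (\<lambda>i. \<bar>z i\<bar> + \<bar>z i\<bar> * (e i x)\<^sup>2)" using z s by (rule summable_add)
      have "\<bar>e i x\<bar> \<le> 1 + (e i x)\<^sup>2" for i
        using two_abs_mult_le[of 1 1 "e i x"] by auto
      then have "\<bar>z i\<bar> * \<bar>e i x\<bar> \<le> \<bar>z i\<bar> * (1 + (e i x)\<^sup>2)" for i by (intro mult_left_mono) auto
      then show "\<forall>\<^sub>F i in sequentially. norm (z i * e i x) \<le> \<bar>z i\<bar> + \<bar>z i\<bar> * (e i x)\<^sup>2"
        by (intro always_eventually allI) (simp add: abs_mult algebra_simps)
    qed
    \<comment> \<open>The coefficient is shared out between the two factors as square roots, so that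
      the weight \<open>\<bar>z i\<bar>\<close> appears in both sums.\<close>
    have "(\<Sum>i\<in>I. z i * e i x)\<^sup>2 = (\<Sum>i\<in>I. sgn (z i) * sqrt \<bar>z i\<bar> * (sqrt \<bar>z i\<bar> * e i x))\<^sup>2"
      by (intro arg_cong[where f = "\<lambda>t. t\<^sup>2"] sum.cong refl)
         (simp add: mult.assoc[symmetric] real_sqrt_mult_self[symmetric] del: real_sqrt_mult_self, simp add: mult.assoc sgn_mult_abs)
    also have "\<dots> \<le> (\<Sum>i\<in>I. (sgn (z i) * sqrt \<bar>z i\<bar>)\<^sup>2) * (\<Sum>i\<in>I. (sqrt \<bar>z i\<bar> * e i x)\<^sup>2)"
      by (rule Cauchy_Schwarz_ineq_sum)
    also have "\<dots> = (\<Sum>i\<in>I. \<bar>z i\<bar>) * (\<Sum>i\<in>I. \<bar>z i\<bar> * (e i x)\<^sup>2)"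
      by (intro arg_cong2[where f = "(*)"] sum.cong refl) (auto simp: power_mult_distrib sgn_if)
    also have "\<dots> \<le> A * H x"
      unfolding H_def using I s by (intro mult_mono A sum_le_suminf) (auto intro!: suminf_nonneg sum_nonneg simp: A_def z)
    finally show "(\<Sum>i\<in>I. z i * e i x)\<^sup>2 \<le> A * H x" .
  qed
  have bound: "(f x - (\<Sum>i<n. z i * e i x))\<^sup>2 \<le> A * H x"
    if s: "summable (\<lambda>i. \<bar>z i\<bar> * (e i x)\<^sup>2)" for x n
  proof (rule LIMSEQ_le_const2)
    have "(\<lambda>m. \<Sum>i<m. z i * e i x) \<longlonglongrightarrow> f x" unfolding f_def using *(1)[OF s finite.emptyI] by (rule summable_LIMSEQ)
    then show "(\<lambda>m. ((\<Sum>i<m. z i * e i x) - (\<Sum>i<n. z i * e i x))\<^sup>2) \<longlonglongrightarrow> (f x - (\<Sum>i<n. z i * e i x))\<^sup>2"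
      by (intro tendsto_intros)
    have "((\<Sum>i<m. z i * e i x) - (\<Sum>i<n. z i * e i x))\<^sup>2 \<le> A * H x" if "m \<ge> n" for m
    proof -
      have "(\<Sum>i<m. z i * e i x) = (\<Sum>i<n. z i * e i x) + (\<Sum>i\<in>{n..<m}. z i * e i x)"
        using that by (simp add: sum.atLeastLessThan_concat flip: atLeast0LessThan)
      then show ?thesis using *(2)[OF s, of "{n..<m}"] by simp
    qed
    then show "\<exists>N. \<forall>m\<ge>N. ((\<Sum>i<m. z i * e i x) - (\<Sum>i<n. z i * e i x))\<^sup>2 \<le> A * H x" by blast
  qed
  have f_meas [measurable]: "f \<in> borel_measurable M" unfolding f_def by measurable
  show thesis
  proof
    show "square_integrable M f" unfolding square_integrable_def
    proof
      show "integrable M (\<lambda>x. (f x)\<^sup>2)"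
      proof (rule Bochner_Integration.integrable_bound)
        show "integrable M (\<lambda>x. A * H x)" using H by simp
        show "AE x in M. norm ((f x)\<^sup>2) \<le> norm (A * H x)"
          using AE
        proof eventually_elim
          case (elim x)
          from bound[OF this, of 0] show ?case by simp
        qed
      qed simp
    qed simp
    have "(\<lambda>n. LINT x|M. (f x - (\<Sum>i<n. z i * e i x))\<^sup>2) \<longlonglongrightarrow> (LINT x|M. 0)"
    proof (rule integral_dominated_convergence)
      show "integrable M (\<lambda>x. A * H x)" using H by simp
      show "AE x in M. (\<lambda>n. (f x - (\<Sum>i<n. z i * e i x))\<^sup>2) \<longlonglongrightarrow> 0"
        using AE
      proof eventually_elim
        case (elim x)
        have "(\<lambda>m. \<Sum>i<m. z i * e i x) \<longlonglongrightarrow> f x" unfolding f_def using *(1)[OF elim finite.emptyI] by (rule summable_LIMSEQ)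
        then have "(\<lambda>n. (f x - (\<Sum>i<n. z i * e i x))\<^sup>2) \<longlonglongrightarrow> (f x - f x)\<^sup>2" by (intro tendsto_intros)
        then show ?case by simp
      qed
      show "AE x in M. norm ((f x - (\<Sum>i<n. z i * e i x))\<^sup>2) \<le> A * H x" for n
        using AE by eventually_elim (use bound in simp)
    qed simp_all
    then show "(\<lambda>n. LINT x|M. (f x - (\<Sum>i<n. z i * e i x))\<^sup>2) \<longlonglongrightarrow> 0" by simp
  qed
qed

end

text \<open>\<open>L2_norm\<close> is a definite description over representatives \<open>f\<close>;
  the existence of some \<open>f\<close> and the independence of its choice are the two preceding
  facts.\<close>

lemma L2_norm_eq:
  fixes \<psi> :: "nat \<Rightarrow> real ^ 'd \<Rightarrow> real"
  assumes \<psi>: "orthonormal_basis torus {1..} \<psi>" and z: "summable (\<lambda>i. \<bar>z i\<bar>)"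
  shows "L2_norm \<psi> z = sqrt (\<Sum>i. (z i)\<^sup>2)"
proof -
  have sq: "square_integrable torus (\<psi> (Suc i))"
    and orth: "(LINT x|torus. \<psi> (Suc i) x * \<psi> (Suc j) x) = (if i = j then 1 else 0)" for i j
    using \<psi> by (auto simp: orthonormal_basis_def)
  obtain f where f: "square_integrable torus f"
    "(\<lambda>n. LINT x|torus. (f x - (\<Sum>i<n. z i * \<psi> (Suc i) x))\<^sup>2) \<longlonglongrightarrow> 0"
    using orthonormal_series_exists[of torus "\<lambda>i. \<psi> (Suc i)", OF sq orth z] by blast
  show ?thesis
    unfolding L2_norm_def
  proof (rule the_equality)
    show "\<exists>f. L2_sum \<psi> z f \<and> sqrt (\<Sum>i. (z i)\<^sup>2) = sqrt (LINT x|torus. (f x)\<^sup>2)"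
      using f orthonormal_series_norm[of torus "\<lambda>i. \<psi> (Suc i)", OF sq orth z f] by (auto simp: L2_sum_def)
    show "a = sqrt (\<Sum>i. (z i)\<^sup>2)" if "\<exists>f. L2_sum \<psi> z f \<and> a = sqrt (LINT x|torus. (f x)\<^sup>2)" for a
      using that orthonormal_series_norm[of torus "\<lambda>i. \<psi> (Suc i)", OF sq orth z] by (auto simp: L2_sum_def)
  qed
qed

section \<open>Exponential moments of the prior\<close>

context prob_space
begin

context
  fixes X :: "'a \<Rightarrow> real" and p Z :: real
  assumes X: "distributed M lborel X (\<lambda>x. ennreal (exp (- (\<bar>x\<bar> powr p)) / Z))"
    and Z: "Z = (LINT y|lborel. exp (- (\<bar>y\<bar> powr p)))" and p: "1 \<le> p"
begin

lemma exp_power_density_normalization: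
  "0 < Z" "(\<integral>\<^sup>+x. ennreal (exp (- (\<bar>x\<bar> powr p)) / Z) \<partial>lborel) = 1"
proof -
  show 1: "(\<integral>\<^sup>+x. ennreal (exp (- (\<bar>x\<bar> powr p)) / Z) \<partial>lborel) = 1"
    using distributed_nn_integral[OF X, of "\<lambda>_. 1"] by (simp add: emeasure_space_1)
  have "Z \<ge> 0" by (simp add: Z)
  \<comment> \<open>As a Lebesgue integral \<open>Z\<close> could a priori be the default value 0.
    Division by zero would then make the density vanish identically, against total mass 1.\<close>
  moreover have "Z \<noteq> 0" using 1 by auto
  ultimately show "0 < Z" by simp
qed

text \<open>The integrand is the density up to a dilation: \<open>c\<close> is chosen such that
  \<open>x = c * y\<close> turns \<open>(1 - a) * \<bar>x\<bar> powr p\<close> into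
  \<open>\<bar>y\<bar> powr p\<close>, which leaves the Jacobian \<open>c\<close> times the total
  mass.\<close>

lemma exp_power_moment:
  assumes a: "0 \<le> a" "a < 1"
  shows "(\<integral>\<^sup>+\<omega>. ennreal (exp (a * \<bar>X \<omega>\<bar> powr p)) \<partial>M) = ennreal ((1 - a) powr (- 1 / p))"
proof -
  define c where "c = (1 - a) powr (- 1 / p)"
  have c: "c > 0" using a by (simp add: c_def)
  have cp: "(1 - a) * \<bar>c * x\<bar> powr p = \<bar>x\<bar> powr p" for x
  proof -
    have "c powr p = (1 - a) powr (-1)" unfolding c_def powr_powr using p by simp
    also have "\<dots> = 1 / (1 - a)" using a by (simp add: powr_minus_divide)
    finally have "c powr p = 1 / (1 - a)" .
    with a c show ?thesis by (simp add: abs_mult powr_mult)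
  qed
  have "(\<integral>\<^sup>+\<omega>. ennreal (exp (a * \<bar>X \<omega>\<bar> powr p)) \<partial>M)
      = (\<integral>\<^sup>+x. ennreal (exp (- (\<bar>x\<bar> powr p)) / Z) * ennreal (exp (a * \<bar>x\<bar> powr p)) \<partial>lborel)"
    by (rule distributed_nn_integral[OF X, symmetric]) simp
  also have "\<dots> = (\<integral>\<^sup>+x. ennreal (exp (- ((1 - a) * \<bar>x\<bar> powr p)) / Z) \<partial>lborel)"
    using exp_power_density_normalization(1)
    by (intro nn_integral_cong) (simp add: ennreal_mult[symmetric] exp_add[symmetric] algebra_simps)
  also have "\<dots> = ennreal \<bar>c\<bar> * (\<integral>\<^sup>+x. ennreal (exp (- ((1 - a) * \<bar>0 + c * x\<bar> powr p)) / Z) \<partial>lborel)"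
    using c by (intro nn_integral_real_affine) auto
  also have "\<dots> = ennreal c"
    using c exp_power_density_normalization(2) by (simp add: cp)
  finally show ?thesis by (simp add: c_def)
qed

lemma exp_power_integrable:
  assumes a: "0 \<le> a" "a < 1"
  shows "integrable M (\<lambda>\<omega>. exp (a * \<bar>X \<omega>\<bar> powr p))"
proof (rule integrableI_nonneg)
  have [measurable]: "X \<in> borel_measurable M" using X by (simp add: distributed_def)
  show "(\<lambda>\<omega>. exp (a * \<bar>X \<omega>\<bar> powr p)) \<in> borel_measurable M" by measurable
  show "(\<integral>\<^sup>+\<omega>. ennreal (exp (a * \<bar>X \<omega>\<bar> powr p)) \<partial>M) < \<infinity>"
    unfolding exp_power_moment[OF a] by simp
qed simp

lemma exp_power_abs_moment:
  "integrable M (\<lambda>\<omega>. \<bar>X \<omega>\<bar> powr p)" "(LINT \<omega>|M. \<bar>X \<omega>\<bar> powr p) \<le> 4"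
proof -
  have [measurable]: "X \<in> borel_measurable M" using X by (simp add: distributed_def)
  \<comment> \<open>The bound 4 arises from \<open>y \<le> 2 * exp (y / 2)\<close> and the
    exponential moment at \<open>1 / 2\<close>, whose value is
    \<open>2 powr (1 / p) \<le> 2\<close>.\<close>
  have le: "\<bar>X \<omega>\<bar> powr p \<le> 2 * exp (1 / 2 * \<bar>X \<omega>\<bar> powr p)" for \<omega>
    using exp_ge_add_one_self[of "1 / 2 * \<bar>X \<omega>\<bar> powr p"] by linarith
  have int: "integrable M (\<lambda>\<omega>. exp (1 / 2 * \<bar>X \<omega>\<bar> powr p))" by (rule exp_power_integrable) auto
  show 1: "integrable M (\<lambda>\<omega>. \<bar>X \<omega>\<bar> powr p)"
    by (rule Bochner_Integration.integrable_bound[OF integrable_mult_right[OF int, of 2]]) (use le in auto)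
  have "(LINT \<omega>|M. \<bar>X \<omega>\<bar> powr p) \<le> (LINT \<omega>|M. 2 * exp (1 / 2 * \<bar>X \<omega>\<bar> powr p))"
    using 1 int le by (intro integral_mono) auto
  also have "\<dots> = 2 * (1 / 2) powr (- 1 / p)"
    using exp_power_moment[of "1 / 2"] by (simp add: integral_eq_nn_integral)
  also have "\<dots> = 2 * 2 powr (1 / p)" by (simp add: powr_minus_divide powr_divide)
  also have "\<dots> \<le> 2 * 2 powr 1" using p by (intro mult_left_mono powr_mono) auto
  finally show "(LINT \<omega>|M. \<bar>X \<omega>\<bar> powr p) \<le> 4" by simp
qed

lemma exp_power_centered: "integrable M X" "(LINT \<omega>|M. X \<omega>) = 0"
proof -
  have [measurable]: "X \<in> borel_measurable M" using X by (simp add: distributed_def)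
  have le: "\<bar>X \<omega>\<bar> \<le> 1 + \<bar>X \<omega>\<bar> powr p" for \<omega>
  proof (cases "\<bar>X \<omega>\<bar> \<le> 1")
    case False
    then have "\<bar>X \<omega>\<bar> powr 1 \<le> \<bar>X \<omega>\<bar> powr p" using p by (intro powr_mono) auto
    then show ?thesis using False by simp
  qed (use powr_ge_zero[of "\<bar>X \<omega>\<bar>" p] in linarith)
  show "integrable M X"
    by (rule Bochner_Integration.integrable_bound[OF Bochner_Integration.integrable_add[OF integrable_const[of 1] exp_power_abs_moment(1)]])
       (use le in auto)
  define I where "I = (LINT x|lborel. exp (- (\<bar>x\<bar> powr p)) / Z * x)"
  \<comment> \<open>Reflection \<open>x \<mapsto> - x\<close>: the density is even, so the first
    moment equals its own negative.\<close>
  have "I = \<bar>-1\<bar> *\<^sub>R (LINT x|lborel. exp (- (\<bar>0 + (-1) * x\<bar> powr p)) / Z * (0 + (-1) * x))"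
    unfolding I_def by (rule lborel_integral_real_affine) simp
  also have "\<dots> = - I" by (simp add: I_def)
  finally have "I = 0" by simp
  then show "(LINT \<omega>|M. X \<omega>) = 0"
    using distributed_integral[OF X, of "\<lambda>x. x"] exp_power_density_normalization(1) by (simp add: I_def)
qed

end

text \<open>By independence the moment of a partial sum is a product with factors at most
  \<open>exp (b i)\<close>, so it stays below the exponential of the sum of \<open>b\<close>.
  Fatou's lemma passes to the full series, which is a limit only almost everywhere.\<close>

lemma exp_power_sum_moment:
  fixes X :: "nat \<Rightarrow> 'a \<Rightarrow> real" and b :: "nat \<Rightarrow> real"
  assumes indep: "indep_vars (\<lambda>_. borel) X UNIV"
    and X: "\<And>i. distributed M lborel (X i) (\<lambda>x. ennreal (exp (- (\<bar>x\<bar> powr p)) / (LINT y|lborel. exp (- (\<bar>y\<bar> powr p)))))"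
    and p: "1 \<le> p" and b: "\<And>i. 0 \<le> b i" "\<And>i. b i \<le> 1" "summable b"
  shows "AE \<omega> in M. summable (\<lambda>i. b i * \<bar>X i \<omega>\<bar> powr p)"
    "integrable M (\<lambda>\<omega>. exp (1 / 2 * (\<Sum>i. b i * \<bar>X i \<omega>\<bar> powr p)))"
proof -
  have [measurable]: "X i \<in> borel_measurable M" for i using X[of i] by (simp add: distributed_def)
  show AE: "AE \<omega> in M. summable (\<lambda>i. b i * \<bar>X i \<omega>\<bar> powr p)"
  proof (rule AE_summable_of_integral)
    show "summable (\<lambda>i. LINT \<omega>|M. b i * \<bar>X i \<omega>\<bar> powr p)"
    proof (rule summable_comparison_test_ev)
      show "summable (\<lambda>i. b i * 4)" using b by (intro summable_mult2)
      show "\<forall>\<^sub>F i in sequentially. norm (LINT \<omega>|M. b i * \<bar>X i \<omega>\<bar> powr p) \<le> b i * 4"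
        using b exp_power_abs_moment(2)[OF X refl p]
        by (intro always_eventually allI) (simp add: abs_mult mult_left_mono)
    qed
  qed (use b exp_power_abs_moment(1)[OF X refl p] in auto)
  define S where "S n \<omega> = (\<Sum>i<n. b i * \<bar>X i \<omega>\<bar> powr p)" for n \<omega>
  have [measurable]: "S n \<in> borel_measurable M" for n unfolding S_def by measurable
  have le: "(\<integral>\<^sup>+\<omega>. ennreal (exp (1 / 2 * S n \<omega>)) \<partial>M) \<le> ennreal (exp (\<Sum>i. b i))" for n
  proof -
    have "(\<integral>\<^sup>+\<omega>. ennreal (exp (1 / 2 * S n \<omega>)) \<partial>M) = (\<integral>\<^sup>+\<omega>. (\<Prod>i<n. ennreal (exp (b i / 2 * \<bar>X i \<omega>\<bar> powr p))) \<partial>M)"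
      by (intro nn_integral_cong) (simp add: prod_ennreal exp_sum[symmetric] S_def sum_distrib_left)
    also have "\<dots> = (\<Prod>i<n. \<integral>\<^sup>+\<omega>. ennreal (exp (b i / 2 * \<bar>X i \<omega>\<bar> powr p)) \<partial>M)"
      by (intro indep_vars_nn_integral indep_vars_compose2[OF indep_vars_subset[OF indep]]) auto
    also have "\<dots> \<le> (\<Prod>i<n. ennreal (exp (b i)))"
    proof (intro prod_mono_ennreal)
      fix i
      have x: "0 \<le> b i / 2" "b i / 2 \<le> 1 / 2" using b(1)[of i] b(2)[of i] by auto
      have "(1 - b i / 2) powr (- 1 / p) \<le> (1 - b i / 2) powr (-1)"
        using x p by (intro powr_mono') auto
      also have "\<dots> = 1 / (1 - b i / 2)" using x by (simp add: powr_minus_divide)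
      also have "\<dots> \<le> 1 + b i"
      proof -
        have "b i * b i \<le> b i" using b(1)[of i] b(2)[of i] by (intro mult_left_le) auto
        then show ?thesis using x by (simp add: field_simps)
      qed
      also have "\<dots> \<le> exp (b i)" by simp
      finally show "(\<integral>\<^sup>+\<omega>. ennreal (exp (b i / 2 * \<bar>X i \<omega>\<bar> powr p)) \<partial>M) \<le> ennreal (exp (b i))"
        using x exp_power_moment[OF X refl p x(1)] by (simp add: ennreal_leI)
    qed
    also have "\<dots> = ennreal (exp (\<Sum>i<n. b i))" by (simp add: prod_ennreal exp_sum)
    also have "\<dots> \<le> ennreal (exp (\<Sum>i. b i))"
      using b by (intro ennreal_leI) (auto intro!: sum_le_suminf)
    finally show ?thesis .
  qed
  show "integrable M (\<lambda>\<omega>. exp (1 / 2 * (\<Sum>i. b i * \<bar>X i \<omega>\<bar> powr p)))"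
  proof (rule integrableI_nonneg)
    have "(\<integral>\<^sup>+\<omega>. ennreal (exp (1 / 2 * (\<Sum>i. b i * \<bar>X i \<omega>\<bar> powr p))) \<partial>M)
        = (\<integral>\<^sup>+\<omega>. liminf (\<lambda>n. ennreal (exp (1 / 2 * S n \<omega>))) \<partial>M)"
    proof (rule nn_integral_cong_AE)
      show "AE \<omega> in M. ennreal (exp (1 / 2 * (\<Sum>i. b i * \<bar>X i \<omega>\<bar> powr p))) = liminf (\<lambda>n. ennreal (exp (1 / 2 * S n \<omega>)))"
        using AE
      proof eventually_elim
        case (elim \<omega>)
        have "(\<lambda>n. S n \<omega>) \<longlonglongrightarrow> (\<Sum>i. b i * \<bar>X i \<omega>\<bar> powr p)"
          unfolding S_def using elim by (rule summable_LIMSEQ)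
        then have "(\<lambda>n. ennreal (exp (1 / 2 * S n \<omega>))) \<longlonglongrightarrow> ennreal (exp (1 / 2 * (\<Sum>i. b i * \<bar>X i \<omega>\<bar> powr p)))"
          by (intro tendsto_ennrealI tendsto_intros)
        then show ?case using lim_imp_Liminf[OF trivial_limit_sequentially] by metis
      qed
    qed
    also have "\<dots> \<le> liminf (\<lambda>n. \<integral>\<^sup>+\<omega>. ennreal (exp (1 / 2 * S n \<omega>)) \<partial>M)"
      by (rule nn_integral_liminf) measurable
    also have "\<dots> \<le> ennreal (exp (\<Sum>i. b i))"
      using le by (intro Liminf_le) (auto intro!: always_eventually)
    finally show "(\<integral>\<^sup>+\<omega>. ennreal (exp (1 / 2 * (\<Sum>i. b i * \<bar>X i \<omega>\<bar> powr p))) \<partial>M) < \<infinity>"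
      by (simp add: le_less_trans)
  qed auto
qed

lemma besov_prior_moments:
  assumes U: "besov_prior d s p M U" and p: "1 \<le> p" and d: "0 < d" and \<tau>: "\<tau> < s - d / p"
  shows "(\<lambda>\<omega>. U \<omega> j) \<in> borel_measurable M"
    "AE \<omega> in M. U \<omega> \<in> elts (besov d \<tau> p)"
    "integrable M (\<lambda>\<omega>. exp (1 / 2 * nrm (besov d \<tau> p) (U \<omega>) powr p))"
    "integrable M (\<lambda>\<omega>. U \<omega> j)" "(LINT \<omega>|M. U \<omega> j) = 0"
proof -
  from U obtain X :: "nat \<Rightarrow> 'a \<Rightarrow> real" where indep: "indep_vars (\<lambda>_. borel) X UNIV"
    and X: "\<And>i. distributed M lborel (X i) (\<lambda>x. ennreal (exp (- (\<bar>x\<bar> powr p)) / (LINT y|lborel. exp (- (\<bar>y\<bar> powr p)))))"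
    and UX: "\<And>\<omega> i. \<omega> \<in> space M \<Longrightarrow> U \<omega> i = real (Suc i) powr (- (s / d + 1 / 2 - 1 / p)) * X i \<omega>"
    unfolding besov_prior_def by blast
  have [measurable]: "X i \<in> borel_measurable M" for i using X[of i] by (simp add: distributed_def)
  show U_meas: "(\<lambda>\<omega>. U \<omega> j) \<in> borel_measurable M" for j
    by (subst measurable_cong[OF UX]) auto
  show "integrable M (\<lambda>\<omega>. U \<omega> j)" "(LINT \<omega>|M. U \<omega> j) = 0"
    using exp_power_centered[OF X refl p, of j]
    by (simp_all add: UX cong: Bochner_Integration.integrable_cong Bochner_Integration.integral_cong)
  \<comment> \<open>With these weights the \<open>p\<close>-th power of the norm of
    \<open>U \<omega>\<close> is the sum of \<open>b i * \<bar>X i \<omega>\<bar> powr p\<close>.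
    The condition \<open>\<tau> < s - d / p\<close> makes the decay exponent exceed 1, hence
    \<open>b\<close> summable, and \<open>b 0 = 1\<close> is the largest weight.\<close>
  define b where "b i = real (Suc i) powr (- (p * (s - \<tau>) / d))" for i
  have \<delta>: "p * (s - \<tau>) / d > 1"
  proof -
    have "d / p < s - \<tau>" using \<tau> by simp
    then have "d < p * (s - \<tau>)" using p by (simp add: field_simps)
    then show ?thesis using d by simp
  qed
  have b: "summable b" "\<And>i. 0 \<le> b i" "\<And>i. b i \<le> 1"
  proof -
    have "summable (\<lambda>i. real i powr (- (p * (s - \<tau>) / d)))"
      using \<delta> by (subst summable_real_powr_iff) auto
    then show "summable b" unfolding b_def by (subst summable_Suc_iff)
    show "b i \<le> 1" for i
    proof -
      have "b i \<le> real (Suc i) powr 0" unfolding b_def using \<delta> by (intro powr_mono) auto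
      then show ?thesis by simp
    qed
  qed (simp add: b_def)
  have eq: "besov_weight d \<tau> p i * \<bar>U \<omega> i\<bar> powr p = b i * \<bar>X i \<omega>\<bar> powr p" if "\<omega> \<in> space M" for \<omega> i
  proof -
    have "besov_weight d \<tau> p i * \<bar>U \<omega> i\<bar> powr p
        = real (Suc i) powr (p * \<tau> / d + p / 2 - 1) * real (Suc i) powr (- (s / d + 1 / 2 - 1 / p) * p) * \<bar>X i \<omega>\<bar> powr p"
      by (simp add: besov_weight_def UX[OF that] abs_mult powr_mult powr_powr)
    also have "real (Suc i) powr (p * \<tau> / d + p / 2 - 1) * real (Suc i) powr (- (s / d + 1 / 2 - 1 / p) * p) = b i"
      unfolding powr_add[symmetric] b_def using p d by (intro arg_cong2[where f = "(powr)"] refl) (simp add: field_simps)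
    finally show ?thesis .
  qed
  note moment = exp_power_sum_moment[OF indep X p b(2,3,1)]
  show AE: "AE \<omega> in M. U \<omega> \<in> elts (besov d \<tau> p)"
    using moment(1) AE_space by eventually_elim (simp add: besov_eq seq_space_def eq)
  have "AE \<omega> in M. exp (1 / 2 * nrm (besov d \<tau> p) (U \<omega>) powr p) = exp (1 / 2 * (\<Sum>i. b i * \<bar>X i \<omega>\<bar> powr p))"
    using AE AE_space
    by eventually_elim (simp add: besov_eq seq_space_nrm_powr p eq)
  moreover have "(\<lambda>\<omega>. exp (1 / 2 * nrm (besov d \<tau> p) (U \<omega>) powr p)) \<in> borel_measurable M"
  proof -
    have [measurable]: "(\<lambda>\<omega>. nrm (besov d \<tau> p) (U \<omega>)) \<in> borel_measurable M"
      unfolding besov_eq by (rule seq_space_nrm_measurable) (simp_all add: p U_meas)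
    show ?thesis by measurable
  qed
  ultimately show "integrable M (\<lambda>\<omega>. exp (1 / 2 * nrm (besov d \<tau> p) (U \<omega>) powr p))"
    using moment(2) by (subst integrable_cong_AE) auto
qed

end

section \<open>The log-likelihood\<close>

text \<open>The exponent of \<open>likelihood\<close> in terms of coefficients; both agree where
  \<open>L2_norm_eq\<close> applies, in particular on \<open>besov d r 1\<close> for
  \<open>real d / 2 \<le> r\<close>.\<close>

definition log_likelihood :: "(nat \<Rightarrow> real) \<Rightarrow> (nat \<Rightarrow> real) \<Rightarrow> real" where
  "log_likelihood z m = - (1 / 2) * (\<Sum>i. (z i)\<^sup>2) + pairing z m"

lemma abs_suminf_mult_le:
  fixes a b :: "nat \<Rightarrow> real"
  assumes a: "summable (\<lambda>i. \<bar>a i\<bar>)" and b: "summable (\<lambda>i. \<bar>b i\<bar>)"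
  shows "summable (\<lambda>i. \<bar>a i * b i\<bar>)" "\<bar>\<Sum>i. a i * b i\<bar> \<le> (\<Sum>i. \<bar>a i\<bar>) * (\<Sum>i. \<bar>b i\<bar>)"
proof -
  define B where "B = (\<Sum>i. \<bar>b i\<bar>)"
  have bB: "\<bar>b i\<bar> \<le> B" for i
    unfolding B_def using sum_le_suminf[OF b, of "{i}"] by simp
  have le: "\<bar>a i * b i\<bar> \<le> \<bar>a i\<bar> * B" for i
    using bB by (simp add: abs_mult mult_left_mono)
  show s: "summable (\<lambda>i. \<bar>a i * b i\<bar>)"
    by (rule summable_comparison_test_ev[OF _ summable_mult2[OF a, of B]]) (use le in \<open>auto intro: always_eventually\<close>)
  have "\<bar>\<Sum>i. a i * b i\<bar> \<le> (\<Sum>i. \<bar>a i * b i\<bar>)" by (rule summable_rabs[OF s])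
  also have "\<dots> \<le> (\<Sum>i. \<bar>a i\<bar> * B)" by (rule suminf_le[OF le s summable_mult2[OF a]])
  also have "\<dots> = (\<Sum>i. \<bar>a i\<bar>) * B" by (rule suminf_mult2[OF a, symmetric])
  finally show "\<bar>\<Sum>i. a i * b i\<bar> \<le> (\<Sum>i. \<bar>a i\<bar>) * (\<Sum>i. \<bar>b i\<bar>)" by (simp add: B_def)
qed

lemma besov_1:
  "z \<in> elts (besov d r 1) \<longleftrightarrow> summable (\<lambda>i. besov_weight d r 1 i * \<bar>z i\<bar>)"
  "z \<in> elts (besov d r 1) \<Longrightarrow> nrm (besov d r 1) z = (\<Sum>i. besov_weight d r 1 i * \<bar>z i\<bar>)"
  using suminf_nonneg[of "\<lambda>i. besov_weight d r 1 i * \<bar>z i\<bar>"]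
  by (auto simp: besov_eq seq_space_def less_imp_le)

text \<open>At integrability 1 the weight has exponent \<open>r / d - 1 / 2\<close>. Its
  nonnegativity embeds \<open>besov d r 1\<close> into the absolutely summable sequences, for which
  \<open>L2_norm\<close> is known.\<close>

lemma besov_weight_1_ge_1:
  assumes "0 < d" "real d / 2 \<le> r"
  shows "1 \<le> besov_weight d r 1 i"
proof -
  have "1 / 2 \<le> r / d" using assms by (simp add: field_simps)
  then have "real (Suc i) powr 0 \<le> besov_weight d r 1 i"
    unfolding besov_weight_def by (intro powr_mono) auto
  then show ?thesis by simp
qed

lemma besov_1_summable:
  assumes d: "0 < d" "real d / 2 \<le> r" and z: "z \<in> elts (besov d r 1)"
  shows "summable (\<lambda>i. \<bar>z i\<bar>)" "(\<Sum>i. \<bar>z i\<bar>) \<le> nrm (besov d r 1) z"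
    "summable (\<lambda>i. (z i)\<^sup>2)" "(\<Sum>i. (z i)\<^sup>2) \<le> (nrm (besov d r 1) z)\<^sup>2"
proof -
  have le: "\<bar>z i\<bar> \<le> besov_weight d r 1 i * \<bar>z i\<bar>" for i
    using mult_right_mono[OF besov_weight_1_ge_1[OF d, of i], of "\<bar>z i\<bar>"] by simp
  show s: "summable (\<lambda>i. \<bar>z i\<bar>)"
    by (rule summable_comparison_test_ev[OF _ z[unfolded besov_1]]) (use le in \<open>auto intro: always_eventually\<close>)
  show n: "(\<Sum>i. \<bar>z i\<bar>) \<le> nrm (besov d r 1) z"
    unfolding besov_1(2)[OF z] by (rule suminf_le[OF le s z[unfolded besov_1]])
  show "summable (\<lambda>i. (z i)\<^sup>2)" using abs_suminf_mult_le(1)[OF s s] by (simp add: power2_eq_square)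
  have "(\<Sum>i. (z i)\<^sup>2) \<le> (\<Sum>i. \<bar>z i\<bar>) * (\<Sum>i. \<bar>z i\<bar>)"
    using abs_suminf_mult_le(2)[OF s s] by (simp add: power2_eq_square)
  also have "\<dots> \<le> (nrm (besov d r 1) z)\<^sup>2"
    unfolding power2_eq_square using n suminf_nonneg[OF s] by (intro mult_mono) auto
  finally show "(\<Sum>i. (z i)\<^sup>2) \<le> (nrm (besov d r 1) z)\<^sup>2" .
qed

section \<open>The duality pairing and bounds for the log-likelihood\<close>

context
  fixes d :: nat and r :: real
begin

private abbreviation (input) "W \<equiv> besov_inf d (- r)"

text \<open>The weights for smoothness \<open>r\<close> and \<open>- r\<close> are reciprocal, with
  exponents \<open>r / d - 1 / 2\<close> and \<open>- r / d + 1 / 2\<close>; this makes the two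
  spaces dual under \<open>pairing\<close>.\<close>

lemma besov_inf_coordinate:
  assumes "m \<in> elts W"
  shows "\<bar>m i\<bar> \<le> besov_weight d r 1 i * nrm W m"
proof -
  have "real (Suc i) powr (- r / d + 1 / 2) * \<bar>m i\<bar> \<le> nrm W m"
    using assms unfolding besov_inf_def series_space.simps by (intro cSUP_upper) auto
  then have "besov_weight d r 1 i * (real (Suc i) powr (- r / d + 1 / 2) * \<bar>m i\<bar>)
      \<le> besov_weight d r 1 i * nrm W m"
    by (intro mult_left_mono) (auto intro: less_imp_le)
  moreover have "besov_weight d r 1 i * real (Suc i) powr (- r / d + 1 / 2) = 1"
    by (simp add: besov_weight_def powr_add[symmetric])
  ultimately show ?thesis by (metis mult.assoc mult_1)
qed

lemma besov_inf_nrm_nonneg: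
  assumes "m \<in> elts W"
  shows "0 \<le> nrm W m"
proof -
  have "0 \<le> besov_weight d r 1 0 * nrm W m"
    using besov_inf_coordinate[OF assms, of 0] by (rule order_trans[OF abs_ge_zero])
  then show ?thesis by (simp add: besov_weight_def)
qed

lemma besov_inf_diff:
  assumes "m \<in> elts W" "m' \<in> elts W"
  shows "m - m' \<in> elts W"
proof -
  have "real (Suc i) powr (- r / d + 1 / 2) * \<bar>(m - m') i\<bar>
      \<le> nrm W m + nrm W m'" for i
  proof -
    have "real (Suc i) powr (- r / d + 1 / 2) * \<bar>(m - m') i\<bar>
      \<le> real (Suc i) powr (- r / d + 1 / 2) * (\<bar>m i\<bar> + \<bar>m' i\<bar>)"
      by (intro mult_left_mono) auto
    also have "\<dots> = real (Suc i) powr (- r / d + 1 / 2) * \<bar>m i\<bar> + real (Suc i) powr (- r / d + 1 / 2) * \<bar>m' i\<bar>"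
      by (rule distrib_left)
    also have "\<dots> \<le> nrm W m + nrm W m'"
      using assms unfolding besov_inf_def series_space.simps by (intro add_mono cSUP_upper) auto
    finally show ?thesis .
  qed
  then show ?thesis unfolding besov_inf_def by (auto intro!: bdd_aboveI2)
qed

lemma pairing_besov:
  assumes z: "z \<in> elts (besov d r 1)" and m: "m \<in> elts W"
  shows "summable (\<lambda>i. \<bar>z i * m i\<bar>)" "\<bar>pairing z m\<bar> \<le> nrm (besov d r 1) z * nrm W m"
proof -
  let ?k = "nrm W m"
  have le: "\<bar>z i * m i\<bar> \<le> besov_weight d r 1 i * \<bar>z i\<bar> * ?k" for i
    using mult_left_mono[OF besov_inf_coordinate[OF m, of i], of "\<bar>z i\<bar>"] by (simp add: abs_mult mult_ac)
  note s' = summable_mult2[OF z[unfolded besov_1], of ?k]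
  show s: "summable (\<lambda>i. \<bar>z i * m i\<bar>)"
    by (rule summable_comparison_test_ev[OF _ s']) (use le in \<open>auto intro: always_eventually\<close>)
  have "\<bar>pairing z m\<bar> \<le> (\<Sum>i. \<bar>z i * m i\<bar>)" unfolding pairing_def by (rule summable_rabs[OF s])
  also have "\<dots> \<le> (\<Sum>i. besov_weight d r 1 i * \<bar>z i\<bar> * ?k)" by (rule suminf_le[OF le s s'])
  also have "\<dots> = nrm (besov d r 1) z * ?k"
    unfolding besov_1(2)[OF z] by (rule suminf_mult2[OF z[unfolded besov_1], symmetric])
  finally show "\<bar>pairing z m\<bar> \<le> nrm (besov d r 1) z * ?k" .
qed

lemma pairing_diff:
  assumes z: "z \<in> elts (besov d r 1)" "z' \<in> elts (besov d r 1)"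
    and m: "m \<in> elts W" "m' \<in> elts W"
  shows "pairing z m - pairing z' m' = pairing (z - z') m + pairing z' (m - m')"
proof -
  have s: "summable (\<lambda>i. u i * v i)" if "u \<in> elts (besov d r 1)" "v \<in> elts W" for u v
    using pairing_besov(1)[OF that] by (rule summable_rabs_cancel)
  note ss = s[OF z(1) m(1)] s[OF z(2) m(1)] s[OF z(2) m(2)]
  have "pairing (z - z') m = pairing z m - pairing z' m"
    unfolding pairing_def using ss by (simp add: suminf_diff algebra_simps)
  moreover have "pairing z' (m - m') = pairing z' m - pairing z' m'"
    unfolding pairing_def using ss by (simp add: suminf_diff algebra_simps)
  ultimately show ?thesis by simp
qed

text \<open>The quadratic parts differ by the pairing of \<open>z - z'\<close> with
  \<open>z + z'\<close>. The norm of smoothness \<open>r\<close> is used because the projection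
  errors are assumed small in that norm.\<close>

lemma log_likelihood_diff:
  assumes d: "0 < d" "real d / 2 \<le> r"
    and z: "z \<in> elts (besov d r 1)" "z' \<in> elts (besov d r 1)"
    and m: "m \<in> elts W" "m' \<in> elts W"
  shows "\<bar>log_likelihood z m - log_likelihood z' m'\<bar>
    \<le> nrm (besov d r 1) (z - z') * (nrm (besov d r 1) z + nrm (besov d r 1) z' + nrm W m)
      + nrm (besov d r 1) z' * nrm W (m - m')"
proof -
  let ?n = "nrm (besov d r 1)"
  have zz: "z - z' \<in> elts (besov d r 1)" "z + z' \<in> elts (besov d r 1)" "?n (z + z') \<le> ?n z + ?n z'"
    using z unfolding besov_eq by (auto intro!: seq_space_diff seq_space_add simp del: plus_fun_apply fun_diff_def)
  note s = besov_1_summable[OF d]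
  have n0: "0 \<le> ?n u" for u unfolding besov_eq by (simp add: seq_space_nrm)
  have "\<bar>(\<Sum>i. (z i)\<^sup>2) - (\<Sum>i. (z' i)\<^sup>2)\<bar> = \<bar>\<Sum>i. (z - z') i * (z + z') i\<bar>"
    using s(3)[OF z(1)] s(3)[OF z(2)] by (simp add: suminf_diff power2_eq_square algebra_simps)
  also have "\<dots> \<le> (\<Sum>i. \<bar>(z - z') i\<bar>) * (\<Sum>i. \<bar>(z + z') i\<bar>)"
    by (rule abs_suminf_mult_le[OF s(1)[OF zz(1)] s(1)[OF zz(2)]])
  also have "\<dots> \<le> ?n (z - z') * (?n z + ?n z')"
    using s(2)[OF zz(1)] s(2)[OF zz(2)] zz(3) suminf_nonneg[OF s(1)[OF zz(2)]] n0
    by (intro mult_mono) auto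
  finally have 1: "\<bar>(\<Sum>i. (z i)\<^sup>2) - (\<Sum>i. (z' i)\<^sup>2)\<bar> \<le> ?n (z - z') * (?n z + ?n z')" .
  have 2: "\<bar>pairing z m - pairing z' m'\<bar> \<le> ?n (z - z') * nrm W m + ?n z' * nrm W (m - m')"
    unfolding pairing_diff[OF z m]
    using pairing_besov(2)[OF zz(1) m(1)] pairing_besov(2)[OF z(2) besov_inf_diff[OF m]] by linarith
  have "\<bar>log_likelihood z m - log_likelihood z' m'\<bar>
      \<le> \<bar>(\<Sum>i. (z i)\<^sup>2) - (\<Sum>i. (z' i)\<^sup>2)\<bar> + \<bar>pairing z m - pairing z' m'\<bar>"
    by (simp add: log_likelihood_def abs_if field_simps)
  then show ?thesis using 1 2 by (simp add: algebra_simps)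
qed

text \<open>Splitting the series at frequency \<open>y\<close>: the low frequencies are absorbed by the quadratic term,
  the high ones are controlled by the smoothness of \<open>z\<close>.\<close>

lemma log_likelihood_split:
  assumes d: "0 < d" "real d / 2 < r" and w: "r \<le> w" "w \<le> r'" and y: "0 < y"
    and z: "z \<in> elts (besov d r' 1)"
    and m: "m \<in> elts W" "nrm W m \<le> K"
  shows "log_likelihood z m \<le> K\<^sup>2 * y powr (2 * r) / 2 + K * y powr (r - w) * nrm (besov d r' 1) z"
proof -
  let ?\<rho> = "\<lambda>\<sigma>. besov_weight d \<sigma> 1"
  \<comment> \<open>Index \<open>i\<close> stands for the frequency
    \<open>real (Suc i) powr (1 / d)\<close>; thus \<open>I\<close> collects the frequencies up to
    \<open>y\<close> and has at most \<open>y powr d\<close> elements.\<close>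
  define I where "I = {i. real (Suc i) \<le> y powr d}"
  have K: "0 \<le> K" using besov_inf_nrm_nonneg[OF m(1)] m(2) by simp
  have zr: "z \<in> elts (besov d r 1)"
    using z w unfolding besov_eq
    by (rule_tac seq_space_mono(1)[where a = "?\<rho> r'"]) (auto intro: besov_weight_mono simp: less_imp_le)
  have I: "I \<subseteq> {..<nat \<lfloor>y powr d\<rfloor>}"
  proof
    fix i assume "i \<in> I"
    then have "of_nat (Suc i) \<le> y powr d" by (simp add: I_def)
    then have "int (Suc i) \<le> \<lfloor>y powr d\<rfloor>" by (simp add: le_floor_iff del: of_nat_Suc)
    then show "i \<in> {..<nat \<lfloor>y powr d\<rfloor>}" by auto
  qed
  then have finI: "finite I" and cardI: "card I \<le> nat \<lfloor>y powr d\<rfloor>"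
    using finite_subset card_mono[OF _ I] by auto
  have cardI: "real (card I) \<le> y powr d"
  proof -
    have "real (card I) \<le> real (nat \<lfloor>y powr d\<rfloor>)" by (rule of_nat_mono[OF cardI])
    also have "\<dots> \<le> y powr d" by simp
    finally show ?thesis .
  qed
  define a where "a i = (if i \<in> I then K\<^sup>2 * y powr (2 * r - d) / 2 else 0)" for i
  have termwise: "z i * m i \<le> (z i)\<^sup>2 / 2 + a i + K * y powr (r - w) * (?\<rho> r' i * \<bar>z i\<bar>)" for i
  proof -
    have "z i * m i \<le> \<bar>z i\<bar> * \<bar>m i\<bar>" by (metis abs_ge_self abs_mult)
    also have "\<dots> \<le> \<bar>z i\<bar> * (?\<rho> r i * K)"
      using order_trans[OF besov_inf_coordinate[OF m(1), of i] mult_left_mono[OF m(2) less_imp_le[OF besov_weight_pos]]]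
      by (intro mult_left_mono) auto
    finally have *: "z i * m i \<le> K * ?\<rho> r i * \<bar>z i\<bar>" by (simp add: mult_ac)
    show ?thesis
    proof (cases "i \<in> I")
      case True
      \<comment> \<open>Completing the square against half of \<open>(z i)\<^sup>2\<close> costs at
        most \<open>a i\<close>: since \<open>2 * r > d\<close>, the cost is largest at frequency
        \<open>y\<close>. Summed over at most \<open>y powr d\<close> indices this gives
        \<open>K\<^sup>2 * y powr (2 * r) / 2\<close>.\<close>
      have "0 \<le> (K * ?\<rho> r i - \<bar>z i\<bar>)\<^sup>2" by simp
      then have "K * ?\<rho> r i * \<bar>z i\<bar> \<le> (z i)\<^sup>2 / 2 + K\<^sup>2 * (?\<rho> r i)\<^sup>2 / 2"
        by (simp add: power2_diff power_mult_distrib algebra_simps)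
      also have "(?\<rho> r i)\<^sup>2 \<le> y powr (2 * r - d)"
      proof -
        have "(?\<rho> r i)\<^sup>2 = real (Suc i) powr ((2 * r - d) / d)"
          using d unfolding besov_weight_def power2_eq_square powr_add[symmetric]
          by (intro arg_cong2[where f = "(powr)"] refl) (simp add: field_simps)
        also have "\<dots> \<le> (y powr d) powr ((2 * r - d) / d)"
          using True d by (intro powr_mono2) (auto simp: I_def)
        also have "\<dots> = y powr (2 * r - d)" using d by (simp add: powr_powr)
        finally show ?thesis .
      qed
      then have "K\<^sup>2 * (?\<rho> r i)\<^sup>2 / 2 \<le> a i" using True by (simp add: a_def mult_left_mono)
      finally have "K * ?\<rho> r i * \<bar>z i\<bar> \<le> (z i)\<^sup>2 / 2 + a i" by simp
      moreover have "0 \<le> K * y powr (r - w) * (?\<rho> r' i * \<bar>z i\<bar>)" using K by (simp add: less_imp_le)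
      ultimately show ?thesis using * by linarith
    next
      case False
      \<comment> \<open>Lowering the smoothness from \<open>w\<close> to \<open>r\<close> gains the
        frequency to the power \<open>r - w\<close>, which is at most \<open>y powr (r - w)\<close>
        above the cutoff.\<close>
      have "?\<rho> r i = (real (Suc i) powr (1 / d)) powr (r - w) * ?\<rho> w i"
        unfolding besov_weight_def powr_powr powr_add[symmetric] using d
        by (intro arg_cong2[where f = "(powr)"] refl) (simp add: field_simps)
      also have "\<dots> \<le> y powr (r - w) * ?\<rho> r' i"
      proof (intro mult_mono besov_weight_mono)
        have "(y powr d) powr (1 / d) \<le> real (Suc i) powr (1 / d)"
          using False by (intro powr_mono2) (auto simp: I_def)
        then have "y \<le> real (Suc i) powr (1 / d)" using d y by (simp add: powr_powr)
        then show "(real (Suc i) powr (1 / d)) powr (r - w) \<le> y powr (r - w)"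
          using y w by (intro powr_mono2') auto
      qed (use w in \<open>auto intro: less_imp_le\<close>)
      finally have "K * ?\<rho> r i * \<bar>z i\<bar> \<le> K * (y powr (r - w) * ?\<rho> r' i) * \<bar>z i\<bar>"
        using K by (intro mult_right_mono mult_left_mono) auto
      moreover have "0 \<le> (z i)\<^sup>2 / 2" by simp
      moreover have "a i = 0" using False by (simp add: a_def)
      ultimately show ?thesis using * by (simp only: mult_ac) 
    qed
  qed
  have s2: "summable (\<lambda>i. (z i)\<^sup>2)" by (rule besov_1_summable[OF d(1) _ zr]) (use d in simp)
  have sr': "summable (\<lambda>i. ?\<rho> r' i * \<bar>z i\<bar>)" using z by (simp add: besov_1)
  have sa: "summable a" and suma: "(\<Sum>i. a i) = real (card I) * (K\<^sup>2 * y powr (2 * r - d) / 2)"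
  proof -
    have "a sums (\<Sum>i\<in>I. a i)" by (rule sums_finite[OF finI]) (simp add: a_def)
    moreover have "(\<Sum>i\<in>I. a i) = real (card I) * (K\<^sup>2 * y powr (2 * r - d) / 2)" by (simp add: a_def)
    ultimately show "summable a" "(\<Sum>i. a i) = real (card I) * (K\<^sup>2 * y powr (2 * r - d) / 2)"
      by (simp_all only: sums_iff)
  qed
  have "pairing z m \<le> (\<Sum>i. (z i)\<^sup>2 / 2 + a i + K * y powr (r - w) * (?\<rho> r' i * \<bar>z i\<bar>))"
    unfolding pairing_def
    using summable_rabs_cancel[OF pairing_besov(1)[OF zr m(1)]] s2 sa sr'
    by (intro suminf_le termwise summable_add summable_mult summable_divide)
  also have "\<dots> = (\<Sum>i. (z i)\<^sup>2) / 2 + (\<Sum>i. a i) + K * y powr (r - w) * nrm (besov d r' 1) z"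
    unfolding besov_1(2)[OF z] using s2 sa sr'
    by (simp add: suminf_add[symmetric] summable_add summable_mult summable_divide suminf_mult suminf_divide)
  also have "(\<Sum>i. a i) \<le> y powr d * (K\<^sup>2 * y powr (2 * r - d) / 2)"
    unfolding suma using cardI by (intro mult_right_mono) auto
  also have "y powr d * (K\<^sup>2 * y powr (2 * r - d) / 2) = K\<^sup>2 * y powr (2 * r) / 2"
    using y by (simp add: powr_diff)
  finally show ?thesis by (simp add: log_likelihood_def)
qed

text \<open>Young's inequality with a prescribed share \<open>1 / 8\<close> of
  \<open>R powr p\<close>: either the linear term is already below that share, or \<open>R\<close>
  is bounded by a power of \<open>x\<close>.\<close>

lemma linear_le_powr:
  fixes x R p :: real
  assumes "1 < p" "0 \<le> x" "0 \<le> R"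
  shows "x * R \<le> R powr p / 8 + 8 powr (1 / (p - 1)) * x powr (p / (p - 1))"
proof (cases "x * 8 \<le> R powr (p - 1)")
  case True
  have "x * R \<le> R powr (p - 1) / 8 * R" using True assms by (intro mult_right_mono) auto
  also have "\<dots> = R powr p / 8" using assms by (cases "R = 0") (auto simp: powr_diff)
  finally show ?thesis by (smt (verit) mult_nonneg_nonneg powr_ge_zero)
next
  case False
  then have x: "x > 0" using assms(2) by (cases "x = 0") auto
  have "(R powr (p - 1)) powr (1 / (p - 1)) \<le> (x * 8) powr (1 / (p - 1))"
    using False assms by (intro powr_mono2) auto
  then have "R \<le> 8 powr (1 / (p - 1)) * x powr (1 / (p - 1))"
    using assms by (simp add: powr_powr powr_mult mult.commute)
  then have "x * R \<le> x * (8 powr (1 / (p - 1)) * x powr (1 / (p - 1)))"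
    using assms by (intro mult_left_mono)
  also have "\<dots> = 8 powr (1 / (p - 1)) * (x powr 1 * x powr (1 / (p - 1)))"
    using x by simp
  also have "x powr 1 * x powr (1 / (p - 1)) = x powr (p / (p - 1))"
    unfolding powr_add[symmetric] using assms by (intro arg_cong2[where f = "(powr)"] refl) (simp add: field_simps)
  finally show ?thesis by (smt (verit) powr_ge_zero divide_nonneg_nonneg)
qed

text \<open>Optimises the cutoff of \<open>log_likelihood_split\<close>. With \<open>y\<close>
  proportional to \<open>(1 + K) powr e\<close> the low frequencies cost a multiple of
  \<open>(1 + K) powr B\<close>, and the coefficient of \<open>R\<close> is of order
  \<open>(1 + K) powr ((1 - 1 / p) * B)\<close>, which Young's inequality raises to the power
  \<open>p / (p - 1)\<close>, so that it becomes \<open>(1 + K) powr B\<close> too. For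
  \<open>p = 1\<close> there is nothing to raise, and the coefficient itself has to be at most
  \<open>1 / 8\<close>.\<close>

lemma log_likelihood_upper:
  assumes d: "0 < d" "real d / 2 < r" and w: "r \<le> w" "w \<le> r'" "p = 1 \<longrightarrow> r < w"
    and p: "1 \<le> p" and A: "0 \<le> A"
  obtains C where "1 \<le> C"
    "\<And>z m R K. z \<in> elts (besov d r' 1) \<Longrightarrow> nrm (besov d r' 1) z \<le> A * R \<Longrightarrow> 0 \<le> R \<Longrightarrow>
      m \<in> elts W \<Longrightarrow> nrm W m \<le> K \<Longrightarrow>
      log_likelihood z m \<le> C * (1 + K) powr (2 * w / (w - r + 2 * r * (1 - 1 / p))) + R powr p / 8"
proof -
  have r0: "0 < r" using d by linarith
  define D where "D = w - r + 2 * r * (1 - 1 / p)"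
  have D: "0 < D"
  proof (cases "p = 1")
    case False
    then have "0 < 2 * r * (1 - 1 / p)" using p r0 by simp
    then show ?thesis using w unfolding D_def by linarith
  qed (use w in \<open>simp add: D_def\<close>)
  define B where "B = 2 * w / D"
  \<comment> \<open>\<open>B\<close> and \<open>e\<close> solve the linear system formed by the two
    exponent identities \<open>e1\<close> and \<open>e2\<close>.\<close>
  define e where "e = (1 - 2 * (1 - 1 / p)) / D"
  have e1: "2 + 2 * r * e = B" and e2: "1 + (r - w) * e = (1 - 1 / p) * B"
  proof -
    define \<pi> where "\<pi> = 1 - 1 / p"
    have De: "D * e = 1 - 2 * \<pi>" using D by (simp add: e_def \<pi>_def)
    have DB: "D * B = 2 * w" using D by (simp add: B_def)
    have D': "D = w - r + 2 * r * \<pi>" by (simp add: D_def \<pi>_def)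
    have "D * (2 + 2 * r * e) = 2 * D + 2 * r * (D * e)" by (simp add: algebra_simps)
    also have "\<dots> = 2 * (w - r + 2 * r * \<pi>) + 2 * r * (1 - 2 * \<pi>)" by (simp only: De) (simp only: D')
    also have "\<dots> = D * B" unfolding DB by (simp add: algebra_simps)
    finally show "2 + 2 * r * e = B" using D by simp
    have "D * (1 + (r - w) * e) = D + (r - w) * (D * e)" by (simp add: algebra_simps)
    also have "\<dots> = (w - r + 2 * r * \<pi>) + (r - w) * (1 - 2 * \<pi>)" by (simp only: De) (simp only: D')
    also have "\<dots> = \<pi> * (D * B)" unfolding DB by (simp add: algebra_simps)
    finally have "D * (1 + (r - w) * e) = D * (\<pi> * B)" by (simp add: algebra_simps)
    then show "1 + (r - w) * e = (1 - 1 / p) * B" using D by (simp add: \<pi>_def)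
  qed
  have main: "log_likelihood z m \<le> \<nu> powr (2 * r) / 2 * \<kappa> powr B + \<nu> powr (r - w) * A * \<kappa> powr ((1 - 1 / p) * B) * R"
    if z: "z \<in> elts (besov d r' 1)" "nrm (besov d r' 1) z \<le> A * R" and R: "0 \<le> R"
      and m: "m \<in> elts W" "nrm W m \<le> K"
      and \<nu>: "0 < \<nu>" and \<kappa>: "\<kappa> = 1 + K"
    for z m R K \<nu> \<kappa>
  proof -
    have \<kappa>1: "\<kappa> \<ge> 1" using besov_inf_nrm_nonneg[OF m(1)] m(2) \<kappa> by simp
    define y where "y = \<nu> * \<kappa> powr e"
    have y: "0 < y" using \<nu> \<kappa>1 by (simp add: y_def)
    have "log_likelihood z m \<le> \<kappa>\<^sup>2 * y powr (2 * r) / 2 + \<kappa> * y powr (r - w) * nrm (besov d r' 1) z"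
      by (rule log_likelihood_split[OF d w(1,2) y z(1) m(1)]) (use m \<kappa> in simp)
    also have "\<dots> \<le> \<kappa>\<^sup>2 * y powr (2 * r) / 2 + \<kappa> * y powr (r - w) * (A * R)"
      using \<kappa>1 z by (intro add_left_mono mult_left_mono) auto
    also have "\<kappa>\<^sup>2 * y powr (2 * r) = \<nu> powr (2 * r) * \<kappa> powr B"
    proof -
      have "\<kappa>\<^sup>2 * y powr (2 * r) = \<nu> powr (2 * r) * (\<kappa> powr 2 * \<kappa> powr (2 * r * e))"
        using \<nu> \<kappa>1 by (simp add: y_def powr_mult powr_powr mult_ac)
      then show ?thesis unfolding powr_add[symmetric] e1 .
    qed
    also have "\<kappa> * y powr (r - w) = \<nu> powr (r - w) * \<kappa> powr ((1 - 1 / p) * B)"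
    proof -
      have "\<kappa> * y powr (r - w) = \<nu> powr (r - w) * (\<kappa> powr 1 * \<kappa> powr ((r - w) * e))"
        using \<nu> \<kappa>1 by (simp add: y_def powr_mult powr_powr mult_ac)
      then show ?thesis unfolding powr_add[symmetric] e2 .
    qed
    finally show ?thesis by (simp add: mult_ac)
  qed
  show thesis
  proof (cases "p = 1")
    case True
    then have w': "r < w" using w by simp
    \<comment> \<open>For \<open>p = 1\<close> the power of \<open>1 + K\<close> in front of
      \<open>R\<close> is 0, so a large constant factor in the cutoff brings the coefficient below
      \<open>1 / 8\<close>; here \<open>r < w\<close> is used.\<close>
    define \<nu> where "\<nu> = (8 * A + 1) powr (1 / (w - r))"
    have \<nu>: "0 < \<nu>" using A by (simp add: \<nu>_def)
    have "\<nu> powr (r - w) = (8 * A + 1) powr (- 1)"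
      unfolding \<nu>_def powr_powr using w' by (intro arg_cong2[where f = "(powr)"] refl) (simp add: field_simps)
    then have eq: "\<nu> powr (r - w) = 1 / (8 * A + 1)"
      using A by (simp add: powr_minus_divide)
    have \<nu>A: "\<nu> powr (r - w) * A \<le> 1 / 8"
      unfolding eq using A by (simp add: field_simps)
    show thesis
    proof (rule that[of "1 + \<nu> powr (2 * r) / 2"])
      fix z m R K
      assume *: "z \<in> elts (besov d r' 1)" "nrm (besov d r' 1) z \<le> A * R" "0 \<le> R"
        "m \<in> elts W" "nrm W m \<le> K"
      then have K: "0 < 1 + K" using besov_inf_nrm_nonneg[OF *(4)] by linarith
      have "log_likelihood z m \<le> \<nu> powr (2 * r) / 2 * (1 + K) powr B + \<nu> powr (r - w) * A * R"
        using main[OF * \<nu> refl] True K by simp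
      also have "\<dots> \<le> (1 + \<nu> powr (2 * r) / 2) * (1 + K) powr B + 1 / 8 * R"
        using \<nu>A * by (intro add_mono mult_right_mono) auto
      finally show "log_likelihood z m \<le> (1 + \<nu> powr (2 * r) / 2) * (1 + K) powr (2 * w / (w - r + 2 * r * (1 - 1 / p))) + R powr p / 8"
        using True * unfolding B_def D_def by simp
    qed simp
  next
    case False
    then have p1: "1 < p" using p by simp
    define c where "c = 8 powr (1 / (p - 1)) * A powr (p / (p - 1))"
    show thesis
    proof (rule that[of "1 + c"])
      fix z m R K
      assume *: "z \<in> elts (besov d r' 1)" "nrm (besov d r' 1) z \<le> A * R" "0 \<le> R"
        "m \<in> elts W" "nrm W m \<le> K"
      define x where "x = A * (1 + K) powr ((1 - 1 / p) * B)"
      have "log_likelihood z m \<le> (1 + K) powr B + x * R"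
      proof -
        have "log_likelihood z m \<le> 1 / 2 * (1 + K) powr B + x * R"
          using main[OF * zero_less_one refl] by (simp add: x_def)
        then show ?thesis using powr_ge_zero[of "1 + K" B] by linarith
      qed
      also have "x * R \<le> R powr p / 8 + 8 powr (1 / (p - 1)) * x powr (p / (p - 1))"
        using p1 A * by (intro linear_le_powr) (auto simp: x_def)
      also have "x powr (p / (p - 1)) = A powr (p / (p - 1)) * (1 + K) powr ((1 - 1 / p) * B * (p / (p - 1)))"
        using A by (simp add: x_def powr_mult powr_powr)
      also have "(1 - 1 / p) * B * (p / (p - 1)) = B" using p1 by (simp add: field_simps)
      finally show "log_likelihood z m \<le> (1 + c) * (1 + K) powr (2 * w / (w - r + 2 * r * (1 - 1 / p))) + R powr p / 8"
        unfolding B_def D_def c_def by (simp add: algebra_simps)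
    qed (simp add: c_def)
  qed
qed

end

section \<open>Moments and stability of weighted means\<close>

text \<open>Tangent-line bound for the exponential. The sum of both exponentials on the right spares
  a decision which is larger, and integrates to moments of both models.\<close>

lemma abs_exp_diff_le:
  fixes x y :: real
  shows "\<bar>exp x - exp y\<bar> \<le> \<bar>x - y\<bar> * (exp x + exp y)"
proof -
  have *: "exp u - exp v \<le> \<bar>u - v\<bar> * (exp u + exp v)" for u v :: real
  proof -
    have "1 + (v - u) \<le> exp (v - u)" by (rule exp_ge_add_one_self)
    then have "exp u * (1 + (v - u)) \<le> exp u * exp (v - u)" by (intro mult_left_mono) auto
    then have "exp u - exp v \<le> (u - v) * exp u" by (simp add: exp_diff algebra_simps)
    also have "\<dots> \<le> \<bar>u - v\<bar> * (exp u + exp v)" by (intro mult_mono) auto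
    finally show ?thesis .
  qed
  show ?thesis using *[of x y] *[of y x] by (auto simp: abs_if algebra_simps split: if_splits)
qed

text \<open>Let \<open>y = 2 + x powr p\<close>, which is at least \<open>1 + x\<close>. From
  \<open>y \<le> n * exp (y / n)\<close> the \<open>a\<close>-th power costs
  \<open>exp (a * y / n)\<close>, and \<open>n = 4 * (a + 1)\<close> makes this at most
  \<open>exp (y / 4)\<close>.\<close>

lemma powr_le_exp_power:
  fixes x a p :: real
  assumes x: "0 \<le> x" and p: "1 \<le> p" and a: "0 \<le> a"
  shows "(1 + x) powr a \<le> (4 * (a + 1)) powr a * exp (1 / 2) * exp (x powr p / 4)"
proof -
  let ?n = "4 * (a + 1)" and ?y = "2 + x powr p"
  have "x \<le> 1 + x powr p"
  proof (cases "x \<le> 1")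
    case False
    then have "x powr 1 \<le> x powr p" using p by (intro powr_mono) auto
    then show ?thesis using False by simp
  qed (use powr_ge_zero[of x p] in linarith)
  moreover have "?y / ?n \<le> exp (?y / ?n)" using exp_ge_add_one_self[of "?y / ?n"] by linarith
  then have "?y \<le> ?n * exp (?y / ?n)" using a by (simp add: field_simps)
  ultimately have "(1 + x) powr a \<le> (?n * exp (?y / ?n)) powr a"
    using x a by (intro powr_mono2) auto
  also have "\<dots> = ?n powr a * exp (a * (?y / ?n))"
    using a by (simp add: powr_mult) (simp add: powr_def)
  also have "\<dots> \<le> ?n powr a * exp (1 / 2 + x powr p / 4)"
  proof (intro mult_left_mono)
    have "a * ?y \<le> (a + 1) * ?y" by (intro mult_right_mono) (auto intro: add_nonneg_nonneg)
    then have "a * (?y / ?n) \<le> 1 / 2 + x powr p / 4" using a by (simp add: field_simps)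
    then show "exp (a * (?y / ?n)) \<le> exp (1 / 2 + x powr p / 4)" by simp
  qed simp
  finally show ?thesis by (simp add: exp_add mult.assoc)
qed

context prob_space
begin

text \<open>Jensen's inequality for the exponential: integrate its tangent line at the mean.\<close>

lemma exp_integral_ge:
  fixes \<Phi> :: "'a \<Rightarrow> real"
  assumes "integrable M \<Phi>" "integrable M (\<lambda>x. exp (\<Phi> x))" "b \<le> (LINT x|M. \<Phi> x)"
  shows "exp b \<le> (LINT x|M. exp (\<Phi> x))"
proof -
  let ?m = "LINT x|M. \<Phi> x"
  have "exp ?m = (LINT x|M. exp ?m * (1 + (\<Phi> x - ?m)))"
    using assms(1) by (simp add: prob_space)
  also have "\<dots> \<le> (LINT x|M. exp (\<Phi> x))"
  proof (rule integral_mono[OF _ assms(2)])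
    show "integrable M (\<lambda>x. exp ?m * (1 + (\<Phi> x - ?m)))" using assms(1) by simp
    show "exp ?m * (1 + (\<Phi> x - ?m)) \<le> exp (\<Phi> x)" for x
      using mult_left_mono[OF exp_ge_add_one_self[of "\<Phi> x - ?m"], of "exp ?m"] by (simp add: exp_add[symmetric])
  qed
  finally show ?thesis using assms(3) by (meson exp_le_cancel_iff order_trans)
qed

context
  fixes R :: "'a \<Rightarrow> real" and p :: real
  assumes R: "R \<in> borel_measurable M" "\<And>x. 0 \<le> R x" and p: "1 \<le> p"
    and exp_R: "integrable M (\<lambda>x. exp (1 / 2 * R x powr p))"
begin

lemma powr_moment_integrable:
  assumes "0 \<le> a"
  shows "integrable M (\<lambda>x. (1 + R x) powr a)"
proof (rule Bochner_Integration.integrable_bound)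
  let ?D = "(4 * (a + 1)) powr a * exp (1 / 2)"
  show "integrable M (\<lambda>x. ?D * exp (1 / 2 * R x powr p))" using exp_R by simp
  have "(1 + R x) powr a \<le> ?D * exp (1 / 2 * R x powr p)" for x
  proof -
    have "(1 + R x) powr a \<le> ?D * exp (R x powr p / 4)"
      by (rule powr_le_exp_power[OF R(2) p assms])
    also have "\<dots> \<le> ?D * exp (1 / 2 * R x powr p)"
      using powr_ge_zero[of "R x" p] by (intro mult_left_mono) auto
    finally show ?thesis .
  qed
  then show "AE x in M. norm ((1 + R x) powr a) \<le> norm (?D * exp (1 / 2 * R x powr p))" by simp
qed (use R in measurable)

text \<open>Where \<open>R\<^sup>p \<le> 8 \<kappa>\<close> the moment is bounded pointwise; elsewhere the prior absorbs the likelihood.\<close>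

lemma posterior_moment:
  assumes \<Phi>: "\<Phi> \<in> borel_measurable M" "AE x in M. \<Phi> x \<le> \<kappa> + R x powr p / 8"
    and \<kappa>: "1 \<le> \<kappa>" and a: "0 \<le> a"
  shows "integrable M (\<lambda>x. (1 + R x) powr a * exp (\<Phi> x))"
    "(LINT x|M. (1 + R x) powr a * exp (\<Phi> x))
      \<le> 9 powr a * \<kappa> powr (a / p) * (LINT x|M. exp (\<Phi> x))
        + (4 * (a + 1)) powr a * exp (1 / 2) * (LINT x|M. exp (1 / 2 * R x powr p))"
    "integrable M (\<lambda>x. exp (\<Phi> x))"
proof -
  let ?D = "(4 * (a + 1)) powr a * exp (1 / 2)"
  note [measurable] = \<Phi>(1) R(1)
  show exp_\<Phi>: "integrable M (\<lambda>x. exp (\<Phi> x))"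
  proof (rule Bochner_Integration.integrable_bound)
    show "integrable M (\<lambda>x. exp \<kappa> * exp (1 / 2 * R x powr p))" using exp_R by simp
    show "AE x in M. norm (exp (\<Phi> x)) \<le> norm (exp \<kappa> * exp (1 / 2 * R x powr p))"
      using \<Phi>(2)
    proof eventually_elim
      case (elim x)
      then have "\<Phi> x \<le> \<kappa> + 1 / 2 * R x powr p" using powr_ge_zero[of "R x" p] by linarith
      then show ?case by (simp add: exp_add[symmetric])
    qed
  qed simp
  have le: "AE x in M. (1 + R x) powr a * exp (\<Phi> x)
      \<le> 9 powr a * \<kappa> powr (a / p) * exp (\<Phi> x) + ?D * exp (1 / 2 * R x powr p)"
    using \<Phi>(2)
  proof eventually_elim
    case (elim x)
    have \<kappa>p: "1 \<le> \<kappa> powr (1 / p)" using \<kappa> p by (intro ge_one_powr_ge_zero) auto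
    show ?case
    proof (cases "R x powr p \<le> 8 * \<kappa>")
      case True
      then have "(R x powr p) powr (1 / p) \<le> (8 * \<kappa>) powr (1 / p)" using p by (intro powr_mono2) auto
      then have "R x \<le> 8 powr (1 / p) * \<kappa> powr (1 / p)" using p R(2)[of x] \<kappa> by (simp add: powr_powr powr_mult)
      also have "\<dots> \<le> 8 powr 1 * \<kappa> powr (1 / p)" using p by (intro mult_right_mono powr_mono) auto
      finally have "1 + R x \<le> 9 * \<kappa> powr (1 / p)" using \<kappa>p by simp
      then have "(1 + R x) powr a \<le> (9 * \<kappa> powr (1 / p)) powr a" using R(2)[of x] a by (intro powr_mono2) auto
      also have "\<dots> = 9 powr a * \<kappa> powr (a / p)" by (simp add: powr_mult powr_powr)
      finally have "(1 + R x) powr a * exp (\<Phi> x) \<le> 9 powr a * \<kappa> powr (a / p) * exp (\<Phi> x)"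
        by (intro mult_right_mono) auto
      moreover have "0 \<le> ?D * exp (1 / 2 * R x powr p)" by simp
      ultimately show ?thesis by linarith
    next
      case False
      \<comment> \<open>Here \<open>\<kappa> < R x powr p / 8\<close>, so \<open>\<Phi> x\<close> is
        at most \<open>R x powr p / 4\<close>; the polynomial factor takes another quarter, and
        together they use up the integrable exponent \<open>1 / 2\<close>.\<close>
      have "(1 + R x) powr a * exp (\<Phi> x) \<le> (?D * exp (R x powr p / 4)) * exp (R x powr p / 4)"
        using False elim by (intro mult_mono powr_le_exp_power[OF R(2) p a]) auto
      also have "\<dots> = ?D * exp (1 / 2 * R x powr p)" by (simp add: mult.assoc exp_add[symmetric])
      moreover have "0 \<le> 9 powr a * \<kappa> powr (a / p) * exp (\<Phi> x)" by simp
      ultimately show ?thesis by linarith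
    qed
  qed
  have int: "integrable M (\<lambda>x. 9 powr a * \<kappa> powr (a / p) * exp (\<Phi> x) + ?D * exp (1 / 2 * R x powr p))"
    using exp_\<Phi> exp_R by simp
  show 1: "integrable M (\<lambda>x. (1 + R x) powr a * exp (\<Phi> x))"
  proof (rule Bochner_Integration.integrable_bound[OF int])
    show "AE x in M. norm ((1 + R x) powr a * exp (\<Phi> x)) \<le> norm (9 powr a * \<kappa> powr (a / p) * exp (\<Phi> x) + ?D * exp (1 / 2 * R x powr p))"
      using le by eventually_elim simp
  qed simp
  have "(LINT x|M. (1 + R x) powr a * exp (\<Phi> x))
      \<le> (LINT x|M. 9 powr a * \<kappa> powr (a / p) * exp (\<Phi> x) + ?D * exp (1 / 2 * R x powr p))"
    by (rule integral_mono_AE[OF 1 int le])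
  also have "\<dots> = 9 powr a * \<kappa> powr (a / p) * (LINT x|M. exp (\<Phi> x)) + ?D * (LINT x|M. exp (1 / 2 * R x powr p))"
    using exp_\<Phi> exp_R by simp
  finally show "(LINT x|M. (1 + R x) powr a * exp (\<Phi> x))
      \<le> 9 powr a * \<kappa> powr (a / p) * (LINT x|M. exp (\<Phi> x)) + ?D * (LINT x|M. exp (1 / 2 * R x powr p))" .
qed

end

text \<open>\<open>S b\<close> bounds the posterior moment of order \<open>b\<close> in both models.
  The difference of the normalised integrands is split into \<open>l1\<close> times
  \<open>G1 - G2\<close> and \<open>l1 - l2\<close> times \<open>G2\<close>: the first part costs a
  moment of order \<open>q + 1\<close>, the second one of order \<open>q + 2\<close> and, through
  the normalising constants, a product of moments of orders \<open>q\<close> and 2.\<close>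

lemma weighted_mean_stability:
  fixes a :: "nat \<Rightarrow> real" and p :: real and G1 G2 :: "'a \<Rightarrow> nat \<Rightarrow> real" and S :: "real \<Rightarrow> real"
  defines "X \<equiv> seq_space a p"
  assumes a: "\<And>i. 0 < a i" and p: "1 \<le> p"
    and R: "\<And>x. 0 \<le> R x"
    and G_meas: "\<And>j. (\<lambda>x. G1 x j) \<in> borel_measurable M" "\<And>j. (\<lambda>x. G2 x j) \<in> borel_measurable M"
    and G: "AE x in M. G1 x \<in> elts X \<and> nrm X (G1 x) \<le> c * (1 + R x) powr q"
      "AE x in M. G2 x \<in> elts X \<and> nrm X (G2 x) \<le> c * (1 + R x) powr q"
    and G_diff: "AE x in M. nrm X (G1 x - G2 x) \<le> \<epsilon> * c * (1 + R x) powr (q + 1)"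
    and \<Phi>_meas: "\<Phi>1 \<in> borel_measurable M" "\<Phi>2 \<in> borel_measurable M"
    and \<Phi>_diff: "AE x in M. \<bar>\<Phi>1 x - \<Phi>2 x\<bar> \<le> \<epsilon> * H * (1 + R x) powr 2"
    and nonneg: "0 \<le> c" "0 \<le> \<epsilon>" "0 \<le> H"
    and int1: "\<And>b. b \<in> {0, q, q + 1, q + 2, 2} \<Longrightarrow> integrable M (\<lambda>x. (1 + R x) powr b * exp (\<Phi>1 x))"
    and int2: "\<And>b. b \<in> {0, q, q + 1, q + 2, 2} \<Longrightarrow> integrable M (\<lambda>x. (1 + R x) powr b * exp (\<Phi>2 x))"
    and le1: "\<And>b. b \<in> {q, q + 1, q + 2, 2} \<Longrightarrow> (LINT x|M. (1 + R x) powr b * exp (\<Phi>1 x)) \<le> S b * (LINT x|M. exp (\<Phi>1 x))"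
    and le2: "\<And>b. b \<in> {q, q + 1, q + 2, 2} \<Longrightarrow> (LINT x|M. (1 + R x) powr b * exp (\<Phi>2 x)) \<le> S b * (LINT x|M. exp (\<Phi>2 x))"
    and pos: "0 < (LINT x|M. exp (\<Phi>1 x))" "0 < (LINT x|M. exp (\<Phi>2 x))"
  shows "(1 / (LINT x|M. exp (\<Phi>1 x))) *\<^sub>R (\<lambda>j. LINT x|M. (exp (\<Phi>1 x) *\<^sub>R G1 x) j)
      - (1 / (LINT x|M. exp (\<Phi>2 x))) *\<^sub>R (\<lambda>j. LINT x|M. (exp (\<Phi>2 x) *\<^sub>R G2 x) j) \<in> elts X" (is "?v \<in> _")
    "nrm X ((1 / (LINT x|M. exp (\<Phi>1 x))) *\<^sub>R (\<lambda>j. LINT x|M. (exp (\<Phi>1 x) *\<^sub>R G1 x) j)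
      - (1 / (LINT x|M. exp (\<Phi>2 x))) *\<^sub>R (\<lambda>j. LINT x|M. (exp (\<Phi>2 x) *\<^sub>R G2 x) j))
     \<le> c * \<epsilon> * (S (q + 1) + 3 * H * S (q + 2) + 6 * H * S q * S 2)"
proof -
  note [measurable] = \<Phi>_meas G_meas
  define Z1 Z2 where "Z1 = (LINT x|M. exp (\<Phi>1 x))" and "Z2 = (LINT x|M. exp (\<Phi>2 x))"
  define l1 l2 where "l1 x = exp (\<Phi>1 x) / Z1" and "l2 x = exp (\<Phi>2 x) / Z2" for x
  define h where "h x = l1 x *\<^sub>R G1 x - l2 x *\<^sub>R G2 x" for x
  have Z: "0 < Z1" "0 < Z2" using pos by (auto simp: Z1_def Z2_def)
  have l0: "0 \<le> l1 x" "0 \<le> l2 x" for x using Z by (auto simp: l1_def l2_def)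
  have [measurable]: "l1 \<in> borel_measurable M" "l2 \<in> borel_measurable M"
    unfolding l1_def l2_def by measurable
  note sc = seq_space_scaleR[where a = a, OF a p, folded X_def] and df = seq_space_diff[where a = a, OF a p, folded X_def]
    and ad = seq_space_add[where a = a, OF a p, folded X_def] and n0 = seq_space_nrm_nonneg[where a = a, OF a p, folded X_def]
  have R1: "(1 + R x) powr b * (1 + R x) powr b' = (1 + R x) powr (b + b')" for b b' x
    by (simp add: powr_add)
  have il: "integrable M (\<lambda>x. (1 + R x) powr b * l1 x)" "integrable M (\<lambda>x. (1 + R x) powr b * l2 x)"
    if "b \<in> {0, q, q + 1, q + 2, 2}" for b
    using int1[OF that] int2[OF that] by (auto simp: l1_def l2_def)
  have ll: "(LINT x|M. (1 + R x) powr b * l1 x) \<le> S b" "(LINT x|M. (1 + R x) powr b * l2 x) \<le> S b"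
    if "b \<in> {q, q + 1, q + 2, 2}" for b
    using le1[OF that] le2[OF that] Z by (auto simp: l1_def l2_def Z1_def[symmetric] Z2_def[symmetric] divide_le_eq)
  have hE: "AE x in M. h x \<in> elts X \<and> nrm X (h x) \<le> c * ((1 + R x) powr q * l1 x + (1 + R x) powr q * l2 x)"
    using G
  proof eventually_elim
    case (elim x)
    have "nrm X (h x) \<le> nrm X (l1 x *\<^sub>R G1 x) + nrm X (l2 x *\<^sub>R G2 x)"
      unfolding h_def using elim by (intro df sc) auto
    also have "\<dots> = l1 x * nrm X (G1 x) + l2 x * nrm X (G2 x)" using elim l0 by (simp add: sc)
    also have "\<dots> \<le> l1 x * (c * (1 + R x) powr q) + l2 x * (c * (1 + R x) powr q)"
      using elim l0 by (intro add_mono mult_left_mono) auto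
    finally show ?case using elim unfolding h_def by (auto intro!: df sc simp: algebra_simps simp del: fun_diff_def)
  qed
  have h_meas: "(\<lambda>x. h x j) \<in> borel_measurable M" for j
    unfolding h_def by (simp add: scaleR_fun_def)
  have nh_meas [measurable]: "(\<lambda>x. nrm X (h x)) \<in> borel_measurable M"
    unfolding X_def by (rule seq_space_nrm_measurable[where a = a and h = h, OF a p h_meas])
  have bnd: "integrable M (\<lambda>x. c * ((1 + R x) powr q * l1 x + (1 + R x) powr q * l2 x))"
    using il[of q] by simp
  have int_h: "integrable M (\<lambda>x. nrm X (h x))"
  proof (rule Bochner_Integration.integrable_bound[OF bnd])
    show "AE x in M. norm (nrm X (h x)) \<le> norm (c * ((1 + R x) powr q * l1 x + (1 + R x) powr q * l2 x))"
      using hE by eventually_elim (use n0 in auto)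
  qed simp
  have AE_h: "AE x in M. h x \<in> elts (seq_space a p)" using hE by (simp add: X_def)
  have intG: "integrable M (\<lambda>x. exp (\<Phi> x) * G x j)"
    if [measurable]: "\<Phi> \<in> borel_measurable M" "\<And>j. (\<lambda>x. G x j) \<in> borel_measurable M"
      and GE: "AE x in M. G x \<in> elts X \<and> nrm X (G x) \<le> c * (1 + R x) powr q"
      and i: "integrable M (\<lambda>x. (1 + R x) powr q * exp (\<Phi> x))" for \<Phi> G j
  proof (rule Bochner_Integration.integrable_bound)
    show "integrable M (\<lambda>x. a j powr (- 1 / p) * c * ((1 + R x) powr q * exp (\<Phi> x)))" using i by simp
    show "AE x in M. norm (exp (\<Phi> x) * G x j) \<le> norm (a j powr (- 1 / p) * c * ((1 + R x) powr q * exp (\<Phi> x)))"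
      using GE
    proof eventually_elim
      case (elim x)
      have "\<bar>G x j\<bar> \<le> a j powr (- 1 / p) * nrm X (G x)"
        using elim seq_space_coordinate[where a = a, OF a p, of "G x" j] by (simp add: X_def)
      also have "\<dots> \<le> a j powr (- 1 / p) * (c * (1 + R x) powr q)" using elim by (intro mult_left_mono) auto
      finally have "exp (\<Phi> x) * \<bar>G x j\<bar> \<le> exp (\<Phi> x) * (a j powr (- 1 / p) * (c * (1 + R x) powr q))"
        by (intro mult_left_mono) auto
      then show ?case using nonneg by (simp add: abs_mult mult_ac)
    qed
  qed simp
  have v_eq: "?v = (\<lambda>j. LINT x|M. h x j)"
  proof
    fix j
    have "integrable M (\<lambda>x. exp (\<Phi>1 x) * G1 x j)" "integrable M (\<lambda>x. exp (\<Phi>2 x) * G2 x j)"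
      by (rule intG; use G int1 int2 in simp)+
    then show "?v j = (LINT x|M. h x j)"
      by (simp add: h_def l1_def l2_def scaleR_fun_def Z1_def[symmetric] Z2_def[symmetric])
  qed
  show "?v \<in> elts X" unfolding v_eq X_def
    by (rule seq_space_integral(2)[where a = a and h = h, OF a p h_meas AE_h int_h[unfolded X_def]])
  have v_le: "nrm X ?v \<le> (LINT x|M. nrm X (h x))" unfolding v_eq X_def
    by (rule seq_space_integral(3)[where a = a and h = h, OF a p h_meas AE_h int_h[unfolded X_def]])
  have S0: "0 \<le> S b" if "b \<in> {q, q + 1, q + 2, 2}" for b
  proof -
    have "0 \<le> (LINT x|M. (1 + R x) powr b * l1 x)" using l0 by (intro integral_nonneg_AE) auto
    then show ?thesis using ll(1)[OF that] by linarith
  qed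
  show "nrm X ?v \<le> c * \<epsilon> * (S (q + 1) + 3 * H * S (q + 2) + 6 * H * S q * S 2)"
  proof (cases "3 * (\<epsilon> * H * S 2) \<le> 1")
    \<comment> \<open>Above the threshold the triangle inequality gives \<open>2 * c * S q\<close>,
      and the factor \<open>3 * (\<epsilon> * H * S 2) > 1\<close> may be inserted; this produces
      the term with coefficient 6.\<close>
    case False
    have "(LINT x|M. nrm X (h x)) \<le> (LINT x|M. c * ((1 + R x) powr q * l1 x + (1 + R x) powr q * l2 x))"
      by (rule integral_mono_AE[OF int_h bnd]) (use hE in auto)
    also have "\<dots> = c * ((LINT x|M. (1 + R x) powr q * l1 x) + (LINT x|M. (1 + R x) powr q * l2 x))"
      using il[of q] by simp
    also have "\<dots> \<le> c * (S q + S q)" using ll[of q] nonneg by (intro mult_left_mono add_mono) auto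
    also have "\<dots> = 2 * (c * S q) * 1" by simp
    also have "\<dots> \<le> 2 * (c * S q) * (3 * (\<epsilon> * H * S 2))"
      using False S0[of q] nonneg by (intro mult_left_mono) auto
    also have "\<dots> = c * \<epsilon> * (6 * H * S q * S 2)" by simp
    also have "\<dots> \<le> c * \<epsilon> * (S (q + 1) + 3 * H * S (q + 2) + 6 * H * S q * S 2)"
      using S0 nonneg by (intro mult_left_mono) auto
    finally show ?thesis using v_le by simp
  next
    case True
    let ?L = "\<lambda>x. exp (\<Phi>1 x) + exp (\<Phi>2 x)"
    have expdiff: "AE x in M. \<bar>exp (\<Phi>1 x) - exp (\<Phi>2 x)\<bar> \<le> \<epsilon> * H * ((1 + R x) powr 2 * ?L x)"
      using \<Phi>_diff
    proof eventually_elim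
      case (elim x)
      have "\<bar>exp (\<Phi>1 x) - exp (\<Phi>2 x)\<bar> \<le> \<bar>\<Phi>1 x - \<Phi>2 x\<bar> * ?L x" by (rule abs_exp_diff_le)
      also have "\<dots> \<le> (\<epsilon> * H * (1 + R x) powr 2) * ?L x" using elim by (intro mult_right_mono) (auto simp: add_nonneg_nonneg)
      finally show ?case by (simp add: mult_ac)
    qed
    have iL: "integrable M (\<lambda>x. (1 + R x) powr b * ?L x)" if "b \<in> {0, q, q + 1, q + 2, 2}" for b
      using int1[OF that] int2[OF that] by (simp add: distrib_left)
    have lL: "(LINT x|M. (1 + R x) powr b * ?L x) \<le> S b * (Z1 + Z2)" if "b \<in> {q, q + 1, q + 2, 2}" for b
      using int1[of b] int2[of b] le1[OF that] le2[OF that] that by (auto simp: distrib_left Z1_def Z2_def)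
    have e0: "integrable M (\<lambda>x. exp (\<Phi>1 x))" "integrable M (\<lambda>x. exp (\<Phi>2 x))"
      using pos not_integrable_integral_eq by fastforce+
    have Zd: "\<bar>Z1 - Z2\<bar> \<le> \<epsilon> * H * (S 2 * (Z1 + Z2))"
    proof -
      have "\<bar>Z1 - Z2\<bar> = \<bar>LINT x|M. exp (\<Phi>1 x) - exp (\<Phi>2 x)\<bar>" using e0 by (simp add: Z1_def Z2_def)
      also have "\<dots> \<le> (LINT x|M. \<bar>exp (\<Phi>1 x) - exp (\<Phi>2 x)\<bar>)" by (rule integral_abs_bound)
      also have "\<dots> \<le> (LINT x|M. \<epsilon> * H * ((1 + R x) powr 2 * ?L x))"
        using e0 iL[of 2] expdiff by (intro integral_mono_AE) auto
      also have "\<dots> \<le> \<epsilon> * H * (S 2 * (Z1 + Z2))" using lL[of 2] nonneg by (simp add: mult_left_mono)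
      finally show ?thesis .
    qed
    \<comment> \<open>Below the threshold \<open>Z1\<close> and \<open>Z2\<close> differ by at most
      a third of their sum, hence \<open>Z2 \<le> 2 * Z1\<close>; this is the origin of the factor 3
      in the bound.\<close>
    have "3 * (\<epsilon> * H * (S 2 * (Z1 + Z2))) \<le> 1 * (Z1 + Z2)"
      using mult_right_mono[OF True, of "Z1 + Z2"] Z by (simp add: mult_ac)
    from order_trans[OF mult_left_mono[OF Zd] this] have "3 * \<bar>Z1 - Z2\<bar> \<le> Z1 + Z2" by simp
    then have "3 * (Z2 - Z1) \<le> Z1 + Z2" using abs_ge_minus_self[of "Z1 - Z2"] by simp
    then have "Z2 \<le> 2 * Z1" by simp
    then have Z3: "(Z1 + Z2) / Z1 \<le> 3" using Z by (simp add: divide_le_eq)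
    define T where "T x = c * \<epsilon> * ((1 + R x) powr (q + 1) * l1 x) + c * \<epsilon> * H / Z1 * ((1 + R x) powr (q + 2) * ?L x)
        + c * \<epsilon> * H * S 2 * ((Z1 + Z2) / Z1) * ((1 + R x) powr q * l2 x)" for x
    have T_int: "integrable M T" unfolding T_def
      by (intro Bochner_Integration.integrable_add integrable_mult_right il iL) auto
    have hT: "AE x in M. nrm X (h x) \<le> T x"
      using G G_diff expdiff
    proof eventually_elim
      case (elim x)
      have GG: "G1 x - G2 x \<in> elts X" using elim by (intro df) auto
      have "h x = l1 x *\<^sub>R (G1 x - G2 x) + (l1 x - l2 x) *\<^sub>R G2 x"
        by (simp only: h_def scaleR_right_diff_distrib scaleR_left_diff_distrib) simp
      then have "nrm X (h x) \<le> nrm X (l1 x *\<^sub>R (G1 x - G2 x)) + nrm X ((l1 x - l2 x) *\<^sub>R G2 x)"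
        using elim GG by (simp only:) (intro ad sc, auto)
      also have "\<dots> = l1 x * nrm X (G1 x - G2 x) + \<bar>l1 x - l2 x\<bar> * nrm X (G2 x)"
        using sc(2)[OF GG] sc(2)[of "G2 x"] elim l0 by simp
      also have "\<dots> \<le> l1 x * (\<epsilon> * c * (1 + R x) powr (q + 1)) + \<bar>l1 x - l2 x\<bar> * (c * (1 + R x) powr q)"
        using elim l0 by (intro add_mono mult_left_mono) auto
      also have "\<bar>l1 x - l2 x\<bar> \<le> \<epsilon> * H / Z1 * ((1 + R x) powr 2 * ?L x) + \<epsilon> * H * S 2 * ((Z1 + Z2) / Z1) * l2 x"
      proof -
        \<comment> \<open>Only \<open>Z1\<close> occurs as a denominator, \<open>Z2\<close> being
          hidden in \<open>l2\<close>, so that only the ratio \<open>(Z1 + Z2) / Z1\<close> has to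
          be controlled.\<close>
        have "l1 x - l2 x = (exp (\<Phi>1 x) - exp (\<Phi>2 x)) / Z1 + (Z2 - Z1) / Z1 * l2 x"
          using Z by (simp add: l1_def l2_def field_simps)
        then have "\<bar>l1 x - l2 x\<bar> \<le> \<bar>exp (\<Phi>1 x) - exp (\<Phi>2 x)\<bar> / Z1 + \<bar>Z1 - Z2\<bar> / Z1 * l2 x"
          using Z l0[of x] by (auto simp: abs_mult abs_minus_commute intro!: order_trans[OF abs_triangle_ineq])
        also have "\<dots> \<le> (\<epsilon> * H * ((1 + R x) powr 2 * ?L x)) / Z1 + (\<epsilon> * H * (S 2 * (Z1 + Z2))) / Z1 * l2 x"
          using Z l0 elim Zd by (intro add_mono divide_right_mono mult_right_mono) auto
        finally show ?thesis by (simp add: mult_ac)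
      qed
      finally have "nrm X (h x) \<le> l1 x * (\<epsilon> * c * (1 + R x) powr (q + 1))
          + (\<epsilon> * H / Z1 * ((1 + R x) powr 2 * ?L x) + \<epsilon> * H * S 2 * ((Z1 + Z2) / Z1) * l2 x) * (c * (1 + R x) powr q)"
        using nonneg by (simp add: mult_right_mono)
      also have "\<dots> = T x" unfolding T_def by (simp add: powr_add[of _ q 2] algebra_simps)
      finally show ?case .
    qed
    have "(LINT x|M. nrm X (h x)) \<le> (LINT x|M. T x)" by (rule integral_mono_AE[OF int_h T_int hT])
    also have "\<dots> = c * \<epsilon> * (LINT x|M. (1 + R x) powr (q + 1) * l1 x) + c * \<epsilon> * H / Z1 * (LINT x|M. (1 + R x) powr (q + 2) * ?L x)
        + c * \<epsilon> * H * S 2 * ((Z1 + Z2) / Z1) * (LINT x|M. (1 + R x) powr q * l2 x)"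
    proof -
      have "integrable M (\<lambda>x. c * \<epsilon> * ((1 + R x) powr (q + 1) * l1 x))"
        "integrable M (\<lambda>x. c * \<epsilon> * H / Z1 * ((1 + R x) powr (q + 2) * ?L x))"
        "integrable M (\<lambda>x. c * \<epsilon> * H * S 2 * ((Z1 + Z2) / Z1) * ((1 + R x) powr q * l2 x))"
        by (intro integrable_mult_right il iL; simp)+
      then show ?thesis unfolding T_def by (simp only: Bochner_Integration.integral_add Bochner_Integration.integrable_add integral_mult_right_zero)
    qed
    also have "\<dots> \<le> c * \<epsilon> * S (q + 1) + c * \<epsilon> * H / Z1 * (S (q + 2) * (Z1 + Z2)) + c * \<epsilon> * H * S 2 * ((Z1 + Z2) / Z1) * S q"
      using ll lL S0[of 2] nonneg Z by (intro add_mono mult_left_mono) auto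
    also have "\<dots> = c * \<epsilon> * S (q + 1) + c * \<epsilon> * H * (S (q + 2) + S q * S 2) * ((Z1 + Z2) / Z1)"
      using Z by (simp add: field_simps)
    also have "\<dots> \<le> c * \<epsilon> * S (q + 1) + c * \<epsilon> * H * (S (q + 2) + S q * S 2) * 3"
      using Z3 S0[of q] S0[of 2] S0[of "q + 2"] nonneg by (intro add_left_mono mult_left_mono) auto
    also have "\<dots> \<le> c * \<epsilon> * (S (q + 1) + 3 * H * S (q + 2) + 6 * H * S q * S 2)"
    proof -
      have "0 \<le> c * \<epsilon> * (3 * H * S q * S 2)" using S0[of q] S0[of 2] nonneg by simp
      then show ?thesis by (simp add: algebra_simps)
    qed
    finally show ?thesis using v_le by simp
  qed
qed

end

section \<open>Operators between Besov spaces and the random series\<close>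

lemmas besov_nrm_nonneg = seq_space_nrm_nonneg[where a = "besov_weight d \<sigma> p" and p = p for d \<sigma> p, OF besov_weight_pos, folded besov_eq]
lemmas besov_0 = seq_space_0[where a = "besov_weight d \<sigma> p" and p = p for d \<sigma> p, OF besov_weight_pos, folded besov_eq]
lemmas besov_scaleR = seq_space_scaleR[where a = "besov_weight d \<sigma> p" and p = p for d \<sigma> p, OF besov_weight_pos, folded besov_eq]
lemmas besov_add = seq_space_add[where a = "besov_weight d \<sigma> p" and p = p for d \<sigma> p, OF besov_weight_pos, folded besov_eq]
lemmas besov_diff = seq_space_diff[where a = "besov_weight d \<sigma> p" and p = p for d \<sigma> p, OF besov_weight_pos, folded besov_eq]
lemmas besov_nrm_eq_0 = seq_space_nrm_eq_0[where a = "besov_weight d \<sigma> p" and p = p for d \<sigma> p, OF besov_weight_pos, folded besov_eq]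
lemmas besov_coordinate = seq_space_coordinate[where a = "besov_weight d \<sigma> p" and p = p for d \<sigma> p, OF besov_weight_pos, folded besov_eq]
lemmas besov_truncation = truncation_in_seq_space[where a = "besov_weight d \<sigma> p" and p = p for d \<sigma> p, OF besov_weight_pos, folded besov_eq]
lemmas besov_truncation_le = nrm_truncation_le[where a = "besov_weight d \<sigma> p" and p = p for d \<sigma> p, OF besov_weight_pos, folded besov_eq]
lemmas besov_truncation_tendsto = nrm_truncation_tendsto[where a = "besov_weight d \<sigma> p" and p = p for d \<sigma> p, OF besov_weight_pos, folded besov_eq]

lemma besov_mono:
  assumes "1 \<le> p" "\<sigma> \<le> \<sigma>'" "u \<in> elts (besov d \<sigma>' p)"
  shows "u \<in> elts (besov d \<sigma> p)" "nrm (besov d \<sigma> p) u \<le> nrm (besov d \<sigma>' p) u"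
  using assms seq_space_mono[where a = "besov_weight d \<sigma>' p" and b = "besov_weight d \<sigma> p" and p = p and u = u,
      OF besov_weight_pos _ besov_weight_mono less_imp_le[OF besov_weight_pos]]
  unfolding besov_eq by auto

lemma bounded_op_0:
  assumes "1 \<le> p" "bounded_op (besov d \<sigma> p) Y T"
  shows "T 0 = 0"
proof -
  have "T (0 *\<^sub>R 0) = 0 *\<^sub>R T 0"
    using assms besov_0(1)[OF assms(1)] unfolding bounded_op_def by blast
  then show ?thesis by (simp only: scaleR_zero_left)
qed

text \<open>The supremum in \<open>op_norm\<close> is informative only over a bounded set of values,
  which boundedness of \<open>T\<close> provides. Rescaling to the unit ball fails only at norm 0,
  where the vector itself is 0.\<close>

lemma op_norm_bound:
  assumes p: "1 \<le> p" "1 \<le> p'" and T: "bounded_op (besov d \<sigma> p) (besov d \<sigma>' p') T"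
  shows "0 \<le> op_norm (besov d \<sigma> p) (besov d \<sigma>' p') T"
    "u \<in> elts (besov d \<sigma> p) \<Longrightarrow> nrm (besov d \<sigma>' p') (T u) \<le> op_norm (besov d \<sigma> p) (besov d \<sigma>' p') T * nrm (besov d \<sigma> p) u"
proof -
  let ?X = "besov d \<sigma> p" and ?Y = "besov d \<sigma>' p'"
  from T obtain b where b: "\<And>u. u \<in> elts ?X \<Longrightarrow> nrm ?Y (T u) \<le> b * nrm ?X u"
    and sc: "\<And>a u. u \<in> elts ?X \<Longrightarrow> T (a *\<^sub>R u) = a *\<^sub>R T u" and maps: "\<And>u. u \<in> elts ?X \<Longrightarrow> T u \<in> elts ?Y"
    unfolding bounded_op_def by blast
  have bdd: "bdd_above ((\<lambda>u. nrm ?Y (T u)) ` {u \<in> elts ?X. nrm ?X u \<le> 1})"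
  proof (rule bdd_aboveI2)
    fix u assume "u \<in> {u \<in> elts ?X. nrm ?X u \<le> 1}"
    then have u: "u \<in> elts ?X" "nrm ?X u \<le> 1" by auto
    have "nrm ?Y (T u) \<le> b * nrm ?X u" by (rule b[OF u(1)])
    also have "\<dots> \<le> \<bar>b\<bar> * 1" using u(2) besov_nrm_nonneg[OF p(1)] by (intro mult_mono) auto
    finally show "nrm ?Y (T u) \<le> \<bar>b\<bar> * 1" .
  qed
  have le: "nrm ?Y (T u) \<le> op_norm ?X ?Y T" if "u \<in> elts ?X" "nrm ?X u \<le> 1" for u
    unfolding op_norm_def using that by (intro cSUP_upper bdd) auto
  show "0 \<le> op_norm ?X ?Y T"
    using le[of 0] besov_nrm_nonneg[OF p(2), of d \<sigma>' "T 0"] besov_0[OF p(1)] by auto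
  show "nrm ?Y (T u) \<le> op_norm ?X ?Y T * nrm ?X u" if u: "u \<in> elts ?X"
  proof (cases "nrm ?X u = 0")
    case True
    then have "u = 0" using besov_nrm_eq_0[OF p(1) u] by simp
    then show ?thesis using bounded_op_0[OF p(1) T] besov_0[OF p(1)] besov_0[OF p(2)] by simp
  next
    case False
    let ?n = "nrm ?X u"
    have n: "?n > 0" using False besov_nrm_nonneg[OF p(1), of d \<sigma> u] by simp
    have v: "(1 / ?n) *\<^sub>R u \<in> elts ?X" "nrm ?X ((1 / ?n) *\<^sub>R u) \<le> 1"
      using besov_scaleR[OF p(1) u, of "1 / ?n"] n by auto
    have "nrm ?Y (T ((1 / ?n) *\<^sub>R u)) = 1 / ?n * nrm ?Y (T u)"
      unfolding sc[OF u] using besov_scaleR(2)[OF p(2) maps[OF u], of "1 / ?n"] n by simp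
    then have "1 / ?n * nrm ?Y (T u) \<le> op_norm ?X ?Y T" using le[OF v] by simp
    then show ?thesis using n by (simp add: divide_le_eq)
  qed
qed

text \<open>In a complete space a change on a null set preserves measurability. This matters because
  \<open>A\<close> and \<open>g\<close> are unconstrained outside the Besov space, which
  \<open>U\<close> may leave on a null set.\<close>

lemma (in complete_measure) borel_measurable_AE_eq:
  fixes f g :: "'a \<Rightarrow> 'b::topological_space"
  assumes f: "f \<in> borel_measurable M" and AE: "AE x in M. f x = g x"
  shows "g \<in> borel_measurable M"
proof (rule measurableI)
  fix S :: "'b set" assume S: "S \<in> sets borel"
  show "g -` S \<inter> space M \<in> sets M"
  proof (rule in_sets_AE)
    show "f -` S \<inter> space M \<in> sets M" using f S by (rule measurable_sets)
    show "AE x in M. x \<in> f -` S \<inter> space M \<longleftrightarrow> x \<in> g -` S \<inter> space M"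
      using AE by eventually_elim simp
  qed simp
qed simp

text \<open>An explicit bound \<open>b\<close> takes the place of the operator norm: such bounds
  multiply under composition and can be shared by whole families, which yields constants uniform in
  \<open>k\<close> and \<open>n\<close>.\<close>

definition op_le :: "series_space \<Rightarrow> series_space \<Rightarrow> real \<Rightarrow> ((nat \<Rightarrow> real) \<Rightarrow> nat \<Rightarrow> real) \<Rightarrow> bool" where
  "op_le X Y b T \<longleftrightarrow>
     (\<forall>u\<in>elts X. T u \<in> elts Y \<and> nrm Y (T u) \<le> b * nrm X u) \<and>
     (\<forall>u\<in>elts X. \<forall>v\<in>elts X. T (u + v) = T u + T v) \<and>
     (\<forall>a. \<forall>u\<in>elts X. T (a *\<^sub>R u) = a *\<^sub>R T u)"

lemma op_leD:
  assumes "op_le X Y b T"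
  shows "u \<in> elts X \<Longrightarrow> T u \<in> elts Y" "u \<in> elts X \<Longrightarrow> nrm Y (T u) \<le> b * nrm X u"
    "u \<in> elts X \<Longrightarrow> v \<in> elts X \<Longrightarrow> T (u + v) = T u + T v" "u \<in> elts X \<Longrightarrow> T (a *\<^sub>R u) = a *\<^sub>R T u"
  using assms unfolding op_le_def by blast+

lemma op_le_diff:
  assumes "1 \<le> p" "op_le (besov d \<sigma> p) Y b T" "u \<in> elts (besov d \<sigma> p)" "v \<in> elts (besov d \<sigma> p)"
  shows "T (u - v) = T u - T v"
proof -
  have "T (u + (-1) *\<^sub>R v) = T u + (-1) *\<^sub>R T v"
    using op_leD(3)[OF assms(2,3) besov_scaleR(1)[OF assms(1,4), of "-1"]] op_leD(4)[OF assms(2,4), of "-1"] by metis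
  then show ?thesis by simp
qed

lemma op_le_bounded_op:
  assumes "1 \<le> p" "1 \<le> p'" "bounded_op (besov d \<sigma> p) (besov d \<sigma>' p') T"
    and "op_norm (besov d \<sigma> p) (besov d \<sigma>' p') T \<le> b"
  shows "op_le (besov d \<sigma> p) (besov d \<sigma>' p') b T"
proof -
  have "nrm (besov d \<sigma>' p') (T u) \<le> b * nrm (besov d \<sigma> p) u" if "u \<in> elts (besov d \<sigma> p)" for u
    using op_norm_bound(2)[OF assms(1-3) that] mult_right_mono[OF assms(4) besov_nrm_nonneg[OF assms(1), of d \<sigma> u]] by simp
  then show ?thesis using assms(3) unfolding op_le_def bounded_op_def by blast
qed

lemma op_le_comp:
  assumes S: "op_le X Y b S" and T: "op_le Y Z c T" and c: "0 \<le> c"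
  shows "op_le X Z (c * b) (\<lambda>u. T (S u))"
proof -
  have "nrm Z (T (S u)) \<le> c * b * nrm X u" if u: "u \<in> elts X" for u
  proof -
    have "nrm Z (T (S u)) \<le> c * nrm Y (S u)" by (rule op_leD(2)[OF T op_leD(1)[OF S u]])
    also have "\<dots> \<le> c * (b * nrm X u)" using op_leD(2)[OF S u] c by (rule mult_left_mono)
    finally show ?thesis by simp
  qed
  then show ?thesis unfolding op_le_def by (simp add: op_leD[OF S] op_leD[OF T] del: plus_fun_apply)
qed

lemma op_le_weaken:
  assumes "op_le X (besov d \<sigma> p) b T" "b \<le> c" "\<And>u. 0 \<le> nrm X u"
  shows "op_le X (besov d \<sigma> p) c T"
proof -
  have "nrm (besov d \<sigma> p) (T u) \<le> c * nrm X u" if "u \<in> elts X" for u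
    using op_leD(2)[OF assms(1) that] mult_right_mono[OF assms(2,3), of u] by linarith
  then show ?thesis using assms(1) unfolding op_le_def by blast
qed

lemma op_le_truncation:
  assumes "1 \<le> p"
  shows "op_le (besov d \<sigma> p) (besov d \<sigma> p) 1 (truncation n)"
  unfolding op_le_def using besov_truncation[OF assms] besov_truncation_le[OF assms]
  by (auto simp: truncation_def fun_eq_iff scaleR_fun_def)

lemma pairing_linear:
  assumes z: "z \<in> elts (besov d r 1)" "z' \<in> elts (besov d r 1)" and m: "m \<in> elts (besov_inf d (- r))"
  shows "pairing (z + z') m = pairing z m + pairing z' m" "pairing (a *\<^sub>R z) m = a * pairing z m"
  unfolding pairing_def using summable_rabs_cancel[OF pairing_besov(1)[OF z(1) m]] summable_rabs_cancel[OF pairing_besov(1)[OF z(2) m]]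
  by (simp_all add: suminf_add[symmetric] suminf_mult[symmetric] algebra_simps scaleR_fun_def)

text \<open>The law of \<open>U\<close> enters only through exponential moments and vanishing means.  The measure is complete
  because \<open>U\<close> takes values in the Besov spaces only almost surely.\<close>

locale besov_random_series = prob_space M + complete_measure M for M :: "'a measure" +
  fixes U :: "'a \<Rightarrow> nat \<Rightarrow> real" and d :: nat and t t' p :: real
  assumes d: "0 < d" and p: "1 \<le> p" and t: "t \<le> t'"
    and U_meas: "\<And>j. (\<lambda>x. U x j) \<in> borel_measurable M"
    and U_AE: "AE x in M. U x \<in> elts (besov d t' p)"
    and U_exp: "integrable M (\<lambda>x. exp (1 / 2 * nrm (besov d t' p) (U x) powr p))"
    and U_int: "\<And>j. integrable M (\<lambda>x. U x j)"
    and U_mean: "\<And>j. (LINT x|M. U x j) = 0"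
begin

abbreviation (input) "X \<equiv> besov d t p"
abbreviation (input) "R x \<equiv> nrm (besov d t' p) (U x)"

lemma R_meas: "(\<lambda>x. R x) \<in> borel_measurable M"
  unfolding besov_eq by (rule seq_space_nrm_measurable[where h = U]) (use p U_meas in auto)

lemma U_X: "AE x in M. U x \<in> elts X \<and> nrm X (U x) \<le> R x"
  using U_AE by eventually_elim (use besov_mono[OF p t] in blast)

text \<open>Any \<open>F\<close> composed with a simple function is measurable, and sequential
  continuity along the simple approximations of \<open>U\<close> makes \<open>F (U x)\<close> an
  almost everywhere limit of such compositions.\<close>

lemma measurable_continuous_image:
  fixes F :: "(nat \<Rightarrow> real) \<Rightarrow> real"
  assumes F: "\<And>u v. u \<in> elts X \<Longrightarrow> (\<And>n. v n \<in> elts X) \<Longrightarrow> (\<lambda>n. nrm X (u - v n)) \<longlonglongrightarrow> 0 \<Longrightarrow>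
    (\<lambda>n. F (v n)) \<longlonglongrightarrow> F u"
  shows "(\<lambda>x. F (U x)) \<in> borel_measurable M"
proof -
  obtain \<sigma> where \<sigma>: "\<And>i. simple_function M (\<sigma> i)" "\<And>i x. \<sigma> i x \<in> elts X"
    "\<And>x. x \<in> space M \<Longrightarrow> U x \<in> elts X \<Longrightarrow> (\<lambda>i. nrm X (U x - \<sigma> i x)) \<longlonglongrightarrow> 0"
    using seq_space_simple_approximation[where h = U and a = "besov_weight d t p", OF besov_weight_pos p U_meas]
    unfolding besov_eq by metis
  have "simple_function M (\<lambda>x. F (\<sigma> i x))" for i
    using simple_function_compose1[OF \<sigma>(1)[of i], of F] .
  then have "(\<lambda>x. F (\<sigma> i x)) \<in> borel_measurable M" for i by (rule borel_measurable_simple_function)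
  then have "(\<lambda>x. lim (\<lambda>i. F (\<sigma> i x))) \<in> borel_measurable M" by (rule borel_measurable_lim_metric)
  moreover have "AE x in M. lim (\<lambda>i. F (\<sigma> i x)) = F (U x)"
    using U_X AE_space by eventually_elim (intro limI F \<sigma>, auto)
  ultimately show ?thesis by (rule borel_measurable_AE_eq)
qed

lemma op_measurable:
  assumes q: "1 \<le> q" and B: "op_le X (besov d \<sigma> q) b B"
  shows "(\<lambda>x. B (U x) j) \<in> borel_measurable M"
proof (rule measurable_continuous_image)
  fix u v assume u: "u \<in> elts X" and v: "\<And>n :: nat. v n \<in> elts X" and lim: "(\<lambda>n. nrm X (u - v n)) \<longlonglongrightarrow> 0"
  let ?c = "besov_weight d \<sigma> q j powr (- 1 / q)"
  have "norm (B (v n) j - B u j) \<le> ?c * b * nrm X (u - v n)" for n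
  proof -
    note uv = besov_diff(1)[OF p u v, of n]
    have "norm (B (v n) j - B u j) = \<bar>B (u - v n) j\<bar>"
      using op_le_diff[OF p B u v, of n] by (simp add: abs_minus_commute)
    also have "\<dots> \<le> ?c * nrm (besov d \<sigma> q) (B (u - v n))"
      by (rule besov_coordinate[OF q op_leD(1)[OF B uv]])
    also have "\<dots> \<le> ?c * (b * nrm X (u - v n))"
      by (intro mult_left_mono op_leD(2)[OF B uv]) auto
    finally show ?thesis by simp
  qed
  moreover have "(\<lambda>n. ?c * b * nrm X (u - v n)) \<longlonglongrightarrow> 0"
    using tendsto_mult_left[OF lim, of "?c * b"] by simp
  ultimately have "(\<lambda>n. B (v n) j - B u j) \<longlonglongrightarrow> 0"
    by (rule_tac Lim_null_comparison[OF always_eventually[OF allI]])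
  then show "(\<lambda>n. B (v n) j) \<longlonglongrightarrow> B u j" by (rule LIM_zero_cancel)
qed

lemma R_nonneg: "0 \<le> R x"
  by (rule besov_nrm_nonneg[OF p])

lemma R_moments:
  assumes "0 \<le> a"
  shows "integrable M (\<lambda>x. (1 + R x) powr a)"
  by (rule powr_moment_integrable[OF R_meas R_nonneg p U_exp assms])

lemma R_integrable: "integrable M (\<lambda>x. R x)"
proof (rule Bochner_Integration.integrable_bound[OF R_moments[of 1]])
  show "AE x in M. norm (R x) \<le> norm ((1 + R x) powr 1)" using R_nonneg by (intro AE_I2) simp
qed (use R_meas in auto)

text \<open>Reduces the pairing to a finite linear combination of coordinates, whose means are
  known.\<close>

lemma pairing_truncation:
  assumes B: "op_le X (besov d r 1) b B" and m: "m \<in> elts (besov_inf d (- r))"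
  shows "pairing (B (truncation n u)) m = (\<Sum>i<n. u i * pairing (B (\<lambda>j. if j = i then 1 else 0)) m)"
proof (induction n)
  case 0
  have "truncation 0 u = 0 *\<^sub>R 0" by (auto simp: truncation_def)
  then have "B (truncation 0 u) = 0 *\<^sub>R B 0" using op_leD(4)[OF B besov_0(1)[OF p], of 0] by metis
  then have "B (truncation 0 u) = 0" by simp
  then show ?case by (simp add: pairing_def)
next
  case (Suc n)
  let ?e = "(\<lambda>j. if j = n then 1 else 0) :: nat \<Rightarrow> real"
  have e: "?e \<in> elts X" using besov_truncation[OF p, of "Suc n" ?e d t] by (rule back_subst[where P = "\<lambda>u. u \<in> elts X"]) (auto simp: truncation_def)
  have "truncation (Suc n) u = truncation n u + u n *\<^sub>R ?e"
    by (auto simp: truncation_def fun_eq_iff scaleR_fun_def not_less_eq_eq dest: le_antisym)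
  then have "B (truncation (Suc n) u) = B (truncation n u) + u n *\<^sub>R B ?e"
    using op_leD(3)[OF B besov_truncation[OF p] besov_scaleR(1)[OF p e]] op_leD(4)[OF B e] by metis
  then have "pairing (B (truncation (Suc n) u)) m = pairing (B (truncation n u)) m + u n * pairing (B ?e) m"
    using pairing_linear(1)[OF op_leD(1)[OF B besov_truncation[OF p]] besov_scaleR(1)[OF _ op_leD(1)[OF B e]] m]
      pairing_linear(2)[OF op_leD(1)[OF B e] op_leD(1)[OF B e] m] by simp
  then show ?case using Suc by simp
qed

text \<open>The pairings with truncated \<open>U x\<close> have mean zero by linearity; they
  converge to the full pairing and are dominated by a multiple of \<open>R x\<close>.\<close>

lemma pairing_mean:
  assumes B: "op_le X (besov d r 1) b B" and b: "0 \<le> b" and m: "m \<in> elts (besov_inf d (- r))"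
  shows "integrable M (\<lambda>x. pairing (B (U x)) m)" "(LINT x|M. pairing (B (U x)) m) = 0"
proof -
  let ?k = "nrm (besov_inf d (- r)) m"
  define S where "S n x = (\<Sum>i<n. U x i * pairing (B (\<lambda>j. if j = i then 1 else 0)) m)" for n x
  have le: "\<bar>pairing (B v) m\<bar> \<le> b * ?k * nrm X v" if "v \<in> elts X" for v
  proof -
    have "\<bar>pairing (B v) m\<bar> \<le> nrm (besov d r 1) (B v) * ?k" by (rule pairing_besov(2)[OF op_leD(1)[OF B that] m])
    also have "\<dots> \<le> (b * nrm X v) * ?k"
      using op_leD(2)[OF B that] besov_inf_nrm_nonneg[OF m] by (rule mult_right_mono)
    finally show ?thesis by (simp add: mult_ac)
  qed
  have k0: "0 \<le> b * ?k" using b besov_inf_nrm_nonneg[OF m] by simp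
  have lim: "AE x in M. (\<lambda>n. S n x) \<longlonglongrightarrow> pairing (B (U x)) m"
    using U_X
  proof eventually_elim
    case (elim x)
    note T = besov_truncation[OF p, of _ "U x" d t]
    have "norm (S n x - pairing (B (U x)) m) \<le> b * ?k * nrm X (truncation n (U x) - U x)" for n
    proof -
      have uX: "U x \<in> elts X" using elim by simp
      have TU: "truncation n (U x) - U x \<in> elts X" by (rule besov_diff(1)[OF p T uX])
      have "B (truncation n (U x)) = B (truncation n (U x) - U x) + B (U x)"
        using op_leD(3)[OF B TU uX] by simp
      then have "pairing (B (truncation n (U x))) m = pairing (B (truncation n (U x) - U x)) m + pairing (B (U x)) m"
        using pairing_linear(1)[OF op_leD(1)[OF B TU] op_leD(1)[OF B uX] m] by simp
      then have "S n x - pairing (B (U x)) m = pairing (B (truncation n (U x) - U x)) m"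
        unfolding pairing_truncation[OF B m] by (simp add: S_def)
      then show ?thesis using le[OF TU] by simp
    qed
    moreover have "(\<lambda>n. b * ?k * nrm X (truncation n (U x) - U x)) \<longlonglongrightarrow> 0"
      using tendsto_mult_left[OF besov_truncation_tendsto[OF p], of "U x" d t "b * ?k"] elim by simp
    ultimately have "(\<lambda>n. S n x - pairing (B (U x)) m) \<longlonglongrightarrow> 0"
      by (rule_tac Lim_null_comparison[OF always_eventually[OF allI]])
    then show ?case by (rule LIM_zero_cancel)
  qed
  have bound: "AE x in M. norm (S n x) \<le> b * ?k * R x" for n
    using U_X
  proof eventually_elim
    case (elim x)
    have "norm (S n x) \<le> b * ?k * nrm X (truncation n (U x))"
      using le[OF besov_truncation[OF p, of n "U x"]] unfolding pairing_truncation[OF B m] by (simp add: S_def)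
    also have "\<dots> \<le> b * ?k * R x"
      using besov_truncation_le[OF p, of "U x" d t n] elim k0 by (intro mult_left_mono) auto
    finally show ?case .
  qed
  have S_meas: "S n \<in> borel_measurable M" for n
    unfolding S_def using U_meas by measurable
  have pm: "(\<lambda>x. pairing (B (U x)) m) \<in> borel_measurable M"
    unfolding pairing_def using op_measurable[OF _ B] by measurable
  have dom: "integrable M (\<lambda>x. b * ?k * R x)" using R_integrable by simp
  show "integrable M (\<lambda>x. pairing (B (U x)) m)"
    by (rule integrable_dominated_convergence[OF pm S_meas dom lim bound])
  have "(\<lambda>n. LINT x|M. S n x) \<longlonglongrightarrow> (LINT x|M. pairing (B (U x)) m)"
    by (rule integral_dominated_convergence[OF pm S_meas dom lim bound])
  moreover have "(LINT x|M. S n x) = 0" for n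
    unfolding S_def using U_int U_mean by simp
  ultimately show "(LINT x|M. pairing (B (U x)) m) = 0" by (simp add: LIMSEQ_const_iff)
qed

lemma log_likelihood_measurable:
  assumes "op_le X (besov d r 1) b B"
  shows "(\<lambda>x. log_likelihood (B (U x)) m) \<in> borel_measurable M"
  unfolding log_likelihood_def pairing_def using op_measurable[OF _ assms] by measurable

text \<open>Jensen's inequality; the linear part of the log-likelihood has mean zero.\<close>

lemma evidence_lower_bound:
  assumes B: "op_le X (besov d r 1) b B" and b: "0 \<le> b" and r: "real d / 2 \<le> r" and m: "m \<in> elts (besov_inf d (- r))"
    and int: "integrable M (\<lambda>x. exp (log_likelihood (B (U x)) m))"
  shows "exp (- (b\<^sup>2 * (LINT x|M. (1 + R x) powr 2))) \<le> (LINT x|M. exp (log_likelihood (B (U x)) m))"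
proof -
  define Q where "Q x = (\<Sum>i. (B (U x) i)\<^sup>2)" for x
  have Q: "AE x in M. 0 \<le> Q x \<and> Q x \<le> b\<^sup>2 * (1 + R x) powr 2"
    using U_X
  proof eventually_elim
    case (elim x)
    note z = op_leD(1)[OF B, of "U x"] and s = besov_1_summable[OF d r]
    have "nrm (besov d r 1) (B (U x)) \<le> b * nrm X (U x)" using op_leD(2)[OF B] elim by simp
    also have "\<dots> \<le> b * (1 + R x)" using elim b by (intro mult_left_mono) auto
    finally have "(nrm (besov d r 1) (B (U x)))\<^sup>2 \<le> (b * (1 + R x))\<^sup>2"
      using besov_nrm_nonneg[of 1] by (intro power_mono) auto
    moreover have "(b * (1 + R x))\<^sup>2 = b\<^sup>2 * (1 + R x) powr 2" using R_nonneg[of x] by (simp add: power_mult_distrib)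
    ultimately show ?case using s(4)[OF z] s(3)[OF z] elim by (auto simp: Q_def intro!: suminf_nonneg)
  qed
  have Q_meas: "Q \<in> borel_measurable M" unfolding Q_def using op_measurable[OF _ B] by measurable
  have Q_int: "integrable M Q"
  proof (rule Bochner_Integration.integrable_bound)
    show "integrable M (\<lambda>x. b\<^sup>2 * (1 + R x) powr 2)" using R_moments[of 2] by simp
    show "AE x in M. norm (Q x) \<le> norm (b\<^sup>2 * (1 + R x) powr 2)" using Q by eventually_elim simp
  qed (rule Q_meas)
  have Qle: "(LINT x|M. Q x) \<le> (LINT x|M. b\<^sup>2 * (1 + R x) powr 2)"
    by (rule integral_mono_AE[OF Q_int]) (use R_moments[of 2] Q in auto)
  have Q0: "0 \<le> (LINT x|M. Q x)" by (rule integral_nonneg_AE) (use Q in auto)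
  have \<Phi>: "(\<lambda>x. log_likelihood (B (U x)) m) = (\<lambda>x. - (1 / 2) * Q x + pairing (B (U x)) m)"
    by (simp add: log_likelihood_def Q_def)
  show ?thesis
  proof (rule exp_integral_ge[OF _ int])
    show "integrable M (\<lambda>x. log_likelihood (B (U x)) m)"
      unfolding \<Phi> using Q_int pairing_mean(1)[OF B b m] by simp
    have "(LINT x|M. log_likelihood (B (U x)) m) = - (1 / 2) * (LINT x|M. Q x)"
      unfolding \<Phi> using Q_int pairing_mean[OF B b m] by simp
    then show "- (b\<^sup>2 * (LINT x|M. (1 + R x) powr 2)) \<le> (LINT x|M. log_likelihood (B (U x)) m)"
      using Qle Q0 by simp
  qed
qed

end

section \<open>Stability of posterior means\<close>

definition growth_lipschitz :: "series_space \<Rightarrow> real \<Rightarrow> real \<Rightarrow> ((nat \<Rightarrow> real) \<Rightarrow> nat \<Rightarrow> real) \<Rightarrow> bool" where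
  "growth_lipschitz X c q g \<longleftrightarrow>
     (\<forall>u\<in>elts X. g u \<in> elts X \<and> nrm X (g u) \<le> c * (1 + nrm X u) powr q) \<and>
     (\<forall>u\<in>elts X. \<forall>v\<in>elts X. nrm X (g u - g v) \<le> c * nrm X (u - v) * (1 + max (nrm X u) (nrm X v)) powr q)"

lemma growth_lipschitzD:
  assumes "growth_lipschitz X c q g"
  shows "u \<in> elts X \<Longrightarrow> g u \<in> elts X" "u \<in> elts X \<Longrightarrow> nrm X (g u) \<le> c * (1 + nrm X u) powr q"
    "u \<in> elts X \<Longrightarrow> v \<in> elts X \<Longrightarrow> nrm X (g u - g v) \<le> c * nrm X (u - v) * (1 + max (nrm X u) (nrm X v)) powr q"
  using assms unfolding growth_lipschitz_def by blast+

lemma growth_lipschitz_nonneg: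
  assumes "1 \<le> p" "growth_lipschitz (besov d t p) c q g"
  shows "0 \<le> c"
  using growth_lipschitzD(2)[OF assms(2) besov_0(1)[OF assms(1)]] besov_nrm_nonneg[OF assms(1), of d t "g 0"]
    besov_0(2)[OF assms(1), of d t] by simp

text \<open>Truncation is a linear contraction of the space, so \<open>c\<close> and
  \<open>q\<close> survive unchanged, and one stability statement serves \<open>g\<close> with and
  without truncation.\<close>

lemma growth_lipschitz_truncation:
  assumes p: "1 \<le> p" and q: "0 \<le> q" and g: "growth_lipschitz (besov d t p) c q g"
  shows "growth_lipschitz (besov d t p) c q (\<lambda>u. g (truncation n u))"
proof -
  let ?X = "besov d t p"
  note c = growth_lipschitz_nonneg[OF p g] and T = besov_truncation[OF p, of n _ d t]
    and Tle = besov_truncation_le[OF p, of _ d t n] and n0 = besov_nrm_nonneg[OF p, of d t]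
  have 1: "nrm ?X (g (truncation n u)) \<le> c * (1 + nrm ?X u) powr q" if u: "u \<in> elts ?X" for u
  proof -
    have "nrm ?X (g (truncation n u)) \<le> c * (1 + nrm ?X (truncation n u)) powr q"
      by (rule growth_lipschitzD(2)[OF g T])
    also have "\<dots> \<le> c * (1 + nrm ?X u) powr q"
      using Tle[OF u] c q n0[of "truncation n u"] by (intro mult_left_mono powr_mono2) auto
    finally show ?thesis .
  qed
  have 2: "nrm ?X (g (truncation n u) - g (truncation n v)) \<le> c * nrm ?X (u - v) * (1 + max (nrm ?X u) (nrm ?X v)) powr q"
    if u: "u \<in> elts ?X" and v: "v \<in> elts ?X" for u v
  proof -
    have eq: "truncation n u - truncation n v = truncation n (u - v)" by (auto simp: truncation_def)
    have "nrm ?X (g (truncation n u) - g (truncation n v))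
        \<le> c * nrm ?X (truncation n u - truncation n v) * (1 + max (nrm ?X (truncation n u)) (nrm ?X (truncation n v))) powr q"
      by (rule growth_lipschitzD(3)[OF g T T])
    also have "\<dots> \<le> c * nrm ?X (u - v) * (1 + max (nrm ?X u) (nrm ?X v)) powr q"
      unfolding eq using Tle[OF u] Tle[OF v] Tle[OF besov_diff(1)[OF p u v]] c q n0
      by (intro mult_mono mult_left_mono powr_mono2) (auto intro: add_nonneg_nonneg max.coboundedI1 simp: le_max_iff_disj)
    finally show ?thesis .
  qed
  show ?thesis unfolding growth_lipschitz_def using 1 2 growth_lipschitzD(1)[OF g T] by blast
qed

lemma likelihood_eq:
  fixes \<psi> :: "nat \<Rightarrow> real ^ 'd \<Rightarrow> real"
  assumes \<psi>: "orthonormal_basis torus {1..} \<psi>" and d: "0 < d" "real d / 2 \<le> r" and z: "z \<in> elts (besov d r 1)"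
  shows "likelihood \<psi> m z = exp (log_likelihood z m)"
  using suminf_nonneg[OF besov_1_summable(3)[OF d z]]
  by (simp add: likelihood_def log_likelihood_def L2_norm_eq[OF \<psi> besov_1_summable(1)[OF d z]])

context besov_random_series
begin

text \<open>The Lipschitz bound grows with the norms, but these stay bounded along a convergent
  sequence, which gives continuity of each coordinate.\<close>

lemma image_measurable:
  assumes G: "growth_lipschitz X c q G" and q: "0 \<le> q"
  shows "(\<lambda>x. G (U x) j) \<in> borel_measurable M"
proof (rule measurable_continuous_image)
  fix u v assume u: "u \<in> elts X" and v: "\<And>n :: nat. v n \<in> elts X" and lim: "(\<lambda>n. nrm X (u - v n)) \<longlonglongrightarrow> 0"
  let ?c = "besov_weight d t p j powr (- 1 / p)" and ?\<delta> = "\<lambda>n. nrm X (u - v n)"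
  note c = growth_lipschitz_nonneg[OF p G]
  have "norm (G (v n) j - G u j) \<le> ?c * (c * ?\<delta> n * (1 + (nrm X u + ?\<delta> n)) powr q)" for n
  proof -
    have vn: "nrm X (v n) \<le> nrm X u + ?\<delta> n"
      using besov_diff(2)[OF p u besov_diff(1)[OF p u v], of n] by simp
    have GG: "G u - G (v n) \<in> elts X" by (intro besov_diff p growth_lipschitzD(1)[OF G] u v)
    have "norm (G (v n) j - G u j) = \<bar>(G u - G (v n)) j\<bar>" by (simp add: abs_minus_commute)
    also have "\<dots> \<le> ?c * nrm X (G u - G (v n))" by (rule besov_coordinate[OF p GG])
    also have "\<dots> \<le> ?c * (c * ?\<delta> n * (1 + max (nrm X u) (nrm X (v n))) powr q)"
      by (intro mult_left_mono growth_lipschitzD(3)[OF G] u v) auto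
    also have "\<dots> \<le> ?c * (c * ?\<delta> n * (1 + (nrm X u + ?\<delta> n)) powr q)"
      using vn c q besov_nrm_nonneg[OF p] by (intro mult_left_mono powr_mono2) (auto simp: add_nonneg_nonneg le_max_iff_disj)
    finally show ?thesis .
  qed
  moreover have "(\<lambda>n. ?c * (c * ?\<delta> n * (1 + (nrm X u + ?\<delta> n)) powr q)) \<longlonglongrightarrow> ?c * (c * 0 * (1 + (nrm X u + 0)) powr q)"
    using besov_nrm_nonneg[OF p, of d t u] by (intro tendsto_intros lim) auto
  then have "(\<lambda>n. ?c * (c * ?\<delta> n * (1 + (nrm X u + ?\<delta> n)) powr q)) \<longlonglongrightarrow> 0" by simp
  ultimately have "(\<lambda>n. G (v n) j - G u j) \<longlonglongrightarrow> 0"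
    by (rule_tac Lim_null_comparison[OF always_eventually[OF allI]])
  then show "(\<lambda>n. G (v n) j) \<longlonglongrightarrow> G u j" by (rule LIM_zero_cancel)
qed

text \<open>The reconstructor with \<open>log_likelihood\<close> in the exponent and coordinatewise
  real integrals instead of the Bochner integral; \<open>bochner_posterior_mean\<close> identifies
  the two.\<close>

definition posterior_mean :: "((nat \<Rightarrow> real) \<Rightarrow> nat \<Rightarrow> real) \<Rightarrow> ((nat \<Rightarrow> real) \<Rightarrow> nat \<Rightarrow> real) \<Rightarrow> (nat \<Rightarrow> real) \<Rightarrow> nat \<Rightarrow> real" where
  "posterior_mean G B m = (1 / (LINT x|M. exp (log_likelihood (B (U x)) m))) *\<^sub>R
     (\<lambda>j. LINT x|M. (exp (log_likelihood (B (U x)) m) *\<^sub>R G (U x)) j)"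

section \<open>Estimates uniform over all operators with bound \<open>A\<close>, which is a real
  number in this part\<close>

context
  fixes r r' w A \<beta> :: real
  assumes r: "real d / 2 < r" and w: "r \<le> w" "w \<le> r'" "p = 1 \<longrightarrow> r < w" and A: "0 \<le> A"
    and \<beta>: "\<beta> = 2 * w / (w - r + 2 * r * (1 - 1 / p))"
begin

private abbreviation (input) "Y \<equiv> besov d r' 1"
private abbreviation (input) "W \<equiv> besov_inf d (- r)"

lemma r_pos: "0 < r" using r d by (rule_tac le_less_trans[OF _ r]) simp

lemma \<beta>_nonneg: "0 \<le> \<beta>"
  unfolding \<beta> using r_pos w p by (intro divide_nonneg_nonneg add_nonneg_nonneg mult_nonneg_nonneg) auto

lemma op_le_lower: "op_le X Y b B \<Longrightarrow> op_le X (besov d r 1) b B"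
  unfolding op_le_def using besov_mono[of 1 r r'] w by (meson order_trans order_refl)

text \<open>\<open>posterior_moment\<close> is used with
  \<open>\<kappa> = C * (1 + K) powr \<beta>\<close>, and the lower bound on the evidence absorbs
  its additive term. The function \<open>\<sigma>\<close> is the same for all operators bounded by
  \<open>A\<close>, all data and all \<open>K\<close>.\<close>

lemma posterior_moment_bound:
  obtains \<sigma> where
    "\<And>a. 0 \<le> a \<Longrightarrow> 0 \<le> \<sigma> a"
    "\<And>B m K. op_le X Y A B \<Longrightarrow> m \<in> elts W \<Longrightarrow> nrm W m \<le> K \<Longrightarrow>
      0 < (LINT x|M. exp (log_likelihood (B (U x)) m))"
    "\<And>B m K a. op_le X Y A B \<Longrightarrow> m \<in> elts W \<Longrightarrow> nrm W m \<le> K \<Longrightarrow> 0 \<le> a \<Longrightarrow>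
      integrable M (\<lambda>x. (1 + R x) powr a * exp (log_likelihood (B (U x)) m))"
    "\<And>B m K a. op_le X Y A B \<Longrightarrow> m \<in> elts W \<Longrightarrow> nrm W m \<le> K \<Longrightarrow> 0 \<le> a \<Longrightarrow>
      (LINT x|M. (1 + R x) powr a * exp (log_likelihood (B (U x)) m))
        \<le> \<sigma> a * (1 + K) powr (\<beta> * a / p) * (LINT x|M. exp (log_likelihood (B (U x)) m))"
proof -
  obtain C where C: "1 \<le> C" and upper:
    "\<And>z m R K. z \<in> elts Y \<Longrightarrow> nrm Y z \<le> A * R \<Longrightarrow> 0 \<le> R \<Longrightarrow>
      m \<in> elts W \<Longrightarrow> nrm W m \<le> K \<Longrightarrow>
      log_likelihood z m \<le> C * (1 + K) powr \<beta> + R powr p / 8"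
    using log_likelihood_upper[OF d r w p A, folded \<beta>] by metis
  define E c0 where "E = (LINT x|M. exp (1 / 2 * R x powr p))"
    and "c0 = exp (- (A\<^sup>2 * (LINT x|M. (1 + R x) powr 2)))"
  define \<sigma> where "\<sigma> a = 9 powr a * C powr (a / p) + (4 * (a + 1)) powr a * exp (1 / 2) * E / c0" for a
  have E0: "0 \<le> E" unfolding E_def by (rule integral_nonneg_AE) auto
  have c0: "0 < c0" by (simp add: c0_def)
  note facts = posterior_moment[OF R_meas R_nonneg p U_exp]
  have \<kappa>: "1 \<le> C * (1 + K) powr \<beta>" "1 \<le> 1 + K" if "m \<in> elts W" "nrm W m \<le> K" for m K
  proof -
    have K: "0 \<le> K" using besov_inf_nrm_nonneg[OF that(1)] that(2) by simp
    then have "1 \<le> (1 + K) powr \<beta>" using \<beta>_nonneg by (intro ge_one_powr_ge_zero) auto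
    then have "1 * 1 \<le> C * (1 + K) powr \<beta>" using C by (intro mult_mono) auto
    then show "1 \<le> C * (1 + K) powr \<beta>" "1 \<le> 1 + K" using K by auto
  qed
  have \<Phi>: "(\<lambda>x. log_likelihood (B (U x)) m) \<in> borel_measurable M"
    "AE x in M. log_likelihood (B (U x)) m \<le> C * (1 + K) powr \<beta> + R x powr p / 8"
    if B: "op_le X Y A B" and m: "m \<in> elts W" "nrm W m \<le> K" for B m K
  proof -
    show "(\<lambda>x. log_likelihood (B (U x)) m) \<in> borel_measurable M"
      by (rule log_likelihood_measurable[OF B])
    show "AE x in M. log_likelihood (B (U x)) m \<le> C * (1 + K) powr \<beta> + R x powr p / 8"
      using U_X
    proof eventually_elim
      case (elim x)
      have "nrm Y (B (U x)) \<le> A * nrm X (U x)" using op_leD(2)[OF B] elim by simp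
      also have "\<dots> \<le> A * R x" using elim A by (intro mult_left_mono) auto
      finally show ?case using op_leD(1)[OF B] elim by (intro upper R_nonneg m) auto
    qed
  qed
  have Z: "c0 \<le> (LINT x|M. exp (log_likelihood (B (U x)) m))"
    if B: "op_le X Y A B" and m: "m \<in> elts W" "nrm W m \<le> K" for B m K
    unfolding c0_def
    by (rule evidence_lower_bound[OF op_le_lower[OF B] A _ m(1) facts(3)[OF \<Phi>[OF B m] \<kappa>(1)[OF m] order_refl]]) (use r in simp)
  show thesis
  proof (rule that[of \<sigma>])
    show "0 \<le> \<sigma> a" if "0 \<le> a" for a using C E0 c0 that by (auto simp: \<sigma>_def)
    fix B m K
    assume B: "op_le X Y A B" and m: "m \<in> elts W" "nrm W m \<le> K"
    show "0 < (LINT x|M. exp (log_likelihood (B (U x)) m))" using Z[OF B m] c0 by simp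
    fix a :: real assume a: "0 \<le> a"
    show "integrable M (\<lambda>x. (1 + R x) powr a * exp (log_likelihood (B (U x)) m))"
      by (rule facts(1)[OF \<Phi>[OF B m] \<kappa>(1)[OF m] a])
    let ?Z = "LINT x|M. exp (log_likelihood (B (U x)) m)" and ?D = "(4 * (a + 1)) powr a * exp (1 / 2)"
      and ?k = "(1 + K) powr (\<beta> * a / p)"
    have k1: "1 \<le> ?k" using \<kappa>(2)[OF m] \<beta>_nonneg a p by (intro ge_one_powr_ge_zero) auto
    have "(LINT x|M. (1 + R x) powr a * exp (log_likelihood (B (U x)) m))
        \<le> 9 powr a * (C * (1 + K) powr \<beta>) powr (a / p) * ?Z + ?D * E"
      unfolding E_def by (rule facts(2)[OF \<Phi>[OF B m] \<kappa>(1)[OF m] a])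
    also have "(C * (1 + K) powr \<beta>) powr (a / p) = C powr (a / p) * ?k"
      using C by (simp add: powr_mult powr_powr)
    \<comment> \<open>The additive term becomes a multiple of the evidence because \<open>?k\<close>
      and \<open>?Z / c0\<close> are both at least 1.\<close>
    also have "?D * E \<le> ?D * E / c0 * ?k * ?Z"
    proof -
      have "1 * 1 \<le> ?k * (?Z / c0)" using k1 Z[OF B m] c0 by (intro mult_mono) auto
      then have "?D * E * 1 \<le> ?D * E * (?k * (?Z / c0))" using E0 by (intro mult_left_mono) auto
      then show ?thesis by simp
    qed
    finally show "(LINT x|M. (1 + R x) powr a * exp (log_likelihood (B (U x)) m)) \<le> \<sigma> a * ?k * ?Z"
      by (simp add: \<sigma>_def algebra_simps)
  qed
qed

text \<open>\<open>likelihood\<close> and the exponential of \<open>log_likelihood\<close> are known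
  to agree only where \<open>U x\<close> lies in the Besov space, hence almost surely. Completeness
  passes measurability from one to the other, and the moment of order \<open>q\<close> gives
  integrability of the norm.\<close>

lemma bochner_posterior_mean:
  fixes \<psi> :: "nat \<Rightarrow> real ^ 'd \<Rightarrow> real"
  assumes \<psi>: "orthonormal_basis torus {1..} \<psi>" and q: "0 \<le> q"
    and G: "growth_lipschitz X c q G" and B: "op_le X Y A B" and m: "m \<in> elts W"
  shows "integrable M (\<lambda>x. likelihood \<psi> m (B (U x)))" "0 < (LINT x|M. likelihood \<psi> m (B (U x)))"
    "\<exists>v. has_bochner_integral_in X M (\<lambda>x. likelihood \<psi> m (B (U x)) *\<^sub>R G (U x)) v"
    "(1 / (LINT x|M. likelihood \<psi> m (B (U x)))) *\<^sub>R bochner_integral_in X M (\<lambda>x. likelihood \<psi> m (B (U x)) *\<^sub>R G (U x))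
      = posterior_mean G B m"
    "posterior_mean G B m \<in> elts X"
proof -
  obtain \<sigma> where pos: "0 < (LINT x|M. exp (log_likelihood (B (U x)) m))"
    and int: "\<And>a. 0 \<le> a \<Longrightarrow> integrable M (\<lambda>x. (1 + R x) powr a * exp (log_likelihood (B (U x)) m))"
  proof -
    show thesis
      by (rule posterior_moment_bound) (rule that; use B m in blast)
  qed
  let ?L = "\<lambda>x. exp (log_likelihood (B (U x)) m)" and ?l = "\<lambda>x. likelihood \<psi> m (B (U x))"
  define h where "h x = ?l x *\<^sub>R G (U x)" for x
  note B' = op_le_lower[OF B]
  have eq: "AE x in M. ?L x = ?l x"
    using U_X by eventually_elim (use likelihood_eq[OF \<psi> d _ op_leD(1)[OF B']] r in auto)
  have L_meas: "?L \<in> borel_measurable M" using log_likelihood_measurable[OF B'] by measurable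
  have l_meas: "?l \<in> borel_measurable M" by (rule borel_measurable_AE_eq[OF L_meas eq])
  have L_int: "integrable M ?L"
    using pos not_integrable_integral_eq by fastforce
  have l_eq: "(LINT x|M. ?l x) = (LINT x|M. ?L x)"
    by (rule integral_cong_AE[OF l_meas L_meas]) (use eq in auto)
  show "integrable M ?l" by (rule integrable_cong_AE_imp[OF L_int l_meas]) (use eq in auto)
  show "0 < (LINT x|M. ?l x)" using pos l_eq by simp
  have h_meas: "(\<lambda>x. h x j) \<in> borel_measurable M" for j
    using l_meas image_measurable[OF G q, of j] by (simp add: h_def scaleR_fun_def)
  have h_AE: "AE x in M. h x \<in> elts X \<and> nrm X (h x) \<le> c * ((1 + R x) powr q * ?L x)"
    using U_X eq
  proof eventually_elim
    case (elim x)
    then have uX: "U x \<in> elts X" and uR: "nrm X (U x) \<le> R x" by auto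
    note GX = growth_lipschitzD(1)[OF G uX]
    have "nrm X (h x) = nrm X (?L x *\<^sub>R G (U x))" using elim by (simp add: h_def)
    also have "\<dots> = ?L x * nrm X (G (U x))"
      using besov_scaleR(2)[OF p GX, of "?L x"] by simp
    also have "\<dots> \<le> ?L x * (c * (1 + nrm X (U x)) powr q)"
      using growth_lipschitzD(2)[OF G uX] by (intro mult_left_mono) auto
    also have "\<dots> \<le> ?L x * (c * (1 + R x) powr q)"
      using uR q growth_lipschitz_nonneg[OF p G] besov_nrm_nonneg[OF p, of d t "U x"]
      by (intro mult_left_mono powr_mono2) auto
    finally show ?case using besov_scaleR(1)[OF p GX] by (simp add: h_def mult_ac)
  qed
  have nh_meas: "(\<lambda>x. nrm X (h x)) \<in> borel_measurable M"
    unfolding besov_eq by (rule seq_space_nrm_measurable[where h = h]) (use p h_meas in auto)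
  have h_int: "integrable M (\<lambda>x. nrm X (h x))"
  proof (rule Bochner_Integration.integrable_bound)
    show "integrable M (\<lambda>x. c * ((1 + R x) powr q * ?L x))" using int[OF q] by simp
    show "AE x in M. norm (nrm X (h x)) \<le> norm (c * ((1 + R x) powr q * ?L x))"
      using h_AE by eventually_elim (use besov_nrm_nonneg[OF p] in auto)
  qed (rule nh_meas)
  have hE: "AE x in M. h x \<in> elts (seq_space (besov_weight d t p) p)" using h_AE by (simp add: besov_eq)
  note bochner = has_bochner_integral_in_seq_space[where a = "besov_weight d t p" and h = h, OF besov_weight_pos p finite_measure_axioms h_meas hE h_int[unfolded besov_eq]]
    bochner_integral_in_seq_space[where a = "besov_weight d t p" and h = h, OF besov_weight_pos p finite_measure_axioms h_meas hE h_int[unfolded besov_eq]]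
  show "\<exists>v. has_bochner_integral_in X M (\<lambda>x. ?l x *\<^sub>R G (U x)) v"
    using bochner(1) unfolding besov_eq h_def by blast
  have "(LINT x|M. h x j) = (LINT x|M. (?L x *\<^sub>R G (U x)) j)" for j
  proof (rule integral_cong_AE[OF h_meas])
    show "(\<lambda>x. (?L x *\<^sub>R G (U x)) j) \<in> borel_measurable M"
      using L_meas image_measurable[OF G q, of j] by (simp add: scaleR_fun_def)
    show "AE x in M. h x j = (?L x *\<^sub>R G (U x)) j" using eq by eventually_elim (simp add: h_def)
  qed
  then show *: "(1 / (LINT x|M. ?l x)) *\<^sub>R bochner_integral_in X M (\<lambda>x. ?l x *\<^sub>R G (U x)) = posterior_mean G B m"
    unfolding posterior_mean_def l_eq using bochner(2) by (simp add: besov_eq h_def[abs_def])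
  have "(\<lambda>j. LINT x|M. h x j) \<in> elts X"
    using bochner(1) unfolding besov_eq has_bochner_integral_in_def by blast
  then have "bochner_integral_in X M (\<lambda>x. ?l x *\<^sub>R G (U x)) \<in> elts X"
    using bochner(2) unfolding besov_eq h_def by simp
  then show "posterior_mean G B m \<in> elts X"
    unfolding *[symmetric] by (rule besov_scaleR(1)[OF p])
qed

text \<open>Counting powers of \<open>1 + K\<close>: the log-likelihoods differ by
  \<open>\<epsilon>\<close> times a factor of order \<open>1 + K\<close>, and this multiplies
  moments of total order \<open>q + 2\<close>, each unit of order contributing
  \<open>\<beta> / p\<close>. Hence the exponent \<open>1 + \<beta> * (q + 2) / p\<close>.\<close>

lemma posterior_mean_stability:
  assumes q: "0 \<le> q" and \<gamma>: "1 + \<beta> * (q + 2) / p \<le> \<gamma>"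
  obtains D where "0 \<le> D"
    "\<And>G1 G2 B1 B2 m1 m2 K \<epsilon>. growth_lipschitz X c q G1 \<Longrightarrow> growth_lipschitz X c q G2 \<Longrightarrow>
      op_le X Y A B1 \<Longrightarrow> op_le X Y A B2 \<Longrightarrow>
      m1 \<in> elts W \<Longrightarrow> m2 \<in> elts W \<Longrightarrow>
      nrm W m1 \<le> K \<Longrightarrow> nrm W m2 \<le> K \<Longrightarrow>
      nrm W (m1 - m2) \<le> \<epsilon> \<Longrightarrow>
      (\<And>u. u \<in> elts (besov d t' p) \<Longrightarrow>
        nrm X (G1 u - G2 u) \<le> c * (\<epsilon> * nrm (besov d t' p) u) * (1 + nrm (besov d t' p) u) powr q) \<Longrightarrow>
      (\<And>u. u \<in> elts (besov d t' p) \<Longrightarrow> nrm (besov d r 1) (B1 u - B2 u) \<le> \<epsilon> * nrm (besov d t' p) u) \<Longrightarrow>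
      nrm X (posterior_mean G1 B1 m1 - posterior_mean G2 B2 m2) \<le> D * (1 + K) powr \<gamma> * \<epsilon>"
proof -
  obtain \<sigma> where \<sigma>0: "\<And>a. 0 \<le> a \<Longrightarrow> 0 \<le> \<sigma> a"
    and pos: "\<And>B m K. op_le X Y A B \<Longrightarrow> m \<in> elts W \<Longrightarrow> nrm W m \<le> K \<Longrightarrow>
      0 < (LINT x|M. exp (log_likelihood (B (U x)) m))"
    and int: "\<And>B m K a. op_le X Y A B \<Longrightarrow> m \<in> elts W \<Longrightarrow> nrm W m \<le> K \<Longrightarrow> 0 \<le> a \<Longrightarrow>
      integrable M (\<lambda>x. (1 + R x) powr a * exp (log_likelihood (B (U x)) m))"
    and le: "\<And>B m K a. op_le X Y A B \<Longrightarrow> m \<in> elts W \<Longrightarrow> nrm W m \<le> K \<Longrightarrow> 0 \<le> a \<Longrightarrow>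
      (LINT x|M. (1 + R x) powr a * exp (log_likelihood (B (U x)) m))
        \<le> \<sigma> a * (1 + K) powr (\<beta> * a / p) * (LINT x|M. exp (log_likelihood (B (U x)) m))"
    by (rule posterior_moment_bound) blast
  \<comment> \<open>The part \<open>2 * A + 1\<close> comes from changing the operator, another
    \<open>A\<close> from changing the data.\<close>
  define H where "H = 3 * A + 1"
  have H: "1 \<le> H" using A by (simp add: H_def)
  define D where "D = \<bar>c\<bar> * (\<sigma> (q + 1) + 3 * H * \<sigma> (q + 2) + 6 * H * \<sigma> q * \<sigma> 2)"
  show thesis
  proof (rule that[of D])
    show "0 \<le> D" unfolding D_def using \<sigma>0 q H by simp
    fix G1 G2 B1 B2 m1 m2 K \<epsilon>
    assume G: "growth_lipschitz X c q G1" "growth_lipschitz X c q G2"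
      and B: "op_le X Y A B1" "op_le X Y A B2"
      and m: "m1 \<in> elts W" "m2 \<in> elts W"
      and mK: "nrm W m1 \<le> K" "nrm W m2 \<le> K"
      and md: "nrm W (m1 - m2) \<le> \<epsilon>"
      and Gd: "\<And>u. u \<in> elts (besov d t' p) \<Longrightarrow>
        nrm X (G1 u - G2 u) \<le> c * (\<epsilon> * nrm (besov d t' p) u) * (1 + nrm (besov d t' p) u) powr q"
      and Bd: "\<And>u. u \<in> elts (besov d t' p) \<Longrightarrow> nrm (besov d r 1) (B1 u - B2 u) \<le> \<epsilon> * nrm (besov d t' p) u"
    have K: "0 \<le> K" using besov_inf_nrm_nonneg[OF m(1)] mK(1) by simp
    have \<epsilon>: "0 \<le> \<epsilon>" using besov_inf_nrm_nonneg[OF besov_inf_diff[OF m]] md by simp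
    have c: "0 \<le> c" by (rule growth_lipschitz_nonneg[OF p G(1)])
    define S where "S a = \<sigma> a * (1 + K) powr (\<beta> * a / p)" for a
    have G_bound: "AE x in M. G (U x) \<in> elts X \<and> nrm X (G (U x)) \<le> c * (1 + R x) powr q"
      if G: "growth_lipschitz X c q G" for G
      using U_X
    proof eventually_elim
      case (elim x)
      then have uX: "U x \<in> elts X" and uR: "nrm X (U x) \<le> R x" by auto
      have "nrm X (G (U x)) \<le> c * (1 + nrm X (U x)) powr q" by (rule growth_lipschitzD(2)[OF G uX])
      also have "\<dots> \<le> c * (1 + R x) powr q"
        using uR q c besov_nrm_nonneg[OF p, of d t "U x"] by (intro mult_left_mono powr_mono2) auto
      finally show ?case using growth_lipschitzD(1)[OF G uX] by simp
    qed
    have G_diff: "AE x in M. nrm X (G1 (U x) - G2 (U x)) \<le> \<epsilon> * c * (1 + R x) powr (q + 1)"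
      using U_AE
    proof eventually_elim
      case (elim x)
      have "nrm X (G1 (U x) - G2 (U x)) \<le> c * (\<epsilon> * R x) * (1 + R x) powr q" by (rule Gd[OF elim])
      also have "\<dots> \<le> c * (\<epsilon> * (1 + R x)) * (1 + R x) powr q"
        using c \<epsilon> by (intro mult_right_mono mult_left_mono) auto
      also have "\<dots> = \<epsilon> * c * (1 + R x) powr (q + 1)" using R_nonneg[of x] by (simp add: powr_add mult_ac)
      finally show ?case .
    qed
    have \<Phi>_diff: "AE x in M. \<bar>log_likelihood (B1 (U x)) m1 - log_likelihood (B2 (U x)) m2\<bar> \<le> \<epsilon> * (H * (1 + K)) * (1 + R x) powr 2"
      using U_AE U_X
    proof eventually_elim
      case (elim x)
      then have uX: "U x \<in> elts X" and uR: "nrm X (U x) \<le> R x" by auto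
      let ?n = "nrm (besov d r 1)"
      note z = op_leD(1)[OF op_le_lower[OF B(1)] uX] op_leD(1)[OF op_le_lower[OF B(2)] uX]
      have zn: "?n (B (U x)) \<le> A * R x" if "op_le X Y A B" for B
        using op_leD(2)[OF op_le_lower[OF that] uX] mult_left_mono[OF uR A] by simp
      have "\<bar>log_likelihood (B1 (U x)) m1 - log_likelihood (B2 (U x)) m2\<bar>
          \<le> ?n (B1 (U x) - B2 (U x)) * (?n (B1 (U x)) + ?n (B2 (U x)) + nrm W m1)
            + ?n (B2 (U x)) * nrm W (m1 - m2)"
        by (rule log_likelihood_diff[OF d _ z m]) (use r in simp)
      also have "\<dots> \<le> (\<epsilon> * R x) * (A * R x + A * R x + K) + (A * R x) * \<epsilon>"
        using Bd[OF elim(1)] zn[OF B(1)] zn[OF B(2)] mK md A \<epsilon> K R_nonneg[of x]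
          besov_nrm_nonneg[of 1] besov_inf_nrm_nonneg[OF m(1)] besov_inf_nrm_nonneg[OF besov_inf_diff[OF m]]
        by (intro add_mono mult_mono) (auto intro!: add_nonneg_nonneg)
      also have "\<dots> = \<epsilon> * (R x * (A * R x + A * R x + K) + A * R x)" by (simp add: algebra_simps)
      also have "\<dots> \<le> \<epsilon> * (H * (1 + K) * ((1 + R x) * (1 + R x)))"
      proof (rule mult_left_mono[OF _ \<epsilon>])
        have "A * R x + A * R x + K \<le> (2 * A + 1) * (1 + K) * (1 + R x)"
          using A K R_nonneg[of x] by (simp add: algebra_simps add_nonneg_nonneg)
        then have "R x * (A * R x + A * R x + K) \<le> (1 + R x) * ((2 * A + 1) * (1 + K) * (1 + R x))"
          using A K R_nonneg[of x] by (intro mult_mono) auto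
        moreover have "A * R x * 1 \<le> A * (1 + R x) * ((1 + K) * (1 + R x))"
        proof (intro mult_mono)
          have "1 * 1 \<le> (1 + K) * (1 + R x)" using K R_nonneg[of x] by (intro mult_mono) auto
          then show "1 \<le> (1 + K) * (1 + R x)" by simp
        qed (use A R_nonneg[of x] in auto)
        ultimately show "R x * (A * R x + A * R x + K) + A * R x \<le> H * (1 + K) * ((1 + R x) * (1 + R x))"
          by (simp add: H_def algebra_simps)
      qed
      also have "(1 + R x) * (1 + R x) = (1 + R x) powr 2"
        using R_nonneg[of x] by (simp add: power2_eq_square)
      finally show ?case by (simp add: mult_ac)
    qed
    have q': "b \<in> {0, q, q + 1, q + 2, 2} \<Longrightarrow> 0 \<le> b" for b using q by auto
    have "nrm X (posterior_mean G1 B1 m1 - posterior_mean G2 B2 m2)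
        \<le> c * \<epsilon> * (S (q + 1) + 3 * (H * (1 + K)) * S (q + 2) + 6 * (H * (1 + K)) * S q * S 2)"
      unfolding posterior_mean_def besov_eq[of d t p]
      by (rule weighted_mean_stability(2)[where a = "besov_weight d t p" and S = S and R = "\<lambda>x. R x"
            and ?G1.0 = "\<lambda>x. G1 (U x)" and ?G2.0 = "\<lambda>x. G2 (U x)", OF besov_weight_pos p R_nonneg
            image_measurable[OF G(1) q] image_measurable[OF G(2) q]
            G_bound[OF G(1), unfolded besov_eq[of d t p]] G_bound[OF G(2), unfolded besov_eq[of d t p]] G_diff[unfolded besov_eq[of d t p]]
            log_likelihood_measurable[OF B(1)] log_likelihood_measurable[OF B(2)] \<Phi>_diff c \<epsilon>])
         (use H K int[OF B(1) m(1) mK(1)] int[OF B(2) m(2) mK(2)] le[OF B(1) m(1) mK(1)] le[OF B(2) m(2) mK(2)]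
            pos[OF B(1) m(1) mK(1)] pos[OF B(2) m(2) mK(2)] q q' in \<open>auto simp: S_def\<close>)
    also have "\<dots> \<le> c * \<epsilon> * ((\<sigma> (q + 1) + 3 * H * \<sigma> (q + 2) + 6 * H * \<sigma> q * \<sigma> 2) * (1 + K) powr \<gamma>)"
    proof (rule mult_left_mono)
      have mono: "x \<le> \<gamma> \<Longrightarrow> (1 + K) powr x \<le> (1 + K) powr \<gamma>" for x using K by (intro powr_mono) auto
      have \<gamma>1: "\<beta> * (q + 1) / p \<le> \<gamma>"
      proof -
        have "\<beta> * (q + 1) / p \<le> \<beta> * (q + 2) / p" using \<beta>_nonneg p by (intro divide_right_mono mult_left_mono) auto
        then show ?thesis using \<gamma> by linarith
      qed
      have K1: "1 + K = (1 + K) powr 1" using K by simp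
      have 1: "S (q + 1) \<le> \<sigma> (q + 1) * (1 + K) powr \<gamma>"
        unfolding S_def using \<sigma>0 q by (intro mult_left_mono mono \<gamma>1) auto
      have "(1 + K) * (1 + K) powr (\<beta> * (q + 2) / p) = (1 + K) powr (1 + \<beta> * (q + 2) / p)"
        unfolding powr_add using K by simp
      then have "\<sigma> (q + 2) * ((1 + K) * (1 + K) powr (\<beta> * (q + 2) / p)) \<le> \<sigma> (q + 2) * (1 + K) powr \<gamma>"
        using \<sigma>0[of "q + 2"] q mono[OF \<gamma>] by (simp add: mult_left_mono)
      then have 2: "(1 + K) * S (q + 2) \<le> \<sigma> (q + 2) * (1 + K) powr \<gamma>"
        by (simp only: S_def mult_ac)
      have "\<beta> * q / p + \<beta> * 2 / p = \<beta> * (q + 2) / p" by (simp add: algebra_simps add_divide_distrib)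
      then have "(1 + K) powr (\<beta> * q / p) * (1 + K) powr (\<beta> * 2 / p) = (1 + K) powr (\<beta> * (q + 2) / p)"
        by (simp only: powr_add[symmetric])
      then have "(1 + K) * ((1 + K) powr (\<beta> * q / p) * (1 + K) powr (\<beta> * 2 / p)) = (1 + K) powr (1 + \<beta> * (q + 2) / p)"
        unfolding powr_add[of _ 1] using K by simp
      then have "(\<sigma> q * \<sigma> 2) * ((1 + K) * ((1 + K) powr (\<beta> * q / p) * (1 + K) powr (\<beta> * 2 / p))) \<le> (\<sigma> q * \<sigma> 2) * (1 + K) powr \<gamma>"
        using \<sigma>0[of q] \<sigma>0[of 2] q mono[OF \<gamma>] by (simp add: mult_left_mono)
      then have 3: "(1 + K) * (S q * S 2) \<le> \<sigma> q * \<sigma> 2 * (1 + K) powr \<gamma>"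
        by (simp add: S_def mult_ac)
      have "S (q + 1) + 3 * (H * (1 + K)) * S (q + 2) + 6 * (H * (1 + K)) * S q * S 2
          = S (q + 1) + 3 * H * ((1 + K) * S (q + 2)) + 6 * H * ((1 + K) * (S q * S 2))" by (simp add: algebra_simps)
      also have "\<dots> \<le> \<sigma> (q + 1) * (1 + K) powr \<gamma> + 3 * H * (\<sigma> (q + 2) * (1 + K) powr \<gamma>) + 6 * H * (\<sigma> q * \<sigma> 2 * (1 + K) powr \<gamma>)"
        using H by (intro add_mono mult_left_mono 1 2 3) auto
      finally show "S (q + 1) + 3 * (H * (1 + K)) * S (q + 2) + 6 * (H * (1 + K)) * S q * S 2
          \<le> (\<sigma> (q + 1) + 3 * H * \<sigma> (q + 2) + 6 * H * \<sigma> q * \<sigma> 2) * (1 + K) powr \<gamma>"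
        by (simp add: algebra_simps)
    qed (use c \<epsilon> in simp)
    also have "\<dots> = D * (1 + K) powr \<gamma> * \<epsilon>" using c by (simp add: D_def mult_ac)
    finally show "nrm X (posterior_mean G1 B1 m1 - posterior_mean G2 B2 m2) \<le> D * (1 + K) powr \<gamma> * \<epsilon>" .
  qed
qed

end

end

section \<open>The error estimate and the two limits\<close>

lemma besov_nrm_minus_commute:
  assumes "1 \<le> p" "u \<in> elts (besov d \<sigma> p)" "v \<in> elts (besov d \<sigma> p)"
  shows "nrm (besov d \<sigma> p) (u - v) = nrm (besov d \<sigma> p) (v - u)"
  using besov_scaleR(2)[OF assms(1) besov_diff(1)[OF assms], of "-1"] by simp

lemma besov_inf_0: "nrm (besov_inf d \<sigma>) 0 = 0"
  by (simp add: besov_inf_def)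

lemma converges_in_bound:
  assumes "v \<in> elts X" "\<And>n. 1 \<le> n \<Longrightarrow> f n \<in> elts X" "\<And>n. 1 \<le> n \<Longrightarrow> nrm X (f n - v) \<le> \<epsilon> n"
    and "\<And>u. 0 \<le> nrm X u" "\<epsilon> \<longlonglongrightarrow> 0"
  shows "converges_in X f v"
  unfolding converges_in_def
proof (intro conjI)
  show "\<forall>\<^sub>F n in sequentially. f n \<in> elts X" using assms(2) by (rule eventually_sequentiallyI)
  show "(\<lambda>n. nrm X (f n - v)) \<longlonglongrightarrow> 0"
    by (rule Lim_null_comparison[OF _ assms(5)], rule eventually_sequentiallyI[of 1]) (use assms(3,4) in simp)
qed (rule assms(1))

theorem theorem19:
  fixes \<psi> :: "nat \<Rightarrow> real ^ 'd \<Rightarrow> real"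
    and N :: nat
    and \<Omega> :: "'a measure"
    and U :: "'a \<Rightarrow> nat \<Rightarrow> real"
    and s p t t' r r' w q c C :: real
    and A g :: "(nat \<Rightarrow> real) \<Rightarrow> nat \<Rightarrow> real"
  assumes basis: "wavelet_basis N \<psi>"
    and regularity: "\<forall>\<sigma>\<in>{s, t, t', r, r'}. \<bar>\<sigma>\<bar> < real N"
    and p: "1 \<le> p"
    and prob: "prob_space \<Omega>"
    and prior: "besov_prior CARD('d) s p \<Omega> U"
    and t: "t < t'" "t' < s - real CARD('d) / p"
    and r: "r' > r" "r > real CARD('d) / 2"
    and w: "r \<le> w" "w \<le> r'" "p = 1 \<longrightarrow> w > r"
    and A: "bounded_op (besov CARD('d) t p) (besov CARD('d) r' 1) A"
    and q: "0 \<le> q"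
    and g_maps: "\<forall>u\<in>elts (besov CARD('d) t p). g u \<in> elts (besov CARD('d) t p)"
    and g_growth: "\<forall>u\<in>elts (besov CARD('d) t p).
        nrm (besov CARD('d) t p) (g u) \<le> c * (1 + nrm (besov CARD('d) t p) u) powr q"
    and g_lipschitz: "\<forall>u1\<in>elts (besov CARD('d) t p). \<forall>u2\<in>elts (besov CARD('d) t p).
        nrm (besov CARD('d) t p) (g u1 - g u2)
          \<le> c * nrm (besov CARD('d) t p) (u1 - u2) *
            (1 + max (nrm (besov CARD('d) t p) u1) (nrm (besov CARD('d) t p) u2)) powr q"
    and T_bound: "\<forall>n\<ge>1. bounded_op (besov CARD('d) t' p) (besov CARD('d) t' p) (truncation n) \<and>
        op_norm (besov CARD('d) t' p) (besov CARD('d) t' p) (truncation n) \<le> C"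
  shows "\<exists>C'. \<forall>(P :: nat \<Rightarrow> (nat \<Rightarrow> real) \<Rightarrow> nat \<Rightarrow> real) (\<eta>1 :: nat \<Rightarrow> real) \<eta>2 \<eta>3 K m mk.
      (\<forall>n\<ge>1. bounded_op (besov CARD('d) t' p) (besov CARD('d) t p) (\<lambda>u. u - truncation n u) \<and>
         op_norm (besov CARD('d) t' p) (besov CARD('d) t p) (\<lambda>u. u - truncation n u) < \<eta>2 n) \<and>
      \<eta>2 \<longlonglongrightarrow> 0 \<and>
      (\<forall>k\<ge>1. bounded_op (besov CARD('d) r' 1) (besov CARD('d) r' 1) (P k) \<and>
         (\<forall>u\<in>elts (besov CARD('d) r' 1). P k (P k u) = P k u) \<and>
         dim (P k ` elts (besov CARD('d) r' 1)) = k \<and>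
         bounded_op (besov CARD('d) r' 1) (besov CARD('d) r 1) (\<lambda>u. u - P k u) \<and>
         op_norm (besov CARD('d) r' 1) (besov CARD('d) r 1) (\<lambda>u. u - P k u) < \<eta>1 k \<and>
         op_norm (besov CARD('d) r' 1) (besov CARD('d) r' 1) (P k) \<le> C) \<and>
      \<eta>1 \<longlonglongrightarrow> 0 \<and>
      m \<in> elts (besov_inf CARD('d) (- r)) \<and> nrm (besov_inf CARD('d) (- r)) m \<le> K \<and>
      (\<forall>k\<ge>1. mk k \<in> elts (besov_inf CARD('d) (- r)) \<and>
         nrm (besov_inf CARD('d) (- r)) (mk k) \<le> K \<and>
         \<eta>3 k = nrm (besov_inf CARD('d) (- r)) (mk k - m)) \<and>
      \<eta>3 \<longlonglongrightarrow> 0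
    \<longrightarrow>
      R_M_exists \<psi> (besov CARD('d) t p) \<Omega> U A g m \<and>
      (\<forall>k\<ge>1. \<forall>n\<ge>1.
         R_Theta_exists \<psi> (besov CARD('d) t p) \<Omega> U A g (P k) n (mk k) \<and>
         nrm (besov CARD('d) t p)
             (R_Theta \<psi> (besov CARD('d) t p) \<Omega> U A g (P k) n (mk k)
                - R_M \<psi> (besov CARD('d) t p) \<Omega> U A g m)
           \<le> C' * (1 + K) powr gamma_exponent p q r w * (\<eta>1 k + \<eta>2 n + \<eta>3 k)) \<and>
      (\<forall>k\<ge>1. \<exists>L. converges_in (besov CARD('d) t p)
         (\<lambda>n. R_Theta \<psi> (besov CARD('d) t p) \<Omega> U A g (P k) n (mk k)) L) \<and>
      (\<forall>n\<ge>1. \<exists>L. converges_in (besov CARD('d) t p)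
         (\<lambda>k. R_Theta \<psi> (besov CARD('d) t p) \<Omega> U A g (P k) n (mk k)) L)"
proof -
  let ?d = "CARD('d)"
  let ?X = "besov ?d t p" and ?X' = "besov ?d t' p" and ?Y = "besov ?d r' 1" and ?Yr = "besov ?d r 1" and ?W = "besov_inf ?d (- r)"
  let ?T = truncation
  define \<beta> where "\<beta> = 2 * w / (w - r + 2 * r * (1 - 1 / p))"
  define \<gamma> where "\<gamma> = gamma_exponent p q r w"
  have d: "0 < ?d" by simp
  interpret \<Omega>: prob_space \<Omega> by (rule prob)
  note mom = \<Omega>.besov_prior_moments[OF prior p d t(2)]
  interpret compl: prob_space "completion \<Omega>" by (rule \<Omega>.prob_space_completion)
  \<comment> \<open>The reconstructors integrate over the completion, so the moments of the prior
    are transferred there before the general estimates apply.\<close>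
  interpret N: besov_random_series "completion \<Omega>" U ?d t t' p
  proof unfold_locales
    show "(\<lambda>\<omega>. U \<omega> j) \<in> borel_measurable (completion \<Omega>)" for j by (rule measurable_completion[OF mom(1)])
    show "AE \<omega> in completion \<Omega>. U \<omega> \<in> elts ?X'" by (rule AE_completion[OF mom(2)])
    show "integrable (completion \<Omega>) (\<lambda>\<omega>. exp (1 / 2 * nrm ?X' (U \<omega>) powr p))"
      using mom(3) by (subst integrable_completion) auto
    show "integrable (completion \<Omega>) (\<lambda>\<omega>. U \<omega> j)" for j
      using mom(4) by (subst integrable_completion) auto
    show "(LINT \<omega>|completion \<Omega>. U \<omega> j) = 0" for j
      using mom(1,5) by (subst integral_completion) auto
  qed (use p t in auto)
  define a where "a = op_norm ?X ?Y A"
  \<comment> \<open>A common bound for \<open>A\<close>, for \<open>A\<close> after truncation, and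
    for either of them followed by \<open>P k\<close>. The absolute value makes the factor
    nonnegative whatever the sign of \<open>C\<close>.\<close>
  define b where "b = (\<bar>C\<bar> + 1) * a"
  have a: "0 \<le> a" unfolding a_def by (rule op_norm_bound(1)[OF p _ A]) simp
  have ab: "a \<le> b" "\<bar>C\<bar> * a \<le> b" and b: "0 \<le> b" using a by (auto simp: b_def algebra_simps)
  have opA: "op_le ?X ?Y a A" by (rule op_le_bounded_op[OF p _ A]) (simp_all add: a_def)
  have gL: "growth_lipschitz ?X c q g"
    unfolding growth_lipschitz_def using g_maps g_growth g_lipschitz by blast
  note gLT = growth_lipschitz_truncation[OF p q gL]
  have c: "0 \<le> c" by (rule growth_lipschitz_nonneg[OF p gL])
  note w' = r(2) w b \<beta>_def
  \<comment> \<open>With \<open>\<beta> = 2 * x\<close> this amounts to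
    \<open>(2 * q + 4) / p * x \<le> (2 * q + 8) / p * x\<close>.\<close>
  have \<beta>\<gamma>: "1 + \<beta> * (q + 2) / p \<le> \<gamma>"
  proof -
    define x where "x = w / (w - r + 2 * r * (1 - 1 / p))"
    have x: "0 \<le> x" using N.\<beta>_nonneg[OF w'] by (simp add: \<beta>_def x_def)
    have "\<beta> * (q + 2) / p = (2 * q + 4) / p * x" by (simp add: \<beta>_def x_def algebra_simps add_divide_distrib)
    also have "\<dots> \<le> (2 * q + 8) / p * x" using p x by (intro mult_right_mono divide_right_mono) auto
    finally show ?thesis by (simp add: \<gamma>_def gamma_exponent_def x_def)
  qed
  obtain D where D: "0 \<le> D" and stable:
    "\<And>G1 G2 B1 B2 m1 m2 K \<epsilon>. growth_lipschitz ?X c q G1 \<Longrightarrow> growth_lipschitz ?X c q G2 \<Longrightarrow>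
      op_le ?X ?Y b B1 \<Longrightarrow> op_le ?X ?Y b B2 \<Longrightarrow> m1 \<in> elts ?W \<Longrightarrow> m2 \<in> elts ?W \<Longrightarrow>
      nrm ?W m1 \<le> K \<Longrightarrow> nrm ?W m2 \<le> K \<Longrightarrow> nrm ?W (m1 - m2) \<le> \<epsilon> \<Longrightarrow>
      (\<And>u. u \<in> elts ?X' \<Longrightarrow> nrm ?X (G1 u - G2 u) \<le> c * (\<epsilon> * nrm ?X' u) * (1 + nrm ?X' u) powr q) \<Longrightarrow>
      (\<And>u. u \<in> elts ?X' \<Longrightarrow> nrm ?Yr (B1 u - B2 u) \<le> \<epsilon> * nrm ?X' u) \<Longrightarrow>
      nrm ?X (N.posterior_mean G1 B1 m1 - N.posterior_mean G2 B2 m2) \<le> D * (1 + K) powr \<gamma> * \<epsilon>"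
    using N.posterior_mean_stability[where c = c, OF w' q \<beta>\<gamma>] by blast
  from basis have \<psi>: "orthonormal_basis torus {1..} \<psi>" by (simp add: wavelet_basis_def)
  note mean = N.bochner_posterior_mean[OF w' \<psi> q]
  have nX: "0 \<le> nrm ?X u" "0 \<le> nrm ?X' u" for u by (rule besov_nrm_nonneg[OF p])+
  have X': "u \<in> elts ?X" "nrm ?X u \<le> nrm ?X' u" if "u \<in> elts ?X'" for u
    using besov_mono[OF p less_imp_le[OF t(1)] that] by auto
  have Yr: "u \<in> elts ?Yr" "nrm ?Yr u \<le> nrm ?Y u" if "u \<in> elts ?Y" for u
    using besov_mono[of 1 r r' u ?d] w that by auto
  show ?thesis
    unfolding \<gamma>_def[symmetric]
  \<comment> \<open>Both \<open>D\<close> and \<open>a\<close> are fixed before \<open>P\<close>,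
    \<open>K\<close> and the data. The summand \<open>a\<close> weighs the operator errors, the
    summand 1 the errors in \<open>g\<close> and in the data.\<close>
  proof (intro exI[of _ "D * (a + 1)"] allI impI, elim conjE)
    fix P :: "nat \<Rightarrow> (nat \<Rightarrow> real) \<Rightarrow> nat \<Rightarrow> real" and \<eta>1 \<eta>2 \<eta>3 :: "nat \<Rightarrow> real" and K m mk
    assume H2: "\<forall>n\<ge>1. bounded_op ?X' ?X (\<lambda>u. u - ?T n u) \<and> op_norm ?X' ?X (\<lambda>u. u - ?T n u) < \<eta>2 n"
      and \<eta>2: "\<eta>2 \<longlonglongrightarrow> 0"
      and H1: "\<forall>k\<ge>1. bounded_op ?Y ?Y (P k) \<and> (\<forall>u\<in>elts ?Y. P k (P k u) = P k u) \<and> dim (P k ` elts ?Y) = k \<and>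
         bounded_op ?Y ?Yr (\<lambda>u. u - P k u) \<and> op_norm ?Y ?Yr (\<lambda>u. u - P k u) < \<eta>1 k \<and> op_norm ?Y ?Y (P k) \<le> C"
      and \<eta>1: "\<eta>1 \<longlonglongrightarrow> 0" and m: "m \<in> elts ?W" "nrm ?W m \<le> K"
      and H3: "\<forall>k\<ge>1. mk k \<in> elts ?W \<and> nrm ?W (mk k) \<le> K \<and> \<eta>3 k = nrm ?W (mk k - m)"
      and \<eta>3: "\<eta>3 \<longlonglongrightarrow> 0"
    have mk: "mk k \<in> elts ?W" "nrm ?W (mk k) \<le> K" "nrm ?W (mk k - m) = \<eta>3 k" if "1 \<le> k" for k
      using H3 that by auto
    have \<eta>2_pos: "0 \<le> \<eta>2 n" and T_diff: "u \<in> elts ?X' \<Longrightarrow> nrm ?X (u - ?T n u) \<le> \<eta>2 n * nrm ?X' u" if "1 \<le> n" for n u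
    proof -
      have *: "bounded_op ?X' ?X (\<lambda>u. u - ?T n u)" "op_norm ?X' ?X (\<lambda>u. u - ?T n u) < \<eta>2 n" using H2 that by auto
      show "0 \<le> \<eta>2 n" using op_norm_bound(1)[OF p p *(1)] *(2) by simp
      show "nrm ?X (u - ?T n u) \<le> \<eta>2 n * nrm ?X' u" if "u \<in> elts ?X'"
        by (rule op_leD(2)[OF op_le_bounded_op[OF p p *(1) less_imp_le[OF *(2)]] that])
    qed
    have \<eta>1_pos: "0 \<le> \<eta>1 k" and P_diff: "z \<in> elts ?Y \<Longrightarrow> nrm ?Yr (z - P k z) \<le> \<eta>1 k * nrm ?Y z"
      and opP: "op_le ?Y ?Y \<bar>C\<bar> (P k)" if "1 \<le> k" for k z
    proof -
      have *: "bounded_op ?Y ?Yr (\<lambda>u. u - P k u)" "op_norm ?Y ?Yr (\<lambda>u. u - P k u) < \<eta>1 k"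
        "bounded_op ?Y ?Y (P k)" "op_norm ?Y ?Y (P k) \<le> C" using H1 that by auto
      show "0 \<le> \<eta>1 k" using op_norm_bound(1)[OF _ _ *(1)] *(2) by simp
      show "nrm ?Yr (z - P k z) \<le> \<eta>1 k * nrm ?Y z" if "z \<in> elts ?Y"
        by (rule op_leD(2)[OF op_le_bounded_op[OF _ _ *(1) less_imp_le[OF *(2)]] that]) simp_all
      show "op_le ?Y ?Y \<bar>C\<bar> (P k)" by (rule op_le_bounded_op[OF _ _ *(3)]) (use *(4) in auto)
    qed
    have \<eta>3_pos: "0 \<le> \<eta>3 k" if "1 \<le> k" for k
      using besov_inf_nrm_nonneg[OF besov_inf_diff[OF mk(1)[OF that] m(1)]] mk(3)[OF that] by simp
    note opT = op_le_truncation[OF p, of ?d t]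
    have opAT: "op_le ?X ?Y a (\<lambda>u. A (?T n u))" for n using op_le_comp[OF opT opA a] by simp
    have opb: "op_le ?X ?Y b B" if "op_le ?X ?Y x B" "x \<le> b" for x B
      by (rule op_le_weaken[OF that besov_nrm_nonneg[OF p]])
    note o1 = opb[OF opA ab(1)] and o2 = opb[OF opAT ab(1)]
    have o3: "op_le ?X ?Y b (\<lambda>u. P k (A u))" if "1 \<le> k" for k
      by (rule opb[OF op_le_comp[OF opA opP[OF that]] ab(2)]) simp
    have o4: "op_le ?X ?Y b (\<lambda>u. P k (A (?T n u)))" if "1 \<le> k" for k n
      by (rule opb[OF op_le_comp[OF opAT opP[OF that]] ab(2)]) simp
    have R_M: "R_M_exists \<psi> ?X \<Omega> U A g m" "R_M \<psi> ?X \<Omega> U A g m = N.posterior_mean g A m"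
      "N.posterior_mean g A m \<in> elts ?X"
      unfolding R_M_exists_def R_M_def reconstructor_exists_def reconstructor_def
      using mean[OF gL o1 m(1)] by auto
    have R_\<Theta>: "R_Theta_exists \<psi> ?X \<Omega> U A g (P k) n (mk k)"
      "R_Theta \<psi> ?X \<Omega> U A g (P k) n (mk k) = N.posterior_mean (\<lambda>u. g (?T n u)) (\<lambda>u. P k (A (?T n u))) (mk k)"
      "N.posterior_mean (\<lambda>u. g (?T n u)) (\<lambda>u. P k (A (?T n u))) (mk k) \<in> elts ?X" if "1 \<le> k" for k n
      unfolding R_Theta_exists_def R_Theta_def reconstructor_exists_def reconstructor_def
      using mean[OF gLT[of n] o4[OF that, of n] mk(1)[OF that]] by auto
    have g_diff: "nrm ?X (g (?T n u) - g u) \<le> c * (\<epsilon> * nrm ?X' u) * (1 + nrm ?X' u) powr q"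
      if n: "1 \<le> n" and u: "u \<in> elts ?X'" and \<epsilon>: "\<eta>2 n \<le> \<epsilon>" for n u \<epsilon>
    proof -
      note uX = X'[OF u] and TX = besov_truncation[OF p, of n u ?d t]
      have "nrm ?X (g (?T n u) - g u) \<le> c * nrm ?X (?T n u - u) * (1 + max (nrm ?X (?T n u)) (nrm ?X u)) powr q"
        by (rule growth_lipschitzD(3)[OF gL TX uX(1)])
      also have "\<dots> \<le> c * (\<epsilon> * nrm ?X' u) * (1 + nrm ?X' u) powr q"
      proof (intro mult_mono mult_left_mono powr_mono2)
        show "nrm ?X (?T n u - u) \<le> \<epsilon> * nrm ?X' u"
          unfolding besov_nrm_minus_commute[OF p TX uX(1)]
          using T_diff[OF n u] mult_right_mono[OF \<epsilon> nX(2)[of u]] by linarith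
        show "1 + max (nrm ?X (?T n u)) (nrm ?X u) \<le> 1 + nrm ?X' u"
          using besov_truncation_le[OF p uX(1), of n] uX(2) by simp
        have "0 \<le> \<epsilon>" using \<eta>2_pos[OF n] \<epsilon> by simp
        then show "0 \<le> c * (\<epsilon> * nrm ?X' u)" using c nX by simp
      qed (use c q nX in \<open>auto simp: le_max_iff_disj intro: add_nonneg_nonneg\<close>)
      finally show ?thesis .
    qed
    have B_diff: "nrm ?Yr (B (?T n u) - B u) \<le> \<epsilon> * nrm ?X' u"
      if B: "op_le ?X ?Y x B" and x: "0 \<le> x" and n: "1 \<le> n" and u: "u \<in> elts ?X'" and \<epsilon>: "x * \<eta>2 n \<le> \<epsilon>" for B x n u \<epsilon>
    proof -
      note uX = X'(1)[OF u] and TX = besov_truncation[OF p, of n u ?d t]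
      note Tu = besov_diff(1)[OF p TX uX]
      have "nrm ?Yr (B (?T n u) - B u) = nrm ?Yr (B (?T n u - u))" by (simp only: op_le_diff[OF p B TX uX])
      also have "\<dots> \<le> nrm ?Y (B (?T n u - u))" by (rule Yr(2)[OF op_leD(1)[OF B Tu]])
      also have "\<dots> \<le> x * nrm ?X (?T n u - u)" by (rule op_leD(2)[OF B Tu])
      also have "\<dots> \<le> x * (\<eta>2 n * nrm ?X' u)"
        unfolding besov_nrm_minus_commute[OF p TX uX] by (rule mult_left_mono[OF T_diff[OF n u] x])
      also have "\<dots> \<le> \<epsilon> * nrm ?X' u" using mult_right_mono[OF \<epsilon> nX(2)[of u]] by (simp add: mult.assoc)
      finally show ?thesis .
    qed
    have PA_diff: "nrm ?Yr (P k (A (?T n u)) - A (?T n u)) \<le> \<epsilon> * nrm ?X' u"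
      if k: "1 \<le> k" and u: "u \<in> elts ?X'" and \<epsilon>: "\<eta>1 k * a \<le> \<epsilon>" for k n u \<epsilon>
    proof -
      note uX = X'[OF u]
      note z = op_leD(1)[OF opAT[of n] uX(1)]
      have "nrm ?Yr (P k (A (?T n u)) - A (?T n u)) = nrm ?Yr (A (?T n u) - P k (A (?T n u)))"
        by (rule besov_nrm_minus_commute[OF _ Yr(1)[OF op_leD(1)[OF opP[OF k] z]] Yr(1)[OF z]]) simp
      also have "\<dots> \<le> \<eta>1 k * nrm ?Y (A (?T n u))" by (rule P_diff[OF k z])
      also have "\<dots> \<le> \<eta>1 k * (a * nrm ?X u)" by (rule mult_left_mono[OF op_leD(2)[OF opAT uX(1)] \<eta>1_pos[OF k]])
      also have "\<dots> \<le> \<eta>1 k * (a * nrm ?X' u)" using uX(2) a \<eta>1_pos[OF k] by (intro mult_left_mono) auto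
      also have "\<dots> \<le> \<epsilon> * nrm ?X' u" using mult_right_mono[OF \<epsilon> nX(2)[of u]] by (simp add: mult.assoc)
      finally show ?thesis .
    qed
    let ?R = "\<lambda>k n. R_Theta \<psi> ?X \<Omega> U A g (P k) n (mk k)"
    have main: "nrm ?X (?R k n - R_M \<psi> ?X \<Omega> U A g m)
        \<le> D * (a + 1) * (1 + K) powr \<gamma> * (\<eta>1 k + \<eta>2 n + \<eta>3 k)" if k: "1 \<le> k" and n: "1 \<le> n" for k n
    proof -
      define \<epsilon> where "\<epsilon> = (a + 1) * (\<eta>1 k + \<eta>2 n + \<eta>3 k)"
      note pos = \<eta>1_pos[OF k] \<eta>2_pos[OF n] \<eta>3_pos[OF k]
      have a\<eta>: "0 \<le> a * \<eta>1 k" "0 \<le> a * \<eta>2 n" "0 \<le> a * \<eta>3 k" using a pos by auto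
      have "nrm ?X (N.posterior_mean (\<lambda>u. g (?T n u)) (\<lambda>u. P k (A (?T n u))) (mk k) - N.posterior_mean g A m)
          \<le> D * (1 + K) powr \<gamma> * \<epsilon>"
      proof (rule stable[OF gLT gL o4[OF k] o1 mk(1)[OF k] m(1) mk(2)[OF k] m(2)])
        show "nrm ?W (mk k - m) \<le> \<epsilon>" unfolding mk(3)[OF k] \<epsilon>_def using pos a\<eta> by (simp add: algebra_simps)
        fix u assume u: "u \<in> elts ?X'"
        show "nrm ?X (g (?T n u) - g u) \<le> c * (\<epsilon> * nrm ?X' u) * (1 + nrm ?X' u) powr q"
          by (rule g_diff[OF n u]) (use pos a\<eta> in \<open>simp add: \<epsilon>_def algebra_simps\<close>)
        note z = op_leD(1)[OF opAT[of n] X'(1)[OF u]] and z' = op_leD(1)[OF opA X'(1)[OF u]]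
        \<comment> \<open>Inserting \<open>A (?T n u)\<close> separates the projection error, of
          size \<open>\<eta>1 k * a\<close>, from the truncation error, of size
          \<open>a * \<eta>2 n\<close>.\<close>
        have "nrm ?Yr (P k (A (?T n u)) - A u)
            = nrm ?Yr ((P k (A (?T n u)) - A (?T n u)) + (A (?T n u) - A u))" by simp
        also have "\<dots> \<le> nrm ?Yr (P k (A (?T n u)) - A (?T n u)) + nrm ?Yr (A (?T n u) - A u)"
          by (intro besov_add(2) besov_diff(1) Yr(1) z z' op_leD(1)[OF opP[OF k]]) simp_all
        also have "\<dots> \<le> (\<eta>1 k * a) * nrm ?X' u + (a * \<eta>2 n) * nrm ?X' u"
          by (intro add_mono PA_diff[OF k u] B_diff[OF opA a n u] order_refl)
        also have "\<dots> = (\<eta>1 k * a + a * \<eta>2 n) * nrm ?X' u" by (simp add: algebra_simps)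
        also have "\<dots> \<le> \<epsilon> * nrm ?X' u"
          by (rule mult_right_mono[OF _ nX(2)]) (use pos a\<eta> in \<open>simp add: \<epsilon>_def algebra_simps\<close>)
        finally show "nrm ?Yr (P k (A (?T n u)) - A u) \<le> \<epsilon> * nrm ?X' u" .
      qed
      then show ?thesis unfolding R_\<Theta>(2)[OF k] R_M(2) by (simp add: \<epsilon>_def mult_ac)
    qed
    \<comment> \<open>The limit in \<open>n\<close> is the posterior mean for the operator
      \<open>P k\<close> after \<open>A\<close> with untruncated prior. The bound \<open>b\<close>
      of that operator replaces \<open>a\<close> in the error.\<close>
    have lim_n: "\<exists>L. converges_in ?X (\<lambda>n. ?R k n) L" if k: "1 \<le> k" for k
    proof (intro exI converges_in_bound)
      show "N.posterior_mean g (\<lambda>u. P k (A u)) (mk k) \<in> elts ?X" by (rule mean(5)[OF gL o3[OF k] mk(1)[OF k]])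
      show "?R k n \<in> elts ?X" for n using R_\<Theta>(2,3)[OF k, of n] by simp
      show "nrm ?X (?R k n - N.posterior_mean g (\<lambda>u. P k (A u)) (mk k))
          \<le> D * (1 + K) powr \<gamma> * ((b + 1) * \<eta>2 n)" if n: "1 \<le> n" for n
        unfolding R_\<Theta>(2)[OF k]
      proof (rule stable[OF gLT gL o4[OF k] o3[OF k] mk(1)[OF k] mk(1)[OF k] mk(2)[OF k] mk(2)[OF k]])
        have b\<eta>: "0 \<le> b * \<eta>2 n" using b \<eta>2_pos[OF n] by simp
        show "nrm ?W (mk k - mk k) \<le> (b + 1) * \<eta>2 n" using b \<eta>2_pos[OF n] by (simp only: diff_self besov_inf_0) simp
        fix u assume u: "u \<in> elts ?X'"
        show "nrm ?X (g (?T n u) - g u) \<le> c * ((b + 1) * \<eta>2 n * nrm ?X' u) * (1 + nrm ?X' u) powr q"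
          by (rule g_diff[OF n u]) (use b\<eta> in \<open>simp add: algebra_simps\<close>)
        show "nrm ?Yr (P k (A (?T n u)) - P k (A u)) \<le> (b + 1) * \<eta>2 n * nrm ?X' u"
          by (rule B_diff[OF o3[OF k] b n u]) (use \<eta>2_pos[OF n] in \<open>simp add: algebra_simps\<close>)
      qed
      show "(\<lambda>n. D * (1 + K) powr \<gamma> * ((b + 1) * \<eta>2 n)) \<longlonglongrightarrow> 0"
        using tendsto_mult_left[OF tendsto_mult_left[OF \<eta>2, of "b + 1"], of "D * (1 + K) powr \<gamma>"] by simp
    qed (rule nX)
    \<comment> \<open>The reference model keeps the truncation in both \<open>g\<close> and
      \<open>A\<close>, so that only projection and data errors remain.\<close>
    have lim_k: "\<exists>L. converges_in ?X (\<lambda>k. ?R k n) L" for n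
    proof (intro exI converges_in_bound)
      show "N.posterior_mean (\<lambda>u. g (?T n u)) (\<lambda>u. A (?T n u)) m \<in> elts ?X" by (rule mean(5)[OF gLT o2 m(1)])
      show "?R k n \<in> elts ?X" if "1 \<le> k" for k using R_\<Theta>(2,3)[OF that, of n] by simp
      show "nrm ?X (?R k n - N.posterior_mean (\<lambda>u. g (?T n u)) (\<lambda>u. A (?T n u)) m)
          \<le> D * (1 + K) powr \<gamma> * ((a + 1) * (\<eta>1 k + \<eta>3 k))" if k: "1 \<le> k" for k
        unfolding R_\<Theta>(2)[OF k]
      proof (rule stable[OF gLT gLT o4[OF k] o2 mk(1)[OF k] m(1) mk(2)[OF k] m(2)])
        note pos = \<eta>1_pos[OF k] \<eta>3_pos[OF k]
        have a\<eta>: "0 \<le> a * \<eta>1 k" "0 \<le> a * \<eta>3 k" using a pos by auto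
        show "nrm ?W (mk k - m) \<le> (a + 1) * (\<eta>1 k + \<eta>3 k)"
          unfolding mk(3)[OF k] using pos a\<eta> by (simp add: algebra_simps)
        fix u assume u: "u \<in> elts ?X'"
        have "0 \<le> c * ((a + 1) * (\<eta>1 k + \<eta>3 k) * nrm ?X' u) * (1 + nrm ?X' u) powr q"
          using c a pos nX by simp
        then show "nrm ?X (g (?T n u) - g (?T n u)) \<le> c * ((a + 1) * (\<eta>1 k + \<eta>3 k) * nrm ?X' u) * (1 + nrm ?X' u) powr q"
          by (simp only: diff_self besov_0(2)[OF p])
        show "nrm ?Yr (P k (A (?T n u)) - A (?T n u)) \<le> (a + 1) * (\<eta>1 k + \<eta>3 k) * nrm ?X' u"
          by (rule PA_diff[OF k u]) (use pos a\<eta> in \<open>simp add: algebra_simps\<close>)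
      qed
      show "(\<lambda>k. D * (1 + K) powr \<gamma> * ((a + 1) * (\<eta>1 k + \<eta>3 k))) \<longlonglongrightarrow> 0"
        using tendsto_mult_left[OF tendsto_mult_left[OF tendsto_add[OF \<eta>1 \<eta>3], of "a + 1"], of "D * (1 + K) powr \<gamma>"] by simp
    qed (rule nX)
    show "R_M_exists \<psi> ?X \<Omega> U A g m \<and>
      (\<forall>k\<ge>1. \<forall>n\<ge>1. R_Theta_exists \<psi> ?X \<Omega> U A g (P k) n (mk k) \<and>
         nrm ?X (R_Theta \<psi> ?X \<Omega> U A g (P k) n (mk k) - R_M \<psi> ?X \<Omega> U A g m)
           \<le> D * (a + 1) * (1 + K) powr \<gamma> * (\<eta>1 k + \<eta>2 n + \<eta>3 k)) \<and>
      (\<forall>k\<ge>1. \<exists>L. converges_in ?X (\<lambda>n. R_Theta \<psi> ?X \<Omega> U A g (P k) n (mk k)) L) \<and>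
      (\<forall>n\<ge>1. \<exists>L. converges_in ?X (\<lambda>k. R_Theta \<psi> ?X \<Omega> U A g (P k) n (mk k)) L)"
      using R_M(1) R_\<Theta>(1) main lim_n lim_k by blast
  qed
qed

end
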